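(* Let $\Omega$ be a set of finite perimeter in $\mathbb{H}^n$ bounded by a $C^2$ hypersurface $\Sigma=\partial\Omega$. If $\Omega$ is stationary, then $\Sigma$ has constant mean curvature.
   Context: $\mathbb{H}^n$ is $\mathbb{R}^{2n+1}\equiv\mathbb{C}^n\times\mathbb{R}$, with coordinates $[z,t]$, $z_k=x_k+iy_k$, and product $[z,t]*[z',t']=[z+z',t+t'+\mathrm{Im}(\sum_{i}z_i\overline{z}'_i)]$. Set $X_k=\partial_{x_k}+y_k\partial_t$, $Y_k=\partial_{y_k}-x_k\partial_t$ ($k=1,\dots,n$), $T=\partial_t$. The horizontal distribution is spanned by $\{X_k,Y_k\}$; $U_H$ denotes the projection of $U$ onto it, and $U$ is horizontal if $U=U_H$. $g=\langle\cdot,\cdot\rangle$ is the Riemannian metric making $\{X_k,Y_k,T\}$ orthonormal, with Riemannian volume element $dv$ (Lebesgue measure), divergence $\mathrm{div}$ and Levi-Civita connection $D$. The volume $\mathrm{vol}(\Omega)$ of a Borel set is its Riemannian volume, and its perimeter is $$\mathcal{P}(\Omega)=\sup\left\{\int_\Omega\mathrm{div}(U)\,dv:\ |U|\le1\right\},$$ the supremum being over $C^1$ horizontal vector fields with compact support. $\Omega$ has finite perimeter if $\mathrm{vol}(\Omega)$ and $\mathcal{P}(\Omega)$ are finite. For a $C^1$ vector field $U$ with compact support on $\mathbb{H}^n$ and associated group of diffeomorphisms $\{\varphi_t\}_{t\in\mathbb{R}}$, let $\Omega_t=\varphi_t(\Omega)$, $V(t)=\mathrm{vol}(\Omega_t)$,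 $\mathcal{P}(t)=\mathcal{P}(\Omega_t)$. The variation $\{\Omega_t\}$ preserves volume if $V(t)$ is constant for $t$ small enough. $\Omega$ is stationary if $\mathcal{P}'(0)=0$ for any volume preserving variation. "Bounded by a $C^2$ hypersurface $\Sigma$" means that $\Omega$ is an open set whose boundary $\Sigma=\partial\Omega$ is a $C^2$ embedded hypersurface, with well-defined unit normal $N$ in $(\mathbb{H}^n,g)$ pointing into $\Omega$. The singular set is $\Sigma_0=\{p\in\Sigma:N_H(p)=0\}$; on $\Sigma-\Sigma_0$ put $\nu_H=N_H/|N_H|$ and define the mean curvature $H$ by $-2nH=\mathrm{div}_\Sigma\,\nu_H$, where $\mathrm{div}_\Sigma U=\sum_{i=1}^{2n}\langle D_{e_i}U,e_i\rangle$ for any orthonormal basis $\{e_i\}$ of $T_p\Sigma$. $\Sigma$ has constant mean curvature if $H$ is constant on $\Sigma-\Sigma_0$. *)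

theory Defs
  imports "HOL-Analysis.Analysis"
begin

text \<open>
  The Heisenberg group \<open>H^n\<close>, as \<open>C^n \<times> R\<close> with \<open>n = CARD('n)\<close>. Tangent vectors at every
  point are identified with elements of the same vector space through the coordinates
  \<open>x_k, y_k, t\<close>, so a vector field is a function \<open>'n heis \<Rightarrow> 'n heis\<close>.
\<close>

type_synonym 'n heis = "(complex ^ 'n) \<times> real"

definition Xf :: "'n::finite \<Rightarrow> 'n heis \<Rightarrow> 'n heis" where
  "Xf k p = (axis k 1, Im (fst p $ k))"

definition Yf :: "'n::finite \<Rightarrow> 'n heis \<Rightarrow> 'n heis" where
  "Yf k p = (axis k \<i>, - Re (fst p $ k))"

definition Tf :: "'n::finite heis \<Rightarrow> 'n heis" where
  "Tf p = (0, 1)"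


section \<open>The Riemannian metric and its Levi-Civita connection\<close>

text \<open>The coefficient of \<open>T\<close> when \<open>u\<close> is expanded in the frame \<open>X_k, Y_k, T\<close> at \<open>p\<close>;
  the coefficients of \<open>X_k\<close> and \<open>Y_k\<close> are the real and imaginary parts of \<open>fst u $ k\<close>.\<close>

definition Tcoeff :: "'n::finite heis \<Rightarrow> 'n heis \<Rightarrow> real" where
  "Tcoeff p u = snd u - (\<Sum>k\<in>UNIV. Re (fst u $ k) * Im (fst p $ k) - Im (fst u $ k) * Re (fst p $ k))"

definition hmetric :: "'n::finite heis \<Rightarrow> 'n heis \<Rightarrow> 'n heis \<Rightarrow> real" where
  "hmetric p u v =
     (\<Sum>k\<in>UNIV. Re (fst u $ k) * Re (fst v $ k) + Im (fst u $ k) * Im (fst v $ k))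
     + Tcoeff p u * Tcoeff p v"

definition hnorm :: "'n::finite heis \<Rightarrow> 'n heis \<Rightarrow> real" where
  "hnorm p u = sqrt (hmetric p u u)"

text \<open>The following two lemmas characterize \<open>hmetric\<close> as the metric for which the frame is
  orthonormal.\<close>

lemma frame_expansion:
  "u = (\<Sum>k\<in>UNIV. Re (fst u $ k) *\<^sub>R Xf k p + Im (fst u $ k) *\<^sub>R Yf k p) + Tcoeff p u *\<^sub>R Tf p"
proof (rule prod_eqI)
  show "fst u = fst ((\<Sum>k\<in>UNIV. Re (fst u $ k) *\<^sub>R Xf k p + Im (fst u $ k) *\<^sub>R Yf k p)
                       + Tcoeff p u *\<^sub>R Tf p)"
  proof (rule vec_eq_iff[THEN iffD2], rule allI)
    fix j
    have "(\<Sum>k\<in>UNIV. Re (fst u $ k) *\<^sub>R (axis k 1 $ j :: complex) + Im (fst u $ k) *\<^sub>R (axis k \<i> $ j))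
          = (\<Sum>k\<in>UNIV. if k = j then fst u $ k else 0)"
      by (rule sum.cong) (auto simp: axis_def complex_eq_iff)
    then show "fst u $ j = fst ((\<Sum>k\<in>UNIV. Re (fst u $ k) *\<^sub>R Xf k p + Im (fst u $ k) *\<^sub>R Yf k p)
                       + Tcoeff p u *\<^sub>R Tf p) $ j"
      by (simp add: fst_sum Xf_def Yf_def Tf_def)
  qed
  show "snd u = snd ((\<Sum>k\<in>UNIV. Re (fst u $ k) *\<^sub>R Xf k p + Im (fst u $ k) *\<^sub>R Yf k p)
                       + Tcoeff p u *\<^sub>R Tf p)"
    by (simp add: snd_sum Xf_def Yf_def Tf_def Tcoeff_def)
qed

lemma Tcoeff_frame [simp]:
  "Tcoeff p (Xf k p) = 0" "Tcoeff p (Yf k p) = 0" "Tcoeff p (Tf p) = 1"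
proof -
  have "(\<Sum>j\<in>UNIV. Re (axis k 1 $ j) * Im (fst p $ j) - Im (axis k 1 $ j) * Re (fst p $ j))
        = (\<Sum>j\<in>UNIV. if j = k then Im (fst p $ j) else 0)"
    by (rule sum.cong) (auto simp: axis_def)
  then show "Tcoeff p (Xf k p) = 0" by (simp add: Tcoeff_def Xf_def)
  have "(\<Sum>j\<in>UNIV. Re (axis k \<i> $ j) * Im (fst p $ j) - Im (axis k \<i> $ j) * Re (fst p $ j))
        = (\<Sum>j\<in>UNIV. if j = k then - Re (fst p $ j) else 0)"
    by (rule sum.cong) (auto simp: axis_def)
  then show "Tcoeff p (Yf k p) = 0" by (simp add: Tcoeff_def Yf_def)
  show "Tcoeff p (Tf p) = 1" by (simp add: Tcoeff_def Tf_def)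
qed

lemma frame_orthonormal:
  "hmetric p (Xf k p) (Xf l p) = (if k = l then 1 else 0)"
  "hmetric p (Yf k p) (Yf l p) = (if k = l then 1 else 0)"
  "hmetric p (Xf k p) (Yf l p) = 0"
  "hmetric p (Xf k p) (Tf p) = 0"
  "hmetric p (Yf k p) (Tf p) = 0"
  "hmetric p (Tf p) (Tf p) = 1"
proof -
  have "(\<Sum>j\<in>UNIV. Re (axis k 1 $ j) * Re (axis l 1 $ j) + Im (axis k 1 $ j) * Im (axis l 1 $ j))
        = (\<Sum>j\<in>UNIV. if j = k then (if k = l then 1 else 0) else 0 :: real)"
    by (rule sum.cong) (auto simp: axis_def)
  also have "\<dots> = (if k = l then 1 else 0)" by simp
  finally show "hmetric p (Xf k p) (Xf l p) = (if k = l then 1 else 0)"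
    by (subst hmetric_def, subst Tcoeff_frame) (simp only: Xf_def fst_conv mult_zero_left add_0_right)
  have "(\<Sum>j\<in>UNIV. Re (axis k \<i> $ j) * Re (axis l \<i> $ j) + Im (axis k \<i> $ j) * Im (axis l \<i> $ j))
        = (\<Sum>j\<in>UNIV. if j = k then (if k = l then 1 else 0) else 0 :: real)"
    by (rule sum.cong) (auto simp: axis_def)
  also have "\<dots> = (if k = l then 1 else 0)" by simp
  finally show "hmetric p (Yf k p) (Yf l p) = (if k = l then 1 else 0)"
    by (subst hmetric_def, subst Tcoeff_frame) (simp only: Yf_def fst_conv mult_zero_left add_0_right)
  have "(\<Sum>j\<in>UNIV. Re (axis k 1 $ j) * Re (axis l \<i> $ j) + Im (axis k 1 $ j) * Im (axis l \<i> $ j))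
        = (0 :: real)"
    by (rule sum.neutral) (auto simp: axis_def)
  then show "hmetric p (Xf k p) (Yf l p) = 0"
    by (simp add: hmetric_def) (simp add: Xf_def Yf_def)
  show "hmetric p (Xf k p) (Tf p) = 0" "hmetric p (Yf k p) (Tf p) = 0" "hmetric p (Tf p) (Tf p) = 1"
    by (simp_all add: hmetric_def) (simp_all add: Tf_def)
qed

text \<open>The value at \<open>p\<close> of the covariant derivative of the constant-coefficient field \<open>v\<close> in
  the direction of the constant-coefficient field \<open>u\<close>. Such fields commute, so only the metric
  terms of the Koszul formula remain.\<close>

definition koszul :: "'n::finite heis \<Rightarrow> 'n heis \<Rightarrow> 'n heis \<Rightarrow> 'n heis \<Rightarrow> real" where
  "koszul p u v w =
     (frechet_derivative (\<lambda>q. hmetric q v w) (at p) u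
      + frechet_derivative (\<lambda>q. hmetric q u w) (at p) v
      - frechet_derivative (\<lambda>q. hmetric q u v) (at p) w) / 2"

definition christoffel :: "'n::finite heis \<Rightarrow> 'n heis \<Rightarrow> 'n heis \<Rightarrow> 'n heis" where
  "christoffel p u v = (THE c. \<forall>w. hmetric p c w = koszul p u v w)"

lemma Tcoeff_has_derivative:
  "((\<lambda>q. Tcoeff q u) has_derivative (\<lambda>a. Tcoeff a u - snd u)) (at p)"
proof -
  have "((\<lambda>q. fst q $ k) has_derivative (\<lambda>a. fst a $ k)) (at p)" for k
    by (intro bounded_linear_imp_has_derivative
        bounded_linear_compose[OF bounded_linear_vec_nth bounded_linear_fst])
  then show ?thesis
    unfolding Tcoeff_def by (auto intro!: derivative_eq_intros simp: algebra_simps)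
qed

lemma koszul_eq:
  "koszul p u v w =
     Tcoeff p v * (Tcoeff u w - snd w) + Tcoeff p u * (Tcoeff v w - snd w)"
proof -
  have d: "frechet_derivative (\<lambda>q. hmetric q a b) (at p)
      = (\<lambda>h. Tcoeff p a * (Tcoeff h b - snd b) + (Tcoeff h a - snd a) * Tcoeff p b)" for a b
    unfolding hmetric_def
    by (rule frechet_derivative_at[symmetric])
       (auto intro!: derivative_eq_intros Tcoeff_has_derivative)
  have anti: "Tcoeff a b - snd b = - (Tcoeff b a - snd a)" for a b :: "'a heis"
    by (simp add: Tcoeff_def sum_negf[symmetric] algebra_simps)
  show ?thesis
    unfolding koszul_def d using anti[of u v] anti[of u w] anti[of v w] by algebra
qed

lemma hmetric_nondegenerate:
  assumes "\<And>w. hmetric p c w = hmetric p c' w"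
  shows "c = c'"
proof -
  have add: "Tcoeff p (c - c') = Tcoeff p c - Tcoeff p c'"
    by (simp add: Tcoeff_def sum_subtractf sum.distrib algebra_simps)
  have sub: "hmetric p (c - c') w = hmetric p c w - hmetric p c' w" for w
    unfolding hmetric_def add by (simp add: sum_subtractf sum.distrib algebra_simps)
  have "hmetric p (c - c') (c - c') = 0"
    using assms sub by simp
  then have z: "(\<Sum>k\<in>UNIV. Re (fst (c - c') $ k) * Re (fst (c - c') $ k)
        + Im (fst (c - c') $ k) * Im (fst (c - c') $ k)) = 0"
    and t: "Tcoeff p (c - c') = 0"
    unfolding hmetric_def by (subst (asm) add_nonneg_eq_0_iff; simp add: sum_nonneg)+
  have "fst (c - c') $ k = 0" for k
  proof -
    have "Re (fst (c - c') $ k) * Re (fst (c - c') $ k)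
        + Im (fst (c - c') $ k) * Im (fst (c - c') $ k) = 0"
      using z by (subst (asm) sum_nonneg_eq_0_iff) auto
    then show ?thesis by (simp add: complex_eq_iff sum_squares_eq_zero_iff)
  qed
  then have "fst (c - c') = 0" by (simp add: vec_eq_iff)
  moreover from this t have "snd (c - c') = 0" by (simp add: Tcoeff_def)
  ultimately show ?thesis by (simp add: prod_eq_iff)
qed

lemma christoffel_unique: "\<exists>!c. \<forall>w. hmetric p c w = koszul p u v w"
proof -
  define z where "z = (\<chi> k. \<i> * (Tcoeff p v *\<^sub>R fst u $ k + Tcoeff p u *\<^sub>R fst v $ k))"
  define c where "c = (z, snd p - Tcoeff p (z, snd p))"
  have t: "Tcoeff p c = 0" by (simp add: c_def Tcoeff_def)
  have "hmetric p c w = koszul p u v w" for w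
    unfolding hmetric_def t koszul_eq
    by (simp add: c_def z_def Tcoeff_def[of u] Tcoeff_def[of v] sum_distrib_left
        sum.distrib[symmetric] sum_negf[symmetric] sum_subtractf[symmetric] algebra_simps)
  then show ?thesis by (metis hmetric_nondegenerate)
qed

lemma hmetric_christoffel: "hmetric p (christoffel p u v) w = koszul p u v w"
  using theI'[OF christoffel_unique] unfolding christoffel_def by blast

text \<open>The Levi-Civita derivative \<open>D\<^sub>v U\<close> at \<open>p\<close>. For a field defined on all of the space take
  \<open>S = UNIV\<close>; for a field along a hypersurface \<open>S\<close> take \<open>v\<close> tangent to \<open>S\<close>, in which case the
  derivative within \<open>S\<close> in the direction \<open>v\<close> only depends on the values of \<open>U\<close> on \<open>S\<close>.\<close>

definition levi_civita ::
  "'n::finite heis set \<Rightarrow> ('n heis \<Rightarrow> 'n heis) \<Rightarrow> 'n heis \<Rightarrow> 'n heis \<Rightarrow> 'n heis" where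
  "levi_civita S U p v = frechet_derivative U (at p within S) v + christoffel p v (U p)"

definition hdiv :: "('n::finite heis \<Rightarrow> 'n heis) \<Rightarrow> 'n heis \<Rightarrow> real" where
  "hdiv U p =
     (\<Sum>k\<in>UNIV. hmetric p (levi_civita UNIV U p (Xf k p)) (Xf k p)
               + hmetric p (levi_civita UNIV U p (Yf k p)) (Yf k p))
     + hmetric p (levi_civita UNIV U p (Tf p)) (Tf p)"

definition hproj :: "'n::finite heis \<Rightarrow> 'n heis \<Rightarrow> 'n heis" where
  "hproj p u = (\<Sum>k\<in>UNIV. hmetric p u (Xf k p) *\<^sub>R Xf k p + hmetric p u (Yf k p) *\<^sub>R Yf k p)"

definition horizontal :: "('n::finite heis \<Rightarrow> 'n heis) \<Rightarrow> bool" where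
  "horizontal U \<longleftrightarrow> (\<forall>p. hproj p (U p) = U p)"


section \<open>Volume, perimeter and stationary sets\<close>

definition C1_on :: "('a::real_normed_vector \<Rightarrow> 'b::real_normed_vector) \<Rightarrow> 'a set \<Rightarrow> bool" where
  "C1_on f W \<longleftrightarrow> (\<exists>f' :: 'a \<Rightarrow> 'a \<Rightarrow>\<^sub>L 'b.
     (\<forall>x\<in>W. (f has_derivative blinfun_apply (f' x)) (at x)) \<and> continuous_on W f')"

definition C2_on :: "('a::real_normed_vector \<Rightarrow> 'b::real_normed_vector) \<Rightarrow> 'a set \<Rightarrow> bool" where
  "C2_on f W \<longleftrightarrow> (\<exists>f' :: 'a \<Rightarrow> 'a \<Rightarrow>\<^sub>L 'b.
     (\<forall>x\<in>W. (f has_derivative blinfun_apply (f' x)) (at x)) \<and> C1_on f' W)"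

definition C1c_field :: "('n::finite heis \<Rightarrow> 'n heis) \<Rightarrow> bool" where
  "C1c_field U \<longleftrightarrow> C1_on U UNIV \<and> compact (closure (support_on UNIV U))"

text \<open>The Riemannian volume element is Lebesgue measure in the coordinates \<open>x_k, y_k, t\<close>.\<close>

definition vol :: "'n::finite heis set \<Rightarrow> ennreal" where
  "vol \<Omega> = emeasure lborel \<Omega>"

definition perimeter :: "'n::finite heis set \<Rightarrow> ereal" where
  "perimeter \<Omega> =
     (SUP U \<in> {U. C1c_field U \<and> horizontal U \<and> (\<forall>p. hnorm p (U p) \<le> 1)}.
        ereal (LINT p:\<Omega>|lborel. hdiv U p))"

definition finite_perimeter :: "'n::finite heis set \<Rightarrow> bool" where
  "finite_perimeter \<Omega> \<longleftrightarrow> \<Omega> \<in> sets borel \<and> vol \<Omega> < \<infinity> \<and> perimeter \<Omega> < \<infinity>"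

definition flow_of :: "('n::finite heis \<Rightarrow> 'n heis) \<Rightarrow> (real \<Rightarrow> 'n heis \<Rightarrow> 'n heis) \<Rightarrow> bool" where
  "flow_of U \<phi> \<longleftrightarrow>
     (\<forall>p. \<phi> 0 p = p) \<and>
     (\<forall>t p. ((\<lambda>s. \<phi> s p) has_vector_derivative U (\<phi> t p)) (at t))"

definition volume_preserving ::
  "(real \<Rightarrow> 'n::finite heis \<Rightarrow> 'n heis) \<Rightarrow> 'n heis set \<Rightarrow> bool" where
  "volume_preserving \<phi> \<Omega> \<longleftrightarrow> (\<exists>\<epsilon>>0. \<forall>t. \<bar>t\<bar> < \<epsilon> \<longrightarrow> vol (\<phi> t ` \<Omega>) = vol (\<phi> 0 ` \<Omega>))"

text \<open>The perimeter takes values in the extended reals, so \<open>P'(0) = 0\<close> means that it is finite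
  for small \<open>t\<close> and that the resulting real function has derivative \<open>0\<close>; without the first part
  \<open>real_of_ereal\<close> would turn an infinite perimeter into \<open>0\<close>.\<close>

definition stationary :: "'n::finite heis set \<Rightarrow> bool" where
  "stationary \<Omega> \<longleftrightarrow>
     (\<forall>U \<phi>. C1c_field U \<and> flow_of U \<phi> \<and> volume_preserving \<phi> \<Omega> \<longrightarrow>
        (\<forall>\<^sub>F t in nhds 0. perimeter (\<phi> t ` \<Omega>) < \<infinity>) \<and>
        ((\<lambda>t. real_of_ereal (perimeter (\<phi> t ` \<Omega>))) has_real_derivative 0) (at 0))"


section \<open>Hypersurfaces and their mean curvature\<close>

definition C2_hypersurface :: "'n::finite heis set \<Rightarrow> bool" where
  "C2_hypersurface \<Sigma> \<longleftrightarrow>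
     (\<forall>p\<in>\<Sigma>. \<exists>W (f :: 'n heis \<Rightarrow> real). open W \<and> p \<in> W \<and> C2_on f W \<and>
        (\<forall>q\<in>W. frechet_derivative f (at q) \<noteq> (\<lambda>_. 0)) \<and>
        \<Sigma> \<inter> W = {q \<in> W. f q = 0})"

definition tangent_space :: "'n::finite heis set \<Rightarrow> 'n heis \<Rightarrow> 'n heis set" where
  "tangent_space \<Sigma> p =
     {v. \<exists>\<gamma>. \<gamma> 0 = p \<and> (\<forall>\<^sub>F s in nhds (0::real). \<gamma> s \<in> \<Sigma>) \<and> (\<gamma> has_vector_derivative v) (at 0)}"

definition is_inner_normal :: "'n::finite heis set \<Rightarrow> 'n heis \<Rightarrow> 'n heis \<Rightarrow> bool" where
  "is_inner_normal \<Omega> p N \<longleftrightarrow>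
     hmetric p N N = 1 \<and>
     (\<forall>v \<in> tangent_space (frontier \<Omega>) p. hmetric p N v = 0) \<and>
     (\<forall>\<^sub>F s in at_right 0. p + s *\<^sub>R N \<in> \<Omega>)"

text \<open>Uniqueness of the inner normal excludes sets lying locally on both sides of their boundary,
  such as a ball with a concentric sphere removed.\<close>

definition bounded_by_C2_hypersurface :: "'n::finite heis set \<Rightarrow> bool" where
  "bounded_by_C2_hypersurface \<Omega> \<longleftrightarrow>
     open \<Omega> \<and> C2_hypersurface (frontier \<Omega>) \<and> (\<forall>p \<in> frontier \<Omega>. \<exists>!N. is_inner_normal \<Omega> p N)"

definition inner_normal :: "'n::finite heis set \<Rightarrow> 'n heis \<Rightarrow> 'n heis" where
  "inner_normal \<Omega> p = (THE N. is_inner_normal \<Omega> p N)"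

definition singular_set :: "'n::finite heis set \<Rightarrow> 'n heis set" where
  "singular_set \<Omega> = {p \<in> frontier \<Omega>. hproj p (inner_normal \<Omega> p) = 0}"

definition horizontal_normal :: "'n::finite heis set \<Rightarrow> 'n heis \<Rightarrow> 'n heis" where
  "horizontal_normal \<Omega> p =
     hproj p (inner_normal \<Omega> p) /\<^sub>R hnorm p (hproj p (inner_normal \<Omega> p))"

definition orthonormal_basis :: "'n::finite heis \<Rightarrow> 'n heis set \<Rightarrow> 'n heis set \<Rightarrow> bool" where
  "orthonormal_basis p V B \<longleftrightarrow>
     finite B \<and> span B = V \<and> (\<forall>e\<in>B. \<forall>e'\<in>B. hmetric p e e' = (if e = e' then 1 else 0))"

text \<open>The sum does not depend on the orthonormal basis, whence the definite description.\<close>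

definition surface_div :: "'n::finite heis set \<Rightarrow> ('n heis \<Rightarrow> 'n heis) \<Rightarrow> 'n heis \<Rightarrow> real" where
  "surface_div \<Sigma> U p =
     (THE d. \<forall>B. orthonormal_basis p (tangent_space \<Sigma> p) B \<longrightarrow>
        d = (\<Sum>e\<in>B. hmetric p (levi_civita \<Sigma> U p e) e))"

definition mean_curvature :: "'n::finite heis set \<Rightarrow> 'n heis \<Rightarrow> real" where
  "mean_curvature \<Omega> p =
     - surface_div (frontier \<Omega>) (horizontal_normal \<Omega>) p / (2 * real CARD('n))"

definition constant_mean_curvature :: "'n::finite heis set \<Rightarrow> bool" where
  "constant_mean_curvature \<Omega> \<longleftrightarrow>
     (\<exists>H. \<forall>p \<in> frontier \<Omega> - singular_set \<Omega>. mean_curvature \<Omega> p = H)"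

end

theory Submission
  imports Defs
begin

text \<open>The proof is by contradiction and compares only two points. Suppose that \<open>p\<close> and \<open>q\<close> are
  non-singular boundary points at which the mean curvature of \<open>p\<close> is the larger one. A flow that
  pushes \<open>\<Omega>\<close> outwards near \<open>p\<close> and inwards near \<open>q\<close>, at equal rates of volume, preserves volume,
  and the first variation of perimeter is then at least a positive multiple of the difference of the
  two curvatures. This contradicts stationarity. Since the perimeter is differentiable along such
  a variation by assumption, a one-sided estimate \<open>P(t) \<ge> P(0) + c t\<close> for small \<open>t > 0\<close> with \<open>c > 0\<close> is
  enough.

  The one-sided estimate is a calibration argument (lemma \<open>perimeter_calibration_le\<close>). Let \<open>f\<close> be a
  \<open>C\<^sup>2\<close> function near \<open>p\<close> with \<open>\<Omega> = {f > 0}\<close> and non-vanishing horizontal gradient, and let \<open>\<nu>\<close> be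
  minus its normalized horizontal gradient: the outward horizontal unit normal of all the level sets
  of \<open>f\<close>. Replacing an admissible field \<open>U\<close> by \<open>\<nu>\<close> near \<open>p\<close> does not decrease \<open>\<integral>\<^sub>\<Omega> div U\<close>, since the
  outward flux of \<open>\<nu>\<close> is the largest possible. The modified field competes for the perimeter of every
  set \<open>\<Omega>'\<close> that differs from \<open>\<Omega>\<close> only where \<open>U\<close> was replaced by \<open>\<nu>\<close>, hence
  \<open>P(\<Omega>') - P(\<Omega>)\<close> is at least the integral of \<open>div \<nu>\<close> over \<open>\<Omega>'\<close> minus that over \<open>\<Omega>\<close>. By lemma
  \<open>mean_curvature_eq_hdiv\<close> the continuous function \<open>div \<nu>\<close> takes the value \<open>2nH\<close> at \<open>p\<close>, so a small
  change of volume near \<open>p\<close> costs perimeter at the rate \<open>2nH(p)\<close>, up to an arbitrarily small error.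
  For the comparison of fluxes the indicator function of \<open>{f > 0}\<close> is approximated by cut-offs of \<open>f\<close>, and the divergence of a compactly supported field
  has integral zero (lemmas \<open>flux_nonneg\<close> and \<open>integral_hdiv_eq_0\<close>).

  The flow must preserve volume exactly. It moves points along parallel lines transversal to the
  boundary, and on each line it is given by an explicit formula that is a translation near the
  boundary and the identity far away. The boundary being a graph over the orthogonal complement of
  these lines, the volume gained is exactly proportional to the time (lemma
  \<open>line_flow_volume_step\<close>). The explicit formula also makes the existence of the flow elementary.\<close>

section \<open>Continuously differentiable maps\<close>

text \<open>On a Euclidean space continuity of the derivative in the operator norm can be tested on each vector
  separately. In this form the class is stable under all the operations needed below, with the
  derivative given by \<open>frechet_derivative\<close>.\<close>

lemma C1_onI:
  fixes f :: "'a::euclidean_space \<Rightarrow> 'b::real_normed_vector"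
  assumes d: "\<And>x. x \<in> W \<Longrightarrow> (f has_derivative f' x) (at x)"
    and c: "\<And>v. continuous_on W (\<lambda>x. f' x v)"
  shows "C1_on f W"
  unfolding C1_on_def
proof (intro exI[of _ "\<lambda>x. Blinfun (f' x)"] conjI ballI)
  have ap: "blinfun_apply (Blinfun (f' x)) = f' x" if "x \<in> W" for x
    using has_derivative_bounded_linear[OF d[OF that]] by (simp add: bounded_linear_Blinfun_apply)
  show "(f has_derivative blinfun_apply (Blinfun (f' x))) (at x)" if "x \<in> W" for x
    using d[OF that] ap[OF that] by simp
  show "continuous_on W (\<lambda>x. Blinfun (f' x))"
  proof (rule continuous_on_blinfun_componentwise)
    fix i :: 'a
    show "continuous_on W (\<lambda>x. blinfun_apply (Blinfun (f' x)) i)"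
      using c[of i] by (rule continuous_on_eq) (simp add: ap)
  qed
qed

lemma C1_on_iff:
  fixes f :: "'a::euclidean_space \<Rightarrow> 'b::real_normed_vector"
  shows "C1_on f W \<longleftrightarrow> (\<forall>x\<in>W. f differentiable (at x)) \<and>
    (\<forall>v. continuous_on W (\<lambda>x. frechet_derivative f (at x) v))"
proof
  assume "C1_on f W"
  then obtain f' :: "'a \<Rightarrow> 'a \<Rightarrow>\<^sub>L 'b" where
    d: "\<And>x. x \<in> W \<Longrightarrow> (f has_derivative blinfun_apply (f' x)) (at x)" and c: "continuous_on W f'"
    unfolding C1_on_def by blast
  have "continuous_on W (\<lambda>x. frechet_derivative f (at x) v)" for v
    by (rule continuous_on_eq[of W "\<lambda>x. blinfun_apply (f' x) v"])
       (auto intro!: continuous_intros c simp: frechet_derivative_at[OF d, symmetric])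
  then show "(\<forall>x\<in>W. f differentiable (at x)) \<and>
    (\<forall>v. continuous_on W (\<lambda>x. frechet_derivative f (at x) v))"
    using d differentiableI by blast
next
  assume "(\<forall>x\<in>W. f differentiable (at x)) \<and>
    (\<forall>v. continuous_on W (\<lambda>x. frechet_derivative f (at x) v))"
  then show "C1_on f W"
    by (intro C1_onI[of W f "\<lambda>x. frechet_derivative f (at x)"])
       (auto simp: frechet_derivative_works[symmetric])
qed

lemma C1_on_differentiable:
  fixes f :: "'a::euclidean_space \<Rightarrow> 'b::real_normed_vector"
  assumes "C1_on f W" "x \<in> W" shows "f differentiable (at x)"
  using assms C1_on_iff by blast

lemma C1_on_has_derivative:
  fixes f :: "'a::euclidean_space \<Rightarrow> 'b::real_normed_vector"
  assumes "C1_on f W" "x \<in> W"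
  shows "(f has_derivative frechet_derivative f (at x)) (at x)"
  using assms C1_on_iff frechet_derivative_works by blast

lemma C1_on_continuous_derivative:
  fixes f :: "'a::euclidean_space \<Rightarrow> 'b::real_normed_vector"
  assumes "C1_on f W"
  shows "continuous_on W (\<lambda>x. frechet_derivative f (at x) v)"
  using assms C1_on_iff by blast

lemma C1_on_imp_continuous_on:
  fixes f :: "'a::euclidean_space \<Rightarrow> 'b::real_normed_vector"
  assumes "C1_on f W"
  shows "continuous_on W f"
  by (meson C1_on_has_derivative assms continuous_at_imp_continuous_on has_derivative_continuous)

lemma C1_on_subset: "C1_on f W \<Longrightarrow> V \<subseteq> W \<Longrightarrow> C1_on f V"
  unfolding C1_on_def by (meson continuous_on_subset subsetD)

lemma C1_on_cong:
  assumes "C1_on f W" "open W" "\<And>x. x \<in> W \<Longrightarrow> g x = f x"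
  shows "C1_on g W"
  using assms unfolding C1_on_def
  by (metis has_derivative_transform_within_open)

lemma C1_on_Un:
  fixes f :: "'a::euclidean_space \<Rightarrow> 'b::real_normed_vector"
  assumes "C1_on f A" "C1_on f B" "open A" "open B"
  shows "C1_on f (A \<union> B)"
  using assms unfolding C1_on_iff by (auto intro: continuous_on_open_Un)

lemma C1_on_zero_extension:
  fixes f :: "'a::euclidean_space \<Rightarrow> 'b::real_normed_vector"
  assumes "C1_on f W" "open W" "closed K" "K \<subseteq> W" "\<And>x. x \<notin> K \<Longrightarrow> f x = 0"
  shows "C1_on f UNIV"
proof -
  have "C1_on (\<lambda>_. 0 :: 'b) (- K)"
    by (rule C1_onI[where f' = "\<lambda>_ _. 0"]) auto
  then have "C1_on f (- K)"
    by (rule C1_on_cong) (use assms in auto)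
  then have "C1_on f (W \<union> - K)"
    using assms by (intro C1_on_Un) auto
  moreover have "W \<union> - K = UNIV" using assms by auto
  ultimately show ?thesis by simp
qed

lemma C1_on_const: "C1_on (\<lambda>_::'a::euclidean_space. c) W"
  by (rule C1_onI[where f' = "\<lambda>_ _. 0"]) auto

lemma C1_on_bounded_linear:
  fixes f :: "'a::euclidean_space \<Rightarrow> 'b::real_normed_vector"
  assumes "bounded_linear f" shows "C1_on f W"
  by (rule C1_onI[where f' = "\<lambda>_. f"]) (auto intro: bounded_linear_imp_has_derivative assms)

lemma C1_on_bounded_bilinear:
  fixes f :: "'a::euclidean_space \<Rightarrow> 'b::real_normed_vector"
  assumes "bounded_bilinear bil" "C1_on f W" "C1_on g W"
  shows "C1_on (\<lambda>x. bil (f x) (g x)) W"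
proof (rule C1_onI)
  show "((\<lambda>x. bil (f x) (g x)) has_derivative
     (\<lambda>v. bil (f x) (frechet_derivative g (at x) v) + bil (frechet_derivative f (at x) v) (g x))) (at x)"
    if "x \<in> W" for x
    by (intro bounded_bilinear.FDERIV[OF assms(1)] C1_on_has_derivative[OF assms(2) that]
        C1_on_has_derivative[OF assms(3) that])
  show "continuous_on W (\<lambda>x. bil (f x) (frechet_derivative g (at x) v)
      + bil (frechet_derivative f (at x) v) (g x))" for v
    by (intro continuous_on_add bounded_bilinear.continuous_on[OF assms(1)]
        C1_on_imp_continuous_on C1_on_continuous_derivative assms)
qed

lemmas C1_on_scaleR = C1_on_bounded_bilinear[OF bounded_bilinear_scaleR]
lemmas C1_on_mult = C1_on_bounded_bilinear[OF bounded_bilinear_mult]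
lemmas C1_on_inner = C1_on_bounded_bilinear[OF bounded_bilinear_inner]

lemma C1_on_add:
  fixes f :: "'a::euclidean_space \<Rightarrow> 'b::real_normed_vector"
  assumes "C1_on f W" "C1_on g W"
  shows "C1_on (\<lambda>x. f x + g x) W"
  by (rule C1_onI[where f' = "\<lambda>x v. frechet_derivative f (at x) v + frechet_derivative g (at x) v"])
     (auto intro!: continuous_intros has_derivative_add C1_on_has_derivative[OF assms(1)]
       C1_on_has_derivative[OF assms(2)] C1_on_continuous_derivative assms)

lemma C1_on_compose:
  fixes f :: "'a::euclidean_space \<Rightarrow> 'b::euclidean_space" and g :: "'b \<Rightarrow> 'c::real_normed_vector"
  assumes "C1_on f W" "C1_on g V" "f ` W \<subseteq> V"
  shows "C1_on (\<lambda>x. g (f x)) W"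
proof -
  obtain g' :: "'b \<Rightarrow> 'b \<Rightarrow>\<^sub>L 'c" where
    d: "\<And>x. x \<in> V \<Longrightarrow> (g has_derivative blinfun_apply (g' x)) (at x)" and c: "continuous_on V g'"
    using assms(2) unfolding C1_on_def by blast
  show ?thesis
  proof (rule C1_onI)
    show "((\<lambda>x. g (f x)) has_derivative
        (\<lambda>v. blinfun_apply (g' (f x)) (frechet_derivative f (at x) v))) (at x)" if "x \<in> W" for x
      using has_derivative_compose[OF C1_on_has_derivative[OF assms(1) that] d] assms(3) that by auto
    show "continuous_on W (\<lambda>x. blinfun_apply (g' (f x)) (frechet_derivative f (at x) v))" for v
      by (intro continuous_intros C1_on_continuous_derivative assms
          continuous_on_compose2[OF c C1_on_imp_continuous_on[OF assms(1)]])
  qed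
qed

lemma C1_on_linear_compose:
  fixes f :: "'a::euclidean_space \<Rightarrow> 'b::real_normed_vector"
  assumes "bounded_linear h" "C1_on f W"
  shows "C1_on (\<lambda>x. h (f x)) W"
  by (rule C1_onI[where f' = "\<lambda>x v. h (frechet_derivative f (at x) v)"])
     (auto intro!: bounded_linear.has_derivative[OF assms(1)] C1_on_has_derivative[OF assms(2)]
       bounded_linear.continuous_on[OF assms(1)] C1_on_continuous_derivative[OF assms(2)])

lemma C1_on_minus:
  fixes f :: "'a::euclidean_space \<Rightarrow> 'b::real_normed_vector"
  assumes "C1_on f W" shows "C1_on (\<lambda>x. - f x) W"
  by (rule C1_on_linear_compose[OF bounded_linear_minus[OF bounded_linear_ident] assms])

lemma C1_on_diff:
  fixes f :: "'a::euclidean_space \<Rightarrow> 'b::real_normed_vector"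
  assumes "C1_on f W" "C1_on g W"
  shows "C1_on (\<lambda>x. f x - g x) W"
  using C1_on_add[OF assms(1) C1_on_minus[OF assms(2)]] by simp

lemma C1_on_sum:
  fixes f :: "'i \<Rightarrow> 'a::euclidean_space \<Rightarrow> 'b::real_normed_vector"
  assumes "finite I" "\<And>i. i \<in> I \<Longrightarrow> C1_on (f i) W"
  shows "C1_on (\<lambda>x. \<Sum>i\<in>I. f i x) W"
  using assms by (induction I rule: finite_induct) (auto intro: C1_on_const C1_on_add)

lemma C1_on_real:
  fixes g :: "real \<Rightarrow> real"
  assumes "\<And>x. x \<in> W \<Longrightarrow> (g has_real_derivative g' x) (at x)" "continuous_on W g'"
  shows "C1_on g W"
  by (rule C1_onI[where f' = "\<lambda>x v. g' x * v"])
     (use assms in \<open>auto intro!: continuous_intros simp: has_field_derivative_def\<close>)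

lemma has_real_derivative_glue:
  fixes f g :: "real \<Rightarrow> real"
  assumes f: "\<And>x. x \<le> a \<Longrightarrow> (f has_real_derivative f' x) (at x)"
    and g: "\<And>x. a \<le> x \<Longrightarrow> (g has_real_derivative g' x) (at x)"
    and eq: "f a = g a" "f' a = g' a"
  shows "((\<lambda>x. if x \<le> a then f x else g x) has_real_derivative (if x \<le> a then f' x else g' x)) (at x)"
proof -
  consider "x < a" | "x > a" | "x = a" by linarith
  then show ?thesis
  proof cases
    case 1
    have "((\<lambda>x. if x \<le> a then f x else g x) has_real_derivative f' x) (at x)"
      by (rule DERIV_cong_ev[THEN iffD2, OF refl _ refl f])
         (use 1 in \<open>auto intro!: eventually_mono[OF eventually_nhds_in_open[of "{..<a}"]]\<close>)
    then show ?thesis using 1 by simp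
  next
    case 2
    have "((\<lambda>x. if x \<le> a then f x else g x) has_real_derivative g' x) (at x)"
      by (rule DERIV_cong_ev[THEN iffD2, OF refl _ refl g])
         (use 2 in \<open>auto intro!: eventually_mono[OF eventually_nhds_in_open[of "{a<..}"]]\<close>)
    then show ?thesis using 2 by simp
  next
    case 3
    let ?h = "\<lambda>x. if x \<le> a then f x else g x"
    have l: "(?h has_real_derivative f' a) (at a within {..a})"
      by (rule has_field_derivative_transform_within[where d = 1 and f = f])
         (auto intro: has_field_derivative_at_within f)
    have r: "(?h has_real_derivative f' a) (at a within {a..})"
      by (rule has_field_derivative_transform_within[where d = 1 and f = g])
         (use eq g[of a] in \<open>auto intro: has_field_derivative_at_within\<close>)
    have "(?h has_real_derivative f' a) (at a within {..a} \<union> {a..})"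
      using l r unfolding has_field_derivative_iff by (rule Lim_Un)
    moreover have "{..a} \<union> {a..} = UNIV" by auto
    ultimately show ?thesis using 3 by simp
  qed
qed

text \<open>A \<open>C\<^sup>1\<close> transition from \<open>0\<close> to \<open>1\<close>. It serves to cut off vector fields and, applied to \<open>n f\<close> for
  large \<open>n\<close>, to approximate the indicator function of \<open>{f > 0}\<close>. The choice of \<open>sin\<^sup>2\<close> makes the
  flow of a vector field on the line that is built from it explicit.\<close>

definition transition :: "real \<Rightarrow> real" where
  "transition u = (sin (max 0 (min (pi/2) u)))\<^sup>2"

definition transition' :: "real \<Rightarrow> real" where
  "transition' u = sin (2 * max 0 (min (pi/2) u))"

lemma clamp_simps:
  "u \<le> 0 \<Longrightarrow> max 0 (min (pi/2) u) = 0"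
  "0 \<le> u \<Longrightarrow> u \<le> pi/2 \<Longrightarrow> max 0 (min (pi/2) u) = u"
  "pi/2 \<le> u \<Longrightarrow> max 0 (min (pi/2) u) = pi/2"
  using pi_half_gt_zero by linarith+

lemma transition_simps:
  "u \<le> 0 \<Longrightarrow> transition u = 0"
  "0 \<le> u \<Longrightarrow> u \<le> pi/2 \<Longrightarrow> transition u = (sin u)\<^sup>2"
  "pi/2 \<le> u \<Longrightarrow> transition u = 1"
  by (simp_all add: transition_def clamp_simps)

lemma transition_bounds: "0 \<le> transition u" "transition u \<le> 1"
  by (simp_all add: transition_def abs_square_le_1)

lemma transition'_nonneg: "0 \<le> transition' u"
proof -
  have "0 \<le> max 0 (min (pi/2) u)" "max 0 (min (pi/2) u) \<le> pi/2"
    by (rule max.cobounded1, rule max.boundedI[OF pi_half_ge_zero min.cobounded1])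
  then have "0 \<le> 2 * max 0 (min (pi/2) u)" "2 * max 0 (min (pi/2) u) \<le> pi" by linarith+
  then show ?thesis unfolding transition'_def by (rule sin_ge_zero)
qed

lemma transition_deriv: "(transition has_real_derivative transition' u) (at u)"
proof -
  have 1: "((\<lambda>u. if u \<le> pi/2 then (sin u)\<^sup>2 else 1) has_real_derivative
      (if u \<le> pi/2 then 2 * sin u * cos u else 0)) (at u)" for u :: real
    by (rule has_real_derivative_glue) (auto intro!: derivative_eq_intros)
  have 2: "((\<lambda>u. if u \<le> 0 then 0 else if u \<le> pi/2 then (sin u)\<^sup>2 else 1) has_real_derivative
      (if u \<le> 0 then 0 else if u \<le> pi/2 then 2 * sin u * cos u else 0)) (at u)"
    by (rule has_real_derivative_glue[OF _ 1]) auto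
  have e: "transition = (\<lambda>u. if u \<le> 0 then 0 else if u \<le> pi/2 then (sin u)\<^sup>2 else 1)"
    by (auto simp: transition_simps fun_eq_iff)
  have e': "transition' u = (if u \<le> 0 then 0 else if u \<le> pi/2 then 2 * sin u * cos u else 0)"
    using sin_double[of u] by (simp add: transition'_def clamp_simps)
  show ?thesis unfolding e e' by (rule 2)
qed

lemma C1_on_transition: "C1_on transition W"
proof (rule C1_on_real[OF transition_deriv])
  show "continuous_on W transition'"
    unfolding transition'_def[abs_def] by (intro continuous_intros)
qed

section \<open>Integration in Euclidean space\<close>

lemma integrable_continuous_compact_support:
  fixes g :: "'a::euclidean_space \<Rightarrow> real"
  assumes "continuous_on UNIV g" "compact K" "\<And>x. x \<notin> K \<Longrightarrow> g x = 0"
  shows "integrable lborel g"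
proof -
  have "integrable lborel (\<lambda>x. indicator K x *\<^sub>R g x)"
    by (rule borel_integrable_compact[OF assms(2) continuous_on_subset[OF assms(1)]]) simp
  moreover have "(\<lambda>x. indicator K x *\<^sub>R g x) = g"
    using assms(3) by (auto simp: fun_eq_iff indicator_def)
  ultimately show ?thesis by simp
qed

lemma frechet_derivative_eq_on_open:
  assumes "open W" "x \<in> W" "\<And>y. y \<in> W \<Longrightarrow> f y = g y"
  shows "frechet_derivative f (at x) = frechet_derivative g (at x)"
proof -
  have "(f has_derivative D) (at x) \<longleftrightarrow> (g has_derivative D) (at x)" for D
    using assms by (metis has_derivative_transform_within_open)
  then show ?thesis by (simp add: frechet_derivative_def)
qed

lemma frechet_derivative_zero_off_support:
  fixes f :: "'a::real_normed_vector \<Rightarrow> 'b::real_normed_vector"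
  assumes "closed K" "\<And>x. x \<notin> K \<Longrightarrow> f x = 0" "x \<notin> K"
  shows "frechet_derivative f (at x) v = 0"
proof -
  have "frechet_derivative f (at x) = frechet_derivative (\<lambda>_. 0) (at x)"
    by (rule frechet_derivative_eq_on_open[of "- K"]) (use assms in auto)
  then show ?thesis by simp
qed

lemma integrable_derivative:
  fixes f :: "'a::euclidean_space \<Rightarrow> real"
  assumes "C1_on f UNIV" "compact K" "\<And>x. x \<notin> K \<Longrightarrow> f x = 0"
  shows "integrable lborel (\<lambda>x. frechet_derivative f (at x) v)"
  using C1_on_continuous_derivative[OF assms(1)] assms(2)
  by (rule integrable_continuous_compact_support)
     (use assms in \<open>auto intro: frechet_derivative_zero_off_support[OF compact_imp_closed]\<close>)

lemma integral_translation:
  fixes g :: "'a::euclidean_space \<Rightarrow> real"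
  assumes "g \<in> borel_measurable borel"
  shows "(\<integral>x. g (x + c) \<partial>lborel) = (\<integral>x. g x \<partial>lborel)"
proof -
  have "(\<integral>x. g x \<partial>lborel) = (\<integral>x. g x \<partial>distr lborel borel ((+) c))"
    by (simp add: lborel_distr_plus)
  also have "\<dots> = (\<integral>x. g (c + x) \<partial>lborel)"
    by (rule integral_distr) (use assms in auto)
  finally show ?thesis by (simp add: add.commute)
qed

text \<open>The difference quotients have integral zero by translation invariance, and they converge
  dominatedly to the derivative.\<close>

lemma integral_derivative_eq_0:
  fixes f :: "'a::euclidean_space \<Rightarrow> real"
  assumes C1: "C1_on f UNIV" and K: "compact K" and z: "\<And>x. x \<notin> K \<Longrightarrow> f x = 0"
  shows "(\<integral>x. frechet_derivative f (at x) v \<partial>lborel) = 0"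
proof -
  define D where "D x = frechet_derivative f (at x) v" for x
  define h where "h n = inverse (real (Suc n))" for n
  define q where "q n x = (f (x + h n *\<^sub>R v) - f x) / h n" for n x
  have h: "0 < h n" "h n \<le> 1" for n by (auto simp: h_def field_simps)
  have cD: "continuous_on UNIV D"
    unfolding D_def by (rule C1_on_continuous_derivative[OF C1])
  have cf: "continuous_on UNIV f" by (rule C1_on_imp_continuous_on[OF C1])
  have zD: "D x = 0" if "x \<notin> K" for x
    unfolding D_def using compact_imp_closed[OF K] z that by (rule frechet_derivative_zero_off_support)
  obtain M where M: "\<And>x. x \<in> K \<Longrightarrow> \<bar>D x\<bar> \<le> M" "0 \<le> M"
  proof -
    have "bounded (D ` K)"
      by (intro compact_imp_bounded compact_continuous_image continuous_on_subset[OF cD] K) auto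
    then obtain M where "\<And>x. x \<in> K \<Longrightarrow> \<bar>D x\<bar> \<le> M" by (auto simp: bounded_iff)
    then show ?thesis by (intro that[of "max M 0"]) (auto simp: le_max_iff_disj)
  qed
  have M': "\<bar>D x\<bar> \<le> M" for x using M zD[of x] by (cases "x \<in> K") auto
  \<comment> \<open>A compact set off which all the difference quotients with step at most one vanish.\<close>
  define K' where "K' = (\<lambda>(x, s). x - s *\<^sub>R v) ` (K \<times> {0..1::real})"
  have K': "compact K'"
    unfolding K'_def
    by (intro compact_continuous_image compact_Times K)
       (auto intro!: continuous_intros simp: case_prod_beta)
  have bound: "\<bar>q n x\<bar> \<le> M * indicator K' x" for n x
  proof (cases "x \<in> K'")
    case True
    define u where "u s = f (x + s *\<^sub>R v)" for s :: real
    have du: "(u has_real_derivative D (x + s *\<^sub>R v)) (at s)" for s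
    proof -
      have "((\<lambda>s. f (x + s *\<^sub>R v)) has_derivative
          (\<lambda>r. frechet_derivative f (at (x + s *\<^sub>R v)) (r *\<^sub>R v))) (at s)"
        by (rule has_derivative_compose[OF _ C1_on_has_derivative[OF C1]])
           (auto intro!: derivative_eq_intros)
      moreover have "frechet_derivative f (at y) (r *\<^sub>R v) = r * D y" for r y
        using linear_scale[OF has_derivative_linear[OF C1_on_has_derivative[OF C1 UNIV_I[of y]]], of r v]
        by (simp add: D_def)
      ultimately show ?thesis
        unfolding has_field_derivative_def u_def by (simp add: mult.commute[of _ "D _"])
    qed
    obtain s where "u (h n) - u 0 = (h n - 0) * D (x + s *\<^sub>R v)"
      using MVT2[of 0 "h n" u "\<lambda>s. D (x + s *\<^sub>R v)"] du h(1) by blast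
    then have "q n x = D (x + s *\<^sub>R v)"
      using h(1)[of n] by (simp add: q_def u_def)
    then show ?thesis using M' True by simp
  next
    case False
    have "x \<notin> K"
    proof
      assume "x \<in> K"
      then have "(x, 0) \<in> K \<times> {0..1::real}" by simp
      then show False using False unfolding K'_def by force
    qed
    moreover have "x + h n *\<^sub>R v \<notin> K"
    proof
      assume "x + h n *\<^sub>R v \<in> K"
      then have "(x + h n *\<^sub>R v, h n) \<in> K \<times> {0..1::real}" using h[of n] by simp
      then show False using False unfolding K'_def by force
    qed
    ultimately show ?thesis using z by (simp add: q_def False)
  qed
  have lim: "(\<lambda>n. q n x) \<longlonglongrightarrow> D x" for x
  proof -
    have "((\<lambda>s. f (x + s *\<^sub>R v)) has_derivative
        (\<lambda>r. frechet_derivative f (at (x + 0 *\<^sub>R v)) (r *\<^sub>R v))) (at 0)"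
      by (rule has_derivative_compose[OF _ C1_on_has_derivative[OF C1]])
         (auto intro!: derivative_eq_intros)
    moreover have "frechet_derivative f (at y) (r *\<^sub>R v) = r * D y" for r y
      using linear_scale[OF has_derivative_linear[OF C1_on_has_derivative[OF C1 UNIV_I[of y]]], of r v]
      by (simp add: D_def)
    ultimately have "((\<lambda>s. f (x + s *\<^sub>R v)) has_real_derivative D x) (at 0)"
      unfolding has_field_derivative_def by (simp add: mult.commute[of _ "D _"])
    then have "((\<lambda>s. (f (x + s *\<^sub>R v) - f x) / s) \<longlongrightarrow> D x) (at 0)"
      by (simp add: has_field_derivative_iff)
    moreover have "filterlim h (at 0) sequentially"
      unfolding filterlim_at using h(1) LIMSEQ_inverse_real_of_nat
      by (auto simp: h_def[abs_def] less_imp_neq[symmetric])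
    ultimately show ?thesis unfolding q_def by (rule filterlim_compose)
  qed
  have mf: "f \<in> borel_measurable borel" using cf by (rule borel_measurable_continuous_onI)
  have If: "integrable lborel f" using cf K z by (rule integrable_continuous_compact_support)
  have If': "integrable lborel (\<lambda>x. f (x + c))" for c
  proof (rule integrable_continuous_compact_support)
    show "continuous_on UNIV (\<lambda>x. f (x + c))"
      by (rule continuous_on_compose2[OF cf]) (auto intro!: continuous_intros)
    show "compact ((+) (- c) ` K)" by (rule compact_translation[OF K])
    show "f (x + c) = 0" if "x \<notin> (+) (- c) ` K" for x
    proof (rule z)
      show "x + c \<notin> K"
      proof
        assume "x + c \<in> K"
        then have "- c + (x + c) \<in> (+) (- c) ` K" by (rule imageI)
        then show False using that by simp
      qed
    qed
  qed
  have q0: "(\<integral>x. q n x \<partial>lborel) = 0" for n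
    using If If' integral_translation[OF mf] by (simp add: q_def)
  have "(\<lambda>n. \<integral>x. q n x \<partial>lborel) \<longlonglongrightarrow> (\<integral>x. D x \<partial>lborel)"
  proof (rule integral_dominated_convergence)
    show "D \<in> borel_measurable lborel" using borel_measurable_continuous_onI[OF cD] by simp
    show "q n \<in> borel_measurable lborel" for n
      unfolding q_def using mf by measurable
    show "integrable lborel (\<lambda>x. M * indicator K' x)"
      using borel_compact[OF K'] emeasure_bounded_finite[OF compact_imp_bounded[OF K']]
      by (intro integrable_mult_right integrable_real_indicator) (auto simp: top.not_eq_extremum)
  qed (use lim bound in auto)
  then have "(\<integral>x. D x \<partial>lborel) = 0"
    unfolding q0 by (simp add: LIMSEQ_const_iff)
  then show ?thesis by (simp add: D_def)
qed

lemma nn_integral_translation: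
  fixes g :: "'a::euclidean_space \<Rightarrow> ennreal"
  assumes "g \<in> borel_measurable borel"
  shows "(\<integral>\<^sup>+x. g (x + c) \<partial>lborel) = (\<integral>\<^sup>+x. g x \<partial>lborel)"
proof -
  have "(\<integral>\<^sup>+x. g x \<partial>lborel) = (\<integral>\<^sup>+x. g x \<partial>distr lborel borel ((+) c))"
    by (simp add: lborel_distr_plus)
  also have "\<dots> = (\<integral>\<^sup>+x. g (c + x) \<partial>lborel)"
    by (rule nn_integral_distr) (use assms in auto)
  finally show ?thesis by (simp add: add.commute)
qed

text \<open>A form of Tonelli's theorem for an arbitrary direction \<open>e\<close>, not only a coordinate direction. The
  integral over the line through \<open>x\<close> depends only on the line, and the points with
  \<open>0 \<le> x \<bullet> e \<le> 1\<close> meet every such line in a segment of length one.\<close>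

lemma nn_integral_lines:
  fixes g :: "'a::euclidean_space \<Rightarrow> ennreal"
  assumes g: "g \<in> borel_measurable borel" and e: "norm e = 1"
  shows "(\<integral>\<^sup>+x. g x \<partial>lborel) =
    (\<integral>\<^sup>+x. indicator {0..1} (x \<bullet> e) * (\<integral>\<^sup>+s. g (x + s *\<^sub>R e) \<partial>lborel) \<partial>lborel)"
proof -
  have ee: "e \<bullet> e = 1" using e by (simp add: dot_square_norm)
  have [measurable]: "g \<in> borel_measurable borel" by (rule g)
  have "(\<integral>\<^sup>+x. indicator {0..1} (x \<bullet> e) * (\<integral>\<^sup>+s. g (x + s *\<^sub>R e) \<partial>lborel) \<partial>lborel)
      = (\<integral>\<^sup>+x. (\<integral>\<^sup>+s. indicator {0..1} (x \<bullet> e) * g (x + s *\<^sub>R e) \<partial>lborel) \<partial>lborel)"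
    by (intro nn_integral_cong nn_integral_cmult[symmetric]) measurable
  also have "\<dots> = (\<integral>\<^sup>+s. (\<integral>\<^sup>+x. indicator {0..1} (x \<bullet> e) * g (x + s *\<^sub>R e) \<partial>lborel) \<partial>lborel)"
    by (rule lborel_pair.Fubini') measurable
  also have "\<dots> = (\<integral>\<^sup>+s. (\<integral>\<^sup>+x. indicator {0..1} (x \<bullet> e - s) * g x \<partial>lborel) \<partial>lborel)"
  proof (rule nn_integral_cong)
    fix s :: real
    have "(\<integral>\<^sup>+x. indicator {0..1} ((x + s *\<^sub>R e) \<bullet> e - s) * g (x + s *\<^sub>R e) \<partial>lborel)
        = (\<integral>\<^sup>+x. indicator {0..1} (x \<bullet> e - s) * g x \<partial>lborel)"
      by (rule nn_integral_translation) measurable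
    then show "(\<integral>\<^sup>+x. indicator {0..1} (x \<bullet> e) * g (x + s *\<^sub>R e) \<partial>lborel)
        = (\<integral>\<^sup>+x. indicator {0..1} (x \<bullet> e - s) * g x \<partial>lborel)"
      by (simp add: inner_add_left ee)
  qed
  also have "\<dots> = (\<integral>\<^sup>+x. (\<integral>\<^sup>+s. indicator {0..1} (x \<bullet> e - s) * g x \<partial>lborel) \<partial>lborel)"
    by (rule lborel_pair.Fubini'[symmetric]) measurable
  also have "\<dots> = (\<integral>\<^sup>+x. g x \<partial>lborel)"
  proof (rule nn_integral_cong)
    fix x
    have "(\<integral>\<^sup>+s. indicator {0..1} (x \<bullet> e - s) * g x \<partial>lborel)
        = (\<integral>\<^sup>+s. indicator {x \<bullet> e - 1 .. x \<bullet> e} s * g x \<partial>lborel)"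
      by (intro nn_integral_cong) (auto simp: indicator_def)
    also have "\<dots> = g x"
      by (subst nn_integral_multc) (auto simp: nn_integral_indicator)
    finally show "(\<integral>\<^sup>+s. indicator {0..1} (x \<bullet> e - s) * g x \<partial>lborel) = g x" .
  qed
  finally show ?thesis ..
qed

section \<open>The metric in frame coordinates\<close>

text \<open>The coordinates of a tangent vector in the frame \<open>X\<^sub>k, Y\<^sub>k, T\<close> at \<open>p\<close>. They turn the metric into the
  Euclidean inner product, which gives access to Cauchy--Schwarz and orthonormal bases.\<close>

definition frame_coords :: "'n::finite heis \<Rightarrow> 'n heis \<Rightarrow> 'n heis" where
  "frame_coords p u = (fst u, Tcoeff p u)"

lemma Tcoeff_linear: "linear (Tcoeff p)"
  by (rule linearI)
    (simp_all add: Tcoeff_def sum_subtractf sum.distrib sum_distrib_left algebra_simps)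

text \<open>Together with linearity in \<open>u\<close>, linearity and antisymmetry in the base point make all Christoffel
  terms computable.\<close>

lemma Tcoeff_base_linear: "linear (\<lambda>q. Tcoeff q u - snd u)"
  by (rule linearI)
    (simp_all add: Tcoeff_def sum_subtractf sum.distrib sum_distrib_left algebra_simps)

lemma Tcoeff_antisym: "Tcoeff p u - snd u = - (Tcoeff u p - snd p)"
  by (simp add: Tcoeff_def sum_subtractf algebra_simps)

lemma Tcoeff_self: "Tcoeff u u = snd u"
  using Tcoeff_antisym[of u u] by simp

lemma Tcoeff_T: "Tcoeff p (0, s) = s" "Tcoeff (0, s) u = snd u"
  by (simp_all add: Tcoeff_def)

lemma frame_coords_linear: "linear (frame_coords p)"
  by (rule linearI) (simp_all add: frame_coords_def linear_add[OF Tcoeff_linear] linear_scale[OF Tcoeff_linear])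

lemma hmetric_eq_inner: "hmetric p u v = frame_coords p u \<bullet> frame_coords p v"
  by (simp add: hmetric_def frame_coords_def inner_prod_def inner_vec_def inner_complex_def)

lemma hmetric_fst: "hmetric p u v = fst u \<bullet> fst v + Tcoeff p u * Tcoeff p v"
  by (simp add: hmetric_eq_inner frame_coords_def inner_prod_def)

lemma hnorm_eq_norm: "hnorm p u = norm (frame_coords p u)"
  by (simp add: hnorm_def hmetric_eq_inner norm_eq_sqrt_inner)

lemma frame_coords_bij: "bij (frame_coords p)"
proof (rule o_bij)
  let ?g = "\<lambda>w. (fst w, snd w - Tcoeff p (fst w, 0))"
  have T: "Tcoeff p (a, s) = s + Tcoeff p (a, 0)" for a :: "complex ^ 'a" and s
    by (simp add: Tcoeff_def)
  show "?g \<circ> frame_coords p = id"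
  proof
    fix u
    show "(?g \<circ> frame_coords p) u = id u"
      using T[of "fst u" "snd u"] by (simp add: frame_coords_def)
  qed
  show "frame_coords p \<circ> ?g = id"
  proof
    fix w
    show "(frame_coords p \<circ> ?g) w = id w"
      using T[of "fst w" "snd w - Tcoeff p (fst w, 0)"] by (simp add: frame_coords_def)
  qed
qed

lemma hmetric_commute: "hmetric p u v = hmetric p v u"
  by (simp add: hmetric_eq_inner inner_commute)

lemma hmetric_linear: "linear (hmetric p u)" "linear (\<lambda>u. hmetric p u v)"
  unfolding hmetric_eq_inner
  by (intro linearI; simp add: linear_add[OF frame_coords_linear] linear_scale[OF frame_coords_linear]
      inner_add_left inner_add_right)+

lemma hmetric_pos: "u \<noteq> 0 \<Longrightarrow> 0 < hmetric p u u"
proof -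
  assume "u \<noteq> 0"
  then have "frame_coords p u \<noteq> 0"
    using frame_coords_bij[of p] linear_0[OF frame_coords_linear, of p] by (metis bij_pointE)
  then show ?thesis by (simp add: hmetric_eq_inner)
qed

section \<open>Traces and the divergence\<close>

text \<open>Expanding \<open>e i\<close> in the standard basis and exchanging the sums leaves the expansion of \<open>A b\<close> in the
  system \<open>e\<close>. The family is indexed so that it also covers the frame.\<close>

lemma trace_orthonormal_expansion:
  fixes A :: "'n::finite heis \<Rightarrow> 'n heis"
  assumes "finite I" and A: "linear A"
    and expand: "\<And>v. v = (\<Sum>i\<in>I. hmetric p v (e i) *\<^sub>R e i)"
  shows "(\<Sum>i\<in>I. hmetric p (A (e i)) (e i)) = (\<Sum>b\<in>Basis. A b \<bullet> b)"
proof -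
  have "hmetric p (A (e i)) (e i) = (\<Sum>b\<in>Basis. (e i \<bullet> b) * hmetric p (A b) (e i))" for i
  proof -
    have "A (e i) = A (\<Sum>b\<in>Basis. (e i \<bullet> b) *\<^sub>R b)" by (simp add: euclidean_representation)
    also have "\<dots> = (\<Sum>b\<in>Basis. (e i \<bullet> b) *\<^sub>R A b)"
      by (simp add: linear_sum[OF A] linear_scale[OF A])
    finally show ?thesis
      by (simp add: linear_sum[OF hmetric_linear(2)] linear_scale[OF hmetric_linear(2)])
  qed
  then have "(\<Sum>i\<in>I. hmetric p (A (e i)) (e i))
      = (\<Sum>i\<in>I. \<Sum>b\<in>Basis. (e i \<bullet> b) * hmetric p (A b) (e i))" by simp
  also have "\<dots> = (\<Sum>b\<in>Basis. \<Sum>i\<in>I. (e i \<bullet> b) * hmetric p (A b) (e i))"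
    by (rule sum.swap)
  also have "\<dots> = (\<Sum>b\<in>Basis. (\<Sum>i\<in>I. hmetric p (A b) (e i) *\<^sub>R e i) \<bullet> b)"
    by (simp add: inner_sum_left mult.commute)
  also have "\<dots> = (\<Sum>b\<in>Basis. A b \<bullet> b)"
    by (simp add: expand[symmetric])
  finally show ?thesis .
qed

definition frame_vec :: "'n::finite heis \<Rightarrow> 'n + 'n + unit \<Rightarrow> 'n heis" where
  "frame_vec p i = (case i of Inl k \<Rightarrow> Xf k p | Inr (Inl k) \<Rightarrow> Yf k p | Inr (Inr _) \<Rightarrow> Tf p)"

lemma sum_frame:
  "(\<Sum>i\<in>UNIV. h (frame_vec p i)) =
     (\<Sum>k\<in>UNIV. h (Xf k p) + h (Yf k p)) + (h (Tf p) :: 'b::comm_monoid_add)"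
  by (simp add: UNIV_Plus_UNIV[symmetric] sum.Plus frame_vec_def sum.distrib UNIV_unit algebra_simps
      del: UNIV_Plus_UNIV)

lemma hmetric_frame:
  "hmetric p u (Xf k p) = Re (fst u $ k)" "hmetric p u (Yf k p) = Im (fst u $ k)"
  "hmetric p u (Tf p) = Tcoeff p u"
proof -
  have "fst u \<bullet> axis k 1 = Re (fst u $ k)" "fst u \<bullet> axis k \<i> = Im (fst u $ k)"
    by (simp_all add: inner_axis inner_complex_def)
  then show "hmetric p u (Xf k p) = Re (fst u $ k)" "hmetric p u (Yf k p) = Im (fst u $ k)"
    by (simp_all add: hmetric_fst) (simp_all add: Xf_def Yf_def)
  show "hmetric p u (Tf p) = Tcoeff p u" by (simp add: hmetric_fst) (simp add: Tf_def)
qed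

lemma frame_vec_expansion: "v = (\<Sum>i\<in>UNIV. hmetric p v (frame_vec p i) *\<^sub>R frame_vec p i)"
  unfolding sum_frame[of "\<lambda>e. hmetric p v e *\<^sub>R e"] hmetric_frame by (rule frame_expansion)

lemma trace_frame:
  assumes "linear A"
  shows "(\<Sum>k\<in>UNIV. hmetric p (A (Xf k p)) (Xf k p) + hmetric p (A (Yf k p)) (Yf k p))
    + hmetric p (A (Tf p)) (Tf p) = (\<Sum>b\<in>Basis. A b \<bullet> b)"
  using trace_orthonormal_expansion[OF finite assms frame_vec_expansion[of _ p]]
  unfolding sum_frame[of "\<lambda>e. hmetric p (A e) e"] .

lemma trace_orthonormal_basis:
  assumes B: "orthonormal_basis p UNIV B" and "linear A"
  shows "(\<Sum>e\<in>B. hmetric p (A e) e) = (\<Sum>b\<in>Basis. A b \<bullet> b)"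
proof (rule trace_orthonormal_expansion[OF _ assms(2)])
  show fB: "finite B" using B by (simp add: orthonormal_basis_def)
  have on: "hmetric p e e' = (if e = e' then 1 else 0)" if "e \<in> B" "e' \<in> B" for e e'
    using B that by (simp add: orthonormal_basis_def)
  fix v
  have "v \<in> span B" using B by (simp add: orthonormal_basis_def)
  then obtain a where a: "v = (\<Sum>e\<in>B. a e *\<^sub>R e)"
    by (auto simp: span_finite[OF fB])
  have "hmetric p v e' = a e'" if "e' \<in> B" for e'
  proof -
    have "hmetric p v e' = (\<Sum>e\<in>B. a e * hmetric p e e')"
      unfolding a by (simp add: linear_sum[OF hmetric_linear(2)] linear_scale[OF hmetric_linear(2)])
    also have "\<dots> = (\<Sum>e\<in>B. if e = e' then a e' else 0)"
      by (intro sum.cong) (auto simp: on that)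
    finally show ?thesis using that fB by simp
  qed
  then show "v = (\<Sum>e\<in>B. hmetric p v e *\<^sub>R e)"
    using a by simp
qed

lemma christoffel_linear: "linear (\<lambda>v. christoffel p v u)"
proof (rule linearI)
  have Tc: "Tcoeff (a + b) w - snd w = (Tcoeff a w - snd w) + (Tcoeff b w - snd w)"
     "Tcoeff (c *\<^sub>R a) w - snd w = c * (Tcoeff a w - snd w)" for a b w :: "'a heis" and c
    using linear_add[OF Tcoeff_base_linear[of w], of a b] linear_scale[OF Tcoeff_base_linear[of w], of c a]
    by simp_all
  show "christoffel p (v + w) u = christoffel p v u + christoffel p w u" for v w
  proof (rule hmetric_nondegenerate)
    fix z
    show "hmetric p (christoffel p (v + w) u) z = hmetric p (christoffel p v u + christoffel p w u) z"
      unfolding linear_add[OF hmetric_linear(2)] hmetric_christoffel koszul_eq Tc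
      by (simp add: linear_add[OF Tcoeff_linear] algebra_simps)
  qed
  show "christoffel p (c *\<^sub>R v) u = c *\<^sub>R christoffel p v u" for c v
  proof (rule hmetric_nondegenerate)
    fix z
    show "hmetric p (christoffel p (c *\<^sub>R v) u) z = hmetric p (c *\<^sub>R christoffel p v u) z"
      unfolding linear_scale[OF hmetric_linear(2)] hmetric_christoffel koszul_eq Tc
      by (simp add: linear_scale[OF Tcoeff_linear] algebra_simps)
  qed
qed

lemma trace_christoffel: "(\<Sum>b\<in>Basis. christoffel p b u \<bullet> b) = 0"
  unfolding trace_frame[OF christoffel_linear, of p p u, symmetric] hmetric_christoffel koszul_eq
  by (simp add: Tcoeff_self) (simp add: Tf_def Tcoeff_T)

lemma levi_civita_linear:
  assumes "U differentiable (at p)"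
  shows "linear (levi_civita UNIV U p)"
proof -
  have "linear (frechet_derivative U (at p))"
    using assms frechet_derivative_works has_derivative_linear by blast
  then show ?thesis
    unfolding levi_civita_def by (intro linear_compose_add christoffel_linear)
qed

lemma hdiv_eq_trace:
  assumes "U differentiable (at p)"
  shows "hdiv U p = (\<Sum>b\<in>Basis. levi_civita UNIV U p b \<bullet> b)"
  unfolding hdiv_def by (rule trace_frame[OF levi_civita_linear[OF assms]])

text \<open>The Riemannian volume is Lebesgue measure, so the two divergences agree; here this is seen from the
  vanishing trace of the Christoffel terms.\<close>

lemma hdiv_eq_euclidean:
  assumes "U differentiable (at p)"
  shows "hdiv U p = (\<Sum>b\<in>Basis. frechet_derivative U (at p) b \<bullet> b)"
  unfolding hdiv_eq_trace[OF assms] levi_civita_def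
  by (simp add: inner_add_left sum.distrib trace_christoffel)

lemma hdiv_add:
  assumes "U differentiable (at p)" "V differentiable (at p)"
  shows "hdiv (\<lambda>x. U x + V x) p = hdiv U p + hdiv V p"
proof -
  have d: "((\<lambda>x. U x + V x) has_derivative
      (\<lambda>v. frechet_derivative U (at p) v + frechet_derivative V (at p) v)) (at p)"
    using assms by (intro has_derivative_add) (auto simp: frechet_derivative_works[symmetric])
  show ?thesis
    using assms differentiableI[OF d]
    by (simp add: hdiv_eq_euclidean frechet_derivative_at[OF d, symmetric] inner_add_left sum.distrib)
qed

lemma hdiv_scaleR:
  fixes g :: "'n::finite heis \<Rightarrow> real"
  assumes "g differentiable (at p)" "Z differentiable (at p)"
  shows "hdiv (\<lambda>x. g x *\<^sub>R Z x) p = g p * hdiv Z p + frechet_derivative g (at p) (Z p)"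
proof -
  have dg: "(g has_derivative frechet_derivative g (at p)) (at p)"
    and dZ: "(Z has_derivative frechet_derivative Z (at p)) (at p)"
    using assms frechet_derivative_works by blast+
  have d: "((\<lambda>x. g x *\<^sub>R Z x) has_derivative
      (\<lambda>v. g p *\<^sub>R frechet_derivative Z (at p) v + frechet_derivative g (at p) v *\<^sub>R Z p)) (at p)"
    by (rule has_derivative_scaleR[OF dg dZ])
  have "frechet_derivative g (at p) (Z p) = (\<Sum>b\<in>Basis. (Z p \<bullet> b) * frechet_derivative g (at p) b)"
    by (subst euclidean_representation[of "Z p", symmetric])
       (simp only: linear_sum[OF has_derivative_linear[OF dg]] linear_scale[OF has_derivative_linear[OF dg]]
         real_scaleR_def)
  then show ?thesis
    using d assms
    by (simp add: hdiv_eq_euclidean differentiableI[OF d] frechet_derivative_at[OF d, symmetric]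
        inner_add_left sum.distrib sum_distrib_left mult.commute)
qed

lemma hdiv_eq_on_open:
  assumes "open W" "x \<in> W" "\<And>y. y \<in> W \<Longrightarrow> U y = V y"
  shows "hdiv U x = hdiv V x"
proof -
  have "levi_civita UNIV U x = levi_civita UNIV V x"
    using frechet_derivative_eq_on_open[OF assms] assms
    by (auto simp: levi_civita_def fun_eq_iff)
  then show ?thesis by (simp add: hdiv_def)
qed

lemma continuous_on_hdiv:
  assumes "C1_on U W"
  shows "continuous_on W (hdiv U)"
proof -
  have "continuous_on W (\<lambda>p. \<Sum>b\<in>Basis. frechet_derivative U (at p) b \<bullet> b)"
    by (intro continuous_intros C1_on_continuous_derivative assms)
  then show ?thesis
    by (rule continuous_on_eq) (use assms hdiv_eq_euclidean in \<open>fastforce simp: C1_on_iff\<close>)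
qed

lemma hdiv_zero_off_support:
  assumes "closed K" "\<And>x. x \<notin> K \<Longrightarrow> U x = 0" "x \<notin> K"
  shows "hdiv U x = 0"
proof -
  have "hdiv U x = hdiv (\<lambda>_. 0) x"
    by (rule hdiv_eq_on_open[of "- K"]) (use assms in auto)
  then show ?thesis by (simp add: hdiv_eq_euclidean)
qed

lemma integrable_hdiv:
  assumes "C1_on U UNIV" "compact K" "\<And>x. x \<notin> K \<Longrightarrow> U x = 0"
  shows "integrable lborel (hdiv U)"
  using continuous_on_hdiv[OF assms(1)] assms(2)
  by (rule integrable_continuous_compact_support)
     (use assms in \<open>auto intro: hdiv_zero_off_support[OF compact_imp_closed]\<close>)

lemma integral_hdiv_eq_0:
  assumes U: "C1_on U UNIV" and K: "compact K" "\<And>x. x \<notin> K \<Longrightarrow> U x = 0"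
  shows "(\<integral>x. hdiv U x \<partial>lborel) = 0"
proof -
  have bl: "bounded_linear (\<lambda>u. u \<bullet> b)" for b :: "'a heis" by (rule bounded_linear_inner_left)
  have C: "C1_on (\<lambda>x. U x \<bullet> b) UNIV" for b
    by (rule C1_on_linear_compose[OF bl U])
  have e: "hdiv U x = (\<Sum>b\<in>Basis. frechet_derivative (\<lambda>x. U x \<bullet> b) (at x) b)" for x
  proof -
    have "frechet_derivative (\<lambda>x. U x \<bullet> b) (at x) = (\<lambda>v. frechet_derivative U (at x) v \<bullet> b)" for b
      by (rule frechet_derivative_at[symmetric])
         (rule bounded_linear.has_derivative[OF bl C1_on_has_derivative[OF U UNIV_I]])
    moreover have "U differentiable (at x)" using U unfolding C1_on_iff by blast
    ultimately show ?thesis by (simp add: hdiv_eq_euclidean)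
  qed
  have z: "U x \<bullet> b = 0" if "x \<notin> K" for x b using K(2)[OF that] by simp
  have I: "integrable lborel (\<lambda>x. frechet_derivative (\<lambda>x. U x \<bullet> b) (at x) b)" for b
    by (rule integrable_derivative[OF C K(1) z])
  have Z: "(\<integral>x. frechet_derivative (\<lambda>x. U x \<bullet> b) (at x) b \<partial>lborel) = 0" for b
    by (rule integral_derivative_eq_0[OF C K(1) z])
  show ?thesis unfolding e by (simp add: Bochner_Integration.integral_sum[OF I] Z)
qed

section \<open>Horizontal gradients\<close>

lemma hproj_eq: "hproj p u = u - Tcoeff p u *\<^sub>R Tf p"
proof -
  have "u = hproj p u + Tcoeff p u *\<^sub>R Tf p"
    unfolding hproj_def hmetric_frame by (rule frame_expansion)
  then show ?thesis by (simp add: eq_diff_eq)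
qed

lemma hproj_eq_self_iff: "hproj p u = u \<longleftrightarrow> Tcoeff p u = 0"
proof -
  have "Tf p \<noteq> 0" by (simp add: Tf_def zero_prod_def)
  then show ?thesis by (simp add: hproj_eq)
qed

definition hgrad :: "('n::finite heis \<Rightarrow> real) \<Rightarrow> 'n heis \<Rightarrow> 'n heis" where
  "hgrad f p = (\<Sum>k\<in>UNIV. frechet_derivative f (at p) (Xf k p) *\<^sub>R Xf k p
                       + frechet_derivative f (at p) (Yf k p) *\<^sub>R Yf k p)"

lemma Tcoeff_hgrad [simp]: "Tcoeff p (hgrad f p) = 0"
  unfolding hgrad_def by (simp add: linear_sum[OF Tcoeff_linear] linear_add[OF Tcoeff_linear] linear_scale[OF Tcoeff_linear])

lemma hmetric_horizontal:
  "Tcoeff p u = 0 \<Longrightarrow> hmetric p u v = fst u \<bullet> fst v"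
  by (simp add: hmetric_fst)

lemma derivative_horizontal:
  assumes "f differentiable (at p)" "Tcoeff p u = 0"
  shows "frechet_derivative f (at p) u = hmetric p (hgrad f p) u"
proof -
  let ?D = "frechet_derivative f (at p)"
  have lin: "linear ?D" using assms frechet_derivative_works has_derivative_linear by blast
  have "?D u = ?D (\<Sum>k\<in>UNIV. Re (fst u $ k) *\<^sub>R Xf k p + Im (fst u $ k) *\<^sub>R Yf k p)"
    using frame_expansion[of u p] assms(2) by simp
  also have "\<dots> = (\<Sum>k\<in>UNIV. Re (fst u $ k) * ?D (Xf k p) + Im (fst u $ k) * ?D (Yf k p))"
    by (simp add: linear_sum[OF lin] linear_add[OF lin] linear_scale[OF lin])
  also have "\<dots> = hmetric p (hgrad f p) u"
    by (simp add: hgrad_def linear_sum[OF hmetric_linear(2)] linear_add[OF hmetric_linear(2)]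
        linear_scale[OF hmetric_linear(2)] hmetric_commute[of p _ u] hmetric_frame mult.commute)
  finally show ?thesis .
qed

text \<open>For \<open>\<Omega> = {f > 0}\<close> the horizontal gradient points into \<open>\<Omega>\<close>, whence the sign. The field is defined
  off the boundary too: it is normal to every level set of \<open>f\<close>.\<close>

definition outward_horizontal_normal :: "('n::finite heis \<Rightarrow> real) \<Rightarrow> 'n heis \<Rightarrow> 'n heis" where
  "outward_horizontal_normal f p = - (inverse (hnorm p (hgrad f p)) *\<^sub>R hgrad f p)"

lemma Tcoeff_outward [simp]: "Tcoeff p (outward_horizontal_normal f p) = 0"
  by (simp add: outward_horizontal_normal_def linear_neg[OF Tcoeff_linear] linear_scale[OF Tcoeff_linear])

lemma hnorm_scaleR: "hnorm p (c *\<^sub>R u) = \<bar>c\<bar> * hnorm p u"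
  by (simp add: hnorm_eq_norm linear_scale[OF frame_coords_linear])

lemma hnorm_minus: "hnorm p (- u) = hnorm p u"
  by (simp add: hnorm_eq_norm linear_neg[OF frame_coords_linear])

lemma hnorm_pos: "u \<noteq> 0 \<Longrightarrow> 0 < hnorm p u"
  by (simp add: hnorm_def hmetric_pos)

lemma hnorm_square: "hmetric p u u = (hnorm p u)\<^sup>2"
  by (simp add: hnorm_eq_norm hmetric_eq_inner dot_square_norm)

lemma hnorm_outward:
  "hgrad f p \<noteq> 0 \<Longrightarrow> hnorm p (outward_horizontal_normal f p) = 1"
  using hnorm_pos[of "hgrad f p" p]
  by (simp add: outward_horizontal_normal_def hnorm_minus hnorm_scaleR)

text \<open>Among the horizontal vectors of norm at most one the outward normal decreases \<open>f\<close> fastest, by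
  Cauchy--Schwarz. This is the pointwise calibration inequality, and it holds off the boundary too.\<close>

lemma derivative_outward_le:
  assumes "f differentiable (at p)" "hgrad f p \<noteq> 0" "Tcoeff p u = 0" "hnorm p u \<le> 1"
  shows "frechet_derivative f (at p) (outward_horizontal_normal f p - u) \<le> 0"
proof -
  let ?h = "hgrad f p"
  have pos: "0 < hnorm p ?h" by (rule hnorm_pos[OF assms(2)])
  have T: "Tcoeff p (outward_horizontal_normal f p - u) = 0"
    using assms(3) by (simp add: linear_diff[OF Tcoeff_linear])
  have "hmetric p ?h (outward_horizontal_normal f p) = - hnorm p ?h"
    using pos
    by (simp add: outward_horizontal_normal_def linear_neg[OF hmetric_linear(1)]
        linear_scale[OF hmetric_linear(1)] hnorm_square power2_eq_square)
  moreover have "- hmetric p ?h u \<le> hnorm p ?h * hnorm p u"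
    using Cauchy_Schwarz_ineq2[of "frame_coords p ?h" "frame_coords p u"]
    by (simp add: hmetric_eq_inner hnorm_eq_norm)
  moreover have "hnorm p ?h * hnorm p u \<le> hnorm p ?h"
    using pos assms(4) by simp
  ultimately show ?thesis
    unfolding derivative_horizontal[OF assms(1) T] linear_diff[OF hmetric_linear(1)] by linarith
qed

lemma C1_on_frame: "C1_on (Xf k) W" "C1_on (Yf k) W"
proof -
  have bl: "bounded_linear (\<lambda>p :: 'a heis. Im (fst p $ k))" "bounded_linear (\<lambda>p :: 'a heis. Re (fst p $ k))"
    by (rule bounded_linear_compose[OF bounded_linear_Im bounded_linear_compose[OF bounded_linear_vec_nth bounded_linear_fst]]
          bounded_linear_compose[OF bounded_linear_Re bounded_linear_compose[OF bounded_linear_vec_nth bounded_linear_fst]])+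
  have 1: "Xf k = (\<lambda>p. (axis k 1, 0) + Im (fst p $ k) *\<^sub>R (0, 1))"
    and 2: "Yf k = (\<lambda>p. (axis k \<i>, 0) - Re (fst p $ k) *\<^sub>R (0, 1))"
    by (simp_all add: fun_eq_iff Xf_def Yf_def)
  show "C1_on (Xf k) W" unfolding 1
    by (intro C1_on_add C1_on_const C1_on_scaleR C1_on_bounded_linear bl)
  show "C1_on (Yf k) W" unfolding 2
    by (intro C1_on_diff C1_on_const C1_on_scaleR C1_on_bounded_linear bl)
qed

lemma C2_on_derivative:
  fixes f :: "'a::euclidean_space \<Rightarrow> 'b::real_normed_vector"
  assumes "C2_on f W" "C1_on X W" "open W"
  shows "C1_on (\<lambda>x. frechet_derivative f (at x) (X x)) W"
proof -
  obtain f' :: "'a \<Rightarrow> 'a \<Rightarrow>\<^sub>L 'b" where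
    d: "\<And>x. x \<in> W \<Longrightarrow> (f has_derivative blinfun_apply (f' x)) (at x)" and c: "C1_on f' W"
    using assms(1) unfolding C2_on_def by blast
  show ?thesis
    by (rule C1_on_cong[OF C1_on_bounded_bilinear[OF bounded_bilinear_blinfun_apply c assms(2)] assms(3)])
       (simp add: frechet_derivative_at[OF d, symmetric])
qed

lemma C2_on_imp_C1_on:
  fixes f :: "'a::euclidean_space \<Rightarrow> 'b::real_normed_vector"
  assumes "C2_on f W" shows "C1_on f W"
  using assms C1_on_imp_continuous_on unfolding C2_on_def C1_on_def[of f] by blast

lemma C1_on_hgrad:
  assumes "C2_on f W" "open W"
  shows "C1_on (hgrad f) W"
  unfolding hgrad_def[abs_def]
  by (intro C1_on_sum C1_on_add C1_on_scaleR C2_on_derivative assms C1_on_frame) simp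

lemma C1_on_outward:
  assumes "C2_on f W" "open W" "\<And>x. x \<in> W \<Longrightarrow> hgrad f x \<noteq> 0"
  shows "C1_on (outward_horizontal_normal f) W"
proof -
  have h: "C1_on (hgrad f) W" by (rule C1_on_hgrad[OF assms(1,2)])
  have f: "C1_on (\<lambda>x. fst (hgrad f x)) W"
    by (rule C1_on_linear_compose[OF bounded_linear_fst h])
  have pos: "0 < fst (hgrad f x) \<bullet> fst (hgrad f x)" if "x \<in> W" for x
    using hmetric_pos[OF assms(3)[OF that], of x] by (simp add: hmetric_horizontal)
  have i: "C1_on (\<lambda>r::real. inverse (sqrt r)) {0<..}"
  proof (rule C1_on_real)
    show "((\<lambda>r. inverse (sqrt r)) has_real_derivative
        - (inverse (sqrt r) / 2 * inverse (sqrt r ^ Suc (Suc 0)))) (at r)" if "r \<in> {0<..}" for r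
      using that by (intro DERIV_inverse_fun DERIV_real_sqrt) auto
    show "continuous_on {0<..} (\<lambda>r. - (inverse (sqrt r) / 2 * inverse (sqrt r ^ Suc (Suc 0))))"
      by (intro continuous_intros) auto
  qed
  have "C1_on (\<lambda>x. inverse (sqrt (fst (hgrad f x) \<bullet> fst (hgrad f x)))) W"
    by (rule C1_on_compose[OF C1_on_inner[OF f f] i]) (use pos in auto)
  then show ?thesis
    unfolding outward_horizontal_normal_def[abs_def] hnorm_def
    by (intro C1_on_minus C1_on_scaleR h) (simp add: hmetric_horizontal)
qed

section \<open>Calibration\<close>

text \<open>The divergence theorem on \<open>A = {f > 0}\<close>, in the weak form of an inequality: a field along which
  \<open>f\<close> does not increase has nonnegative outward flux. With \<open>g\<^sub>n\<close> a nondecreasing cut-off of \<open>n f\<close>,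
  \<open>0 = \<integral> div (g\<^sub>n Z) = \<integral> g\<^sub>n div Z + \<integral> dg\<^sub>n(Z)\<close> and the last term is at most zero. The sign of \<open>df(Z)\<close>
  is assumed in a whole neighbourhood because \<open>dg\<^sub>n\<close> does not live on the boundary but in a thin layer
  next to it.\<close>

lemma flux_nonneg:
  fixes f :: "'n::finite heis \<Rightarrow> real"
  assumes f: "C1_on f W" and W: "open W" and K: "compact K" "K \<subseteq> W"
    and A: "A \<in> sets borel" "\<And>x. x \<in> W \<Longrightarrow> x \<in> A \<longleftrightarrow> 0 < f x"
    and Z: "C1_on Z UNIV" "\<And>x. x \<notin> K \<Longrightarrow> Z x = 0"
    and le: "\<And>x. x \<in> W \<Longrightarrow> frechet_derivative f (at x) (Z x) \<le> 0"
  shows "0 \<le> (LINT x:A|lborel. hdiv Z x)"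
proof -
  define g where "g n x = transition (real n * f x)" for n x
  define s where "s n x = g n x * hdiv Z x" for n x
  have clK: "closed K" using K compact_imp_closed by blast
  have z0: "hdiv Z x = 0" if "x \<notin> K" for x
    by (rule hdiv_zero_off_support[OF clK Z(2) that])
  have C1g: "C1_on (g n) W" for n
    unfolding g_def by (rule C1_on_compose[OF C1_on_mult[OF C1_on_const f] C1_on_transition]) auto
  have C1gZ: "C1_on (\<lambda>x. g n x *\<^sub>R Z x) UNIV" for n
    by (rule C1_on_zero_extension[OF C1_on_scaleR[OF C1g C1_on_subset[OF Z(1)]] W clK K(2)])
       (use Z in auto)
  have le_s: "hdiv (\<lambda>x. g n x *\<^sub>R Z x) x \<le> s n x" for n x
  proof (cases "x \<in> W")
    case True
    have df: "(f has_derivative frechet_derivative f (at x)) (at x)"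
      by (rule C1_on_has_derivative[OF f True])
    have "((\<lambda>x. transition (real n * f x)) has_derivative
        (\<lambda>v. real n * frechet_derivative f (at x) v * transition' (real n * f x))) (at x)"
      by (rule has_derivative_compose[OF has_derivative_mult_right[OF df] transition_deriv[unfolded has_field_derivative_def], THEN has_derivative_eq_rhs])
         (simp add: mult.commute)
    then have dg: "frechet_derivative (g n) (at x) = (\<lambda>v. real n * frechet_derivative f (at x) v * transition' (real n * f x))"
      unfolding g_def[abs_def] by (rule frechet_derivative_at[symmetric])
    have "hdiv (\<lambda>x. g n x *\<^sub>R Z x) x = g n x * hdiv Z x + frechet_derivative (g n) (at x) (Z x)"
      by (intro hdiv_scaleR C1_on_differentiable[OF C1g True] C1_on_differentiable[OF Z(1) UNIV_I])
    moreover have "frechet_derivative (g n) (at x) (Z x) \<le> 0"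
      unfolding dg by (intro mult_nonpos_nonneg mult_nonneg_nonpos le True transition'_nonneg) simp
    ultimately show ?thesis by (simp add: s_def)
  next
    case False
    then have "x \<notin> K" using K by auto
    then have "hdiv (\<lambda>x. g n x *\<^sub>R Z x) x = 0"
      by (intro hdiv_zero_off_support[OF clK]) (use Z in auto)
    then show ?thesis using z0[OF \<open>x \<notin> K\<close>] by (simp add: s_def)
  qed
  have Is: "integrable lborel (s n)" for n
  proof -
    have "integrable lborel (\<lambda>x. indicator K x *\<^sub>R s n x)"
      unfolding s_def
      by (intro borel_integrable_compact K continuous_on_mult
          continuous_on_subset[OF C1_on_imp_continuous_on[OF C1g] K(2)]
          continuous_on_subset[OF continuous_on_hdiv[OF Z(1)] subset_UNIV])
    moreover have "(\<lambda>x. indicator K x *\<^sub>R s n x) = s n"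
      using z0 by (auto simp: fun_eq_iff s_def indicator_def)
    ultimately show ?thesis by simp
  qed
  have IZ: "integrable lborel (hdiv Z)" by (rule integrable_hdiv[OF Z(1) K(1) Z(2)])
  have "0 \<le> (\<integral>x. s n x \<partial>lborel)" for n
  proof -
    have "(\<integral>x. hdiv (\<lambda>x. g n x *\<^sub>R Z x) x \<partial>lborel) \<le> (\<integral>x. s n x \<partial>lborel)"
      by (rule integral_mono[OF integrable_hdiv[OF C1gZ K(1)] Is le_s]) (use Z in auto)
    moreover have "(\<integral>x. hdiv (\<lambda>x. g n x *\<^sub>R Z x) x \<partial>lborel) = 0"
      by (rule integral_hdiv_eq_0[OF C1gZ K(1)]) (use Z in auto)
    ultimately show ?thesis by simp
  qed
  moreover have "(\<lambda>n. \<integral>x. s n x \<partial>lborel) \<longlonglongrightarrow> (\<integral>x. indicator A x *\<^sub>R hdiv Z x \<partial>lborel)"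
  proof (rule integral_dominated_convergence)
    show "(\<lambda>x. indicator A x *\<^sub>R hdiv Z x) \<in> borel_measurable lborel"
      using A(1) IZ by measurable
    show "s n \<in> borel_measurable lborel" for n using Is by measurable
    show "integrable lborel (\<lambda>x. \<bar>hdiv Z x\<bar>)" using IZ by (rule integrable_abs)
    show "AE x in lborel. (\<lambda>n. s n x) \<longlonglongrightarrow> indicator A x *\<^sub>R hdiv Z x"
    proof (rule AE_I2)
      fix x
      show "(\<lambda>n. s n x) \<longlonglongrightarrow> indicator A x *\<^sub>R hdiv Z x"
      proof (cases "x \<in> K")
        case True
        then have xW: "x \<in> W" using K by auto
        show ?thesis
        proof (cases "0 < f x")
          case pos: True
          obtain m where m: "pi/2 \<le> real m * f x"
            using reals_Archimedean3[OF pos, rule_format, of "pi/2"] by (auto intro: less_imp_le)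
          have "s n x = hdiv Z x" if "n \<ge> m" for n
          proof -
            have "real m * f x \<le> real n * f x" using that pos by simp
            then have "pi/2 \<le> real n * f x" using m by linarith
            then show ?thesis by (simp add: s_def g_def transition_simps)
          qed
          then have "(\<lambda>n. s n x) \<longlonglongrightarrow> hdiv Z x"
            by (intro tendsto_eventually eventually_sequentiallyI[of m]) auto
          then show ?thesis using A(2)[OF xW] pos by simp
        next
          case False
          then have "s n x = 0" for n
            by (simp add: s_def g_def transition_simps mult_nonneg_nonpos)
          then show ?thesis using A(2)[OF xW] False by simp
        qed
      qed (simp add: s_def z0)
    qed
    show "AE x in lborel. norm (s n x) \<le> \<bar>hdiv Z x\<bar>" for n
      using transition_bounds by (intro AE_I2) (auto simp: s_def g_def abs_mult intro!: mult_left_le_one_le)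
  qed
  ultimately show ?thesis
    unfolding set_lebesgue_integral_def by (intro LIMSEQ_le_const) auto
qed

lemma C1c_field_compact_support:
  assumes "C1_on U UNIV" "compact K" "\<And>x. x \<notin> K \<Longrightarrow> U x = 0"
  shows "C1c_field U"
proof -
  have "support_on UNIV U \<subseteq> K" using assms(3) by (auto simp: support_on_def)
  then have "closure (support_on UNIV U) \<subseteq> K"
    using assms(2) compact_imp_closed closure_minimal by blast
  then have "compact (closure (support_on UNIV U))"
    using assms(2) compact_Int_closed[of K "closure (support_on UNIV U)"] by (simp add: Int_absorb1)
  then show ?thesis using assms(1) by (simp add: C1c_field_def)
qed

lemma C1c_field_imp_compact_support:
  assumes "C1c_field U"
  shows "\<exists>K. compact K \<and> (\<forall>x. x \<notin> K \<longrightarrow> U x = 0)"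
proof (intro exI conjI allI impI)
  show "compact (closure (support_on UNIV U))" using assms by (auto simp: C1c_field_def)
  show "U x = 0" if "x \<notin> closure (support_on UNIV U)" for x
    using that closure_subset[of "support_on UNIV U"] by (auto simp: support_on_def)
qed

text \<open>An admissible field \<open>U\<close> for \<open>A\<close> is replaced by \<open>V = (1 - \<zeta>) U + \<zeta> \<nu>\<close>, which is admissible by convexity
  and equals \<open>\<nu>\<close> where \<open>A\<close> and \<open>A'\<close> differ. Then \<open>\<integral>\<^sub>A div V \<ge> \<integral>\<^sub>A div U\<close> by the flux inequality for
  \<open>V - U = \<zeta> (\<nu> - U)\<close>, while passing from \<open>A\<close> to \<open>A'\<close> changes \<open>\<integral> div V\<close> by the integral of \<open>div \<nu>\<close>.\<close>

lemma perimeter_calibration_le: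
  fixes f :: "'n::finite heis \<Rightarrow> real"
  assumes f: "C2_on f W" and W: "open W" and h: "\<And>x. x \<in> W \<Longrightarrow> hgrad f x \<noteq> 0"
    and A: "A \<in> sets borel" "\<And>x. x \<in> W \<Longrightarrow> x \<in> A \<longleftrightarrow> 0 < f x"
    and R: "0 < \<rho>" "\<rho> < R" "cball p R \<subseteq> W"
    and A': "A' \<in> sets borel" "\<And>x. x \<notin> ball p \<rho> \<Longrightarrow> x \<in> A' \<longleftrightarrow> x \<in> A"
  shows "perimeter A \<le> perimeter A' - ereal (\<integral>x. (indicator A' x - indicator A x)
            * hdiv (outward_horizontal_normal f) x \<partial>lborel)"
    (is "_ \<le> _ - ereal ?c")
  unfolding perimeter_def[of A]
proof (rule SUP_least)
  let ?\<nu> = "outward_horizontal_normal f"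
  fix U :: "'n heis \<Rightarrow> 'n heis"
  assume "U \<in> {U. C1c_field U \<and> horizontal U \<and> (\<forall>p. hnorm p (U p) \<le> 1)}"
  then have cU: "C1c_field U" and hU: "\<And>x. Tcoeff x (U x) = 0" and nU: "\<And>x. hnorm x (U x) \<le> 1"
    by (auto simp: horizontal_def hproj_eq_self_iff)
  from cU have U: "C1_on U UNIV" by (simp add: C1c_field_def)
  from C1c_field_imp_compact_support[OF cU] obtain K
    where K: "compact K" "\<And>x. x \<notin> K \<Longrightarrow> U x = 0" by metis
  define \<zeta> where "\<zeta> x = transition ((R\<^sup>2 - (x - p) \<bullet> (x - p)) * (pi/2 * inverse (R\<^sup>2 - \<rho>\<^sup>2)))" for x
  have pos: "0 < R\<^sup>2 - \<rho>\<^sup>2" using R by (simp add: power_strict_mono)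
  have C\<zeta>: "C1_on \<zeta> V" for V
    unfolding \<zeta>_def
    by (intro C1_on_compose[OF _ C1_on_transition[of UNIV]] C1_on_mult C1_on_diff C1_on_const
        C1_on_inner C1_on_bounded_linear[OF bounded_linear_ident]) simp
  have dd: "(x - p) \<bullet> (x - p) = (dist p x)\<^sup>2" for x by (simp add: dist_norm norm_minus_commute dot_square_norm)
  have \<zeta>1: "\<zeta> x = 1" if "x \<in> ball p \<rho>" for x
  proof -
    have "(dist p x)\<^sup>2 \<le> \<rho>\<^sup>2" using that by (intro power_mono) auto
    then have "1 \<le> (R\<^sup>2 - (dist p x)\<^sup>2) * inverse (R\<^sup>2 - \<rho>\<^sup>2)"
      using pos by (simp add: field_simps)
    then have "pi/2 * 1 \<le> pi/2 * ((R\<^sup>2 - (dist p x)\<^sup>2) * inverse (R\<^sup>2 - \<rho>\<^sup>2))"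
      by (intro mult_left_mono) auto
    then have "pi/2 \<le> (R\<^sup>2 - (dist p x)\<^sup>2) * (pi/2 * inverse (R\<^sup>2 - \<rho>\<^sup>2))"
      by (simp add: mult.left_commute)
    then show ?thesis unfolding \<zeta>_def dd by (rule transition_simps(3))
  qed
  have \<zeta>0: "\<zeta> x = 0" if "x \<notin> cball p R" for x
  proof -
    have "R\<^sup>2 \<le> (dist p x)\<^sup>2" using that R by (intro power_mono) auto
    then have "(R\<^sup>2 - (dist p x)\<^sup>2) * (pi/2 * inverse (R\<^sup>2 - \<rho>\<^sup>2)) \<le> 0"
      using pos by (intro mult_nonpos_nonneg) auto
    then show ?thesis by (simp add: \<zeta>_def dd transition_simps)
  qed
  have \<zeta>b: "0 \<le> \<zeta> x" "\<zeta> x \<le> 1" for x by (auto simp: \<zeta>_def transition_bounds)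
  define Z where "Z x = \<zeta> x *\<^sub>R (?\<nu> x - U x)" for x
  have Z0: "Z x = 0" if "x \<notin> cball p R" for x by (simp add: Z_def \<zeta>0[OF that])
  have CZ: "C1_on Z UNIV"
    by (rule C1_on_zero_extension[OF _ W closed_cball R(3) Z0])
       (auto simp: Z_def[abs_def] intro!: C1_on_scaleR C\<zeta> C1_on_diff C1_on_outward[OF f W h] C1_on_subset[OF U])
  have C1f: "C1_on f W" by (rule C2_on_imp_C1_on[OF f])
  \<comment> \<open>The defining function does not increase along the correction \<open>Z\<close>, by the pointwise inequality.\<close>
  have flux: "0 \<le> (LINT x:A|lborel. hdiv Z x)"
  proof (rule flux_nonneg[OF C1f W compact_cball R(3) A CZ Z0])
    fix x assume x: "x \<in> W"
    have df: "f differentiable (at x)" by (rule C1_on_differentiable[OF C1f x])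
    have "frechet_derivative f (at x) (Z x) = \<zeta> x * frechet_derivative f (at x) (?\<nu> x - U x)"
      unfolding Z_def
      using linear_scale[OF has_derivative_linear[OF C1_on_has_derivative[OF C1f x]]] by simp
    also have "\<dots> \<le> 0"
      by (intro mult_nonneg_nonpos \<zeta>b derivative_outward_le df h x hU nU)
    finally show "frechet_derivative f (at x) (Z x) \<le> 0" .
  qed
  define V where "V x = U x + Z x" for x
  have CV: "C1_on V UNIV" unfolding V_def[abs_def] by (rule C1_on_add[OF U CZ])
  have cK: "compact (K \<union> cball p R)" using K by (simp add: compact_Un)
  have V0: "V x = 0" if "x \<notin> K \<union> cball p R" for x using that Z0 K by (simp add: V_def)
  have TV: "Tcoeff x (V x) = 0" for x
    by (simp add: V_def Z_def linear_add[OF Tcoeff_linear] linear_scale[OF Tcoeff_linear]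
        linear_diff[OF Tcoeff_linear] hU)
  have nV: "hnorm x (V x) \<le> 1" for x
  proof (cases "x \<in> W")
    case True
    have "V x = (1 - \<zeta> x) *\<^sub>R U x + \<zeta> x *\<^sub>R ?\<nu> x"
      by (simp add: V_def Z_def algebra_simps)
    then have "hnorm x (V x) \<le> hnorm x ((1 - \<zeta> x) *\<^sub>R U x) + hnorm x (\<zeta> x *\<^sub>R ?\<nu> x)"
      by (simp add: hnorm_eq_norm linear_add[OF frame_coords_linear] norm_triangle_ineq)
    also have "\<dots> = (1 - \<zeta> x) * hnorm x (U x) + \<zeta> x"
      using \<zeta>b[of x] by (simp add: hnorm_scaleR hnorm_outward[OF h[OF True]])
    also have "\<dots> \<le> (1 - \<zeta> x) * 1 + \<zeta> x"
      using \<zeta>b[of x] nU[of x] by (intro add_right_mono mult_left_mono) auto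
    finally show ?thesis by simp
  next
    case False
    then have "x \<notin> cball p R" using R(3) by blast
    then have "V x = U x" using Z0 by (simp add: V_def)
    then show ?thesis using nU by simp
  qed
  have IV: "integrable lborel (hdiv V)" by (rule integrable_hdiv[OF CV cK V0])
  have IU: "integrable lborel (hdiv U)" by (rule integrable_hdiv[OF U K])
  have IZ: "integrable lborel (hdiv Z)" by (rule integrable_hdiv[OF CZ compact_cball Z0])
  have ind: "integrable lborel (\<lambda>x. indicator B x *\<^sub>R g x)"
    if "B \<in> sets borel" "integrable lborel g" for B :: "'n heis set" and g :: "'n heis \<Rightarrow> real"
    by (rule integrable_mult_indicator) (use that in auto)
  have "?c = (\<integral>x. indicator A' x *\<^sub>R hdiv V x - indicator A x *\<^sub>R hdiv V x \<partial>lborel)"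
  proof (rule Bochner_Integration.integral_cong[OF refl])
    fix x
    show "(indicator A' x - indicator A x) * hdiv ?\<nu> x = indicator A' x *\<^sub>R hdiv V x - indicator A x *\<^sub>R hdiv V x"
    proof (cases "x \<in> ball p \<rho>")
      case True
      have "hdiv V x = hdiv ?\<nu> x"
        by (rule hdiv_eq_on_open[OF open_ball True]) (simp add: V_def Z_def \<zeta>1)
      then show ?thesis by (simp add: algebra_simps)
    next
      case False
      then show ?thesis using A'(2)[OF False] by (simp add: indicator_def)
    qed
  qed
  also have "\<dots> = (\<integral>x. indicator A' x *\<^sub>R hdiv V x \<partial>lborel) - (\<integral>x. indicator A x *\<^sub>R hdiv V x \<partial>lborel)"
    by (intro Bochner_Integration.integral_diff ind A A' IV)
  finally have c: "?c = (LINT x:A'|lborel. hdiv V x) - (LINT x:A|lborel. hdiv V x)"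
    by (simp add: set_lebesgue_integral_def)
  have "hdiv V x = hdiv U x + hdiv Z x" for x
    unfolding V_def[abs_def]
    by (intro hdiv_add C1_on_differentiable[OF U UNIV_I] C1_on_differentiable[OF CZ UNIV_I])
  then have "(LINT x:A|lborel. hdiv V x) = (LINT x:A|lborel. hdiv U x) + (LINT x:A|lborel. hdiv Z x)"
    unfolding set_lebesgue_integral_def
    by (simp add: distrib_left ind[OF A(1) IU, simplified] ind[OF A(1) IZ, simplified])
  then have "(LINT x:A|lborel. hdiv U x) \<le> (LINT x:A'|lborel. hdiv V x) - ?c"
    using flux c by linarith
  moreover have "ereal (LINT x:A'|lborel. hdiv V x) \<le> perimeter A'"
    unfolding perimeter_def
    by (rule SUP_upper)
       (use C1c_field_compact_support[OF CV cK V0] TV nV in \<open>auto simp: horizontal_def hproj_eq_self_iff\<close>)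
  ultimately show "ereal (LINT x:A|lborel. hdiv U x) \<le> perimeter A' - ereal ?c"
    by (cases "perimeter A'") auto
qed

section \<open>An explicit flow on the line\<close>

text \<open>The non-constant solutions of \<open>s' = speed s\<close> are the time translates of \<open>orbit\<close>, the identity on
  \<open>[-1, 1]\<close> continued by \<open>arctan\<close> on both sides. On the tails \<open>speed\<close> is a translate of \<open>cos\<^sup>2\<close>, because
  \<open>arctan' = cos\<^sup>2 \<circ> arctan\<close>. Thus the flow is known in closed form, is a translation near \<open>0\<close> and is
  trivial outside a bounded interval.\<close>

definition speed :: "real \<Rightarrow> real" where
  "speed s = (1 - transition (s - 1)) * (1 - transition (- s - 1))"

definition orbit :: "real \<Rightarrow> real" where
  "orbit t = (if t \<le> -1 then arctan (t + 1) - 1 else if t \<le> 1 then t else arctan (t - 1) + 1)"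

definition orbit_time :: "real \<Rightarrow> real" where
  "orbit_time s = (if s \<le> -1 then tan (s + 1) - 1 else if s \<le> 1 then s else tan (s - 1) + 1)"

definition flow1 :: "real \<Rightarrow> real \<Rightarrow> real" where
  "flow1 t s = (if \<bar>s\<bar> < 1 + pi/2 then orbit (orbit_time s + t) else s)"

lemma C1_on_speed: "C1_on speed W"
  unfolding speed_def[abs_def]
  by (intro C1_on_mult C1_on_diff C1_on_minus C1_on_const C1_on_compose[OF _ C1_on_transition[of UNIV]]
      C1_on_bounded_linear[OF bounded_linear_ident]) auto

lemma speed_eq_0: "1 + pi/2 \<le> \<bar>s\<bar> \<Longrightarrow> speed s = 0"
  by (auto simp: speed_def abs_if transition_simps split: if_splits)

lemma orbit_bound: "\<bar>orbit t\<bar> < 1 + pi/2"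
  using arctan_lbound[of "t + 1"] arctan_ubound[of "t + 1"] arctan_lbound[of "t - 1"]
    arctan_ubound[of "t - 1"] arctan_le_zero_iff[of "t + 1"] arctan_less_zero_iff[of "t - 1"] pi_gt_zero
  by (auto simp: orbit_def abs_if)

lemma speed_orbit:
  "speed (orbit t) = (if t \<le> -1 then inverse (1 + (t + 1)\<^sup>2)
     else if t \<le> 1 then 1 else inverse (1 + (t + -1)\<^sup>2))"
proof -
  have c: "1 - (sin (arctan z))\<^sup>2 = inverse (1 + z\<^sup>2)" for z
    by (simp add: cos_squared_eq[symmetric] cos_arctan power_divide inverse_eq_divide)
  consider "t \<le> -1" | "-1 < t" "t \<le> 1" | "1 < t" by linarith
  then show ?thesis
  proof cases
    case 1
    then have o: "orbit t = arctan (t + 1) - 1" and "arctan (t + 1) \<le> 0" by (simp_all add: orbit_def)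
    then have "orbit t - 1 \<le> 0" by linarith
    then have "transition (- orbit t - 1) = (sin (arctan (t + 1)))\<^sup>2" "transition (orbit t - 1) = 0"
      using 1 arctan_lbound[of "t + 1"] transition_simps(2)[of "- arctan (t + 1)"]
      by (auto simp: o intro: transition_simps(1))
    then show ?thesis using 1 by (simp add: speed_def c)
  next
    case 2
    then show ?thesis by (simp add: speed_def orbit_def transition_simps)
  next
    case 3
    then have o: "orbit t = arctan (t - 1) + 1" and "0 < arctan (t - 1)" by (simp_all add: orbit_def)
    then have "- orbit t - 1 \<le> 0" by linarith
    then have "transition (orbit t - 1) = (sin (arctan (t - 1)))\<^sup>2" "transition (- orbit t - 1) = 0"
      using 3 arctan_ubound[of "t - 1"] transition_simps(2)[of "arctan (t - 1)"]
      by (auto simp: o intro: transition_simps(1))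
    then show ?thesis using 3 by (simp add: speed_def c)
  qed
qed

lemma orbit_deriv: "(orbit has_real_derivative speed (orbit t)) (at t)"
proof -
  have a: "((\<lambda>t. arctan (t + k) + l) has_real_derivative inverse (1 + (t + k)\<^sup>2)) (at t)" for t k l
    by (auto intro!: derivative_eq_intros)
  have 1: "((\<lambda>t. if t \<le> 1 then t else arctan (t + -1) + 1) has_real_derivative
      (if t \<le> 1 then 1 else inverse (1 + (t + -1)\<^sup>2))) (at t)" for t
    by (rule has_real_derivative_glue[OF _ a]) auto
  have 2: "((\<lambda>t. if t \<le> -1 then arctan (t + 1) + -1 else if t \<le> 1 then t else arctan (t + -1) + 1) has_real_derivative
      (if t \<le> -1 then inverse (1 + (t + 1)\<^sup>2) else if t \<le> 1 then 1 else inverse (1 + (t + -1)\<^sup>2))) (at t)"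
    by (rule has_real_derivative_glue[OF a 1]) auto
  have o: "orbit = (\<lambda>t. if t \<le> -1 then arctan (t + 1) + -1 else if t \<le> 1 then t else arctan (t + -1) + 1)"
    by (auto simp: orbit_def fun_eq_iff)
  show ?thesis unfolding speed_orbit by (subst o) (rule 2)
qed

lemma orbit_time_orbit: "orbit_time (orbit t) = t"
proof -
  consider "t \<le> -1" | "-1 < t" "t \<le> 1" | "1 < t" by linarith
  then show ?thesis
  proof cases
    case 3
    then have "\<not> arctan (t - 1) + 1 \<le> 1" "\<not> arctan (t - 1) + 1 \<le> -1"
      using zero_less_arctan_iff[of "t - 1"] by linarith+
    then show ?thesis using 3 by (simp add: orbit_def orbit_time_def tan_arctan)
  qed (simp_all add: orbit_def orbit_time_def tan_arctan)
qed

lemma orbit_orbit_time: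
  assumes "\<bar>s\<bar> < 1 + pi/2" shows "orbit (orbit_time s) = s"
proof -
  consider "s \<le> -1" | "-1 < s" "s \<le> 1" | "1 < s" by linarith
  then show ?thesis
  proof cases
    case 1
    have b: "- (pi/2) < s + 1" "s + 1 < pi/2" using assms 1 pi_gt_zero by auto
    have "tan (s + 1) \<le> 0"
      using arctan_le_zero_iff[of "tan (s + 1)"] arctan_tan[OF b] 1 by simp
    then show ?thesis using 1 arctan_tan[OF b] by (simp add: orbit_def orbit_time_def)
  next
    case 2
    then show ?thesis by (simp add: orbit_def orbit_time_def)
  next
    case 3
    have b: "- (pi/2) < s - 1" "s - 1 < pi/2" using assms 3 pi_gt_zero by auto
    have "0 < tan (s - 1)"
      using zero_less_arctan_iff[of "tan (s - 1)"] arctan_tan[OF b] 3 by simp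
    then show ?thesis using 3 arctan_tan[OF b] by (simp add: orbit_def orbit_time_def)
  qed
qed

lemma orbit_strict_mono: "s < t \<Longrightarrow> orbit s < orbit t"
proof (rule DERIV_pos_imp_increasing[of s t orbit])
  fix x
  have "0 < speed (orbit x)" by (simp add: speed_orbit add_pos_nonneg)
  then show "\<exists>y. (orbit has_real_derivative y) (at x) \<and> 0 < y" using orbit_deriv by blast
qed

lemma flow1_0: "flow1 0 s = s"
  by (simp add: flow1_def orbit_orbit_time)

lemma flow1_add: "flow1 t (flow1 t' s) = flow1 (t' + t) s"
  using orbit_bound[of "orbit_time s + t'"] by (simp add: flow1_def orbit_time_orbit add.assoc)

lemma flow1_outside: "1 + pi/2 \<le> \<bar>s\<bar> \<Longrightarrow> flow1 t s = s"
  by (simp add: flow1_def)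

lemma flow1_inside: "\<bar>s\<bar> < 1 + pi/2 \<Longrightarrow> \<bar>flow1 t s\<bar> < 1 + pi/2"
  using orbit_bound by (simp add: flow1_def)

lemma flow1_linear: "\<bar>s\<bar> \<le> 1/2 \<Longrightarrow> \<bar>t\<bar> \<le> 1/2 \<Longrightarrow> flow1 t s = s + t"
proof -
  assume st: "\<bar>s\<bar> \<le> 1/2" "\<bar>t\<bar> \<le> 1/2"
  then have "\<bar>s\<bar> < 1 + pi/2" using pi_gt_zero by linarith
  moreover have "-1 < s" "s \<le> 1" using st by linarith+
  then have "orbit_time s = s" by (simp add: orbit_time_def)
  moreover have "s + t = -1 \<or> -1 < s + t" "s + t \<le> 1" using st by linarith+
  then have "orbit (s + t) = s + t" by (auto simp: orbit_def)
  ultimately show ?thesis by (simp add: flow1_def)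
qed

lemma flow1_strict_mono:
  assumes "s < s'" shows "flow1 t s < flow1 t s'"
proof -
  have m: "orbit_time s < orbit_time s'" if "\<bar>s\<bar> < 1 + pi/2" "\<bar>s'\<bar> < 1 + pi/2"
    using orbit_strict_mono[of "orbit_time s'" "orbit_time s"] orbit_orbit_time that assms
    by (metis linorder_cases order_less_asym less_irrefl)
  consider "\<bar>s\<bar> < 1 + pi/2" "\<bar>s'\<bar> < 1 + pi/2" | "1 + pi/2 \<le> \<bar>s\<bar>" "\<bar>s'\<bar> < 1 + pi/2" |
     "\<bar>s\<bar> < 1 + pi/2" "1 + pi/2 \<le> \<bar>s'\<bar>" | "1 + pi/2 \<le> \<bar>s\<bar>" "1 + pi/2 \<le> \<bar>s'\<bar>" by linarith
  then show ?thesis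
  proof cases
    case 1
    then show ?thesis using m by (simp add: flow1_def orbit_strict_mono)
  next
    case 2
    then show ?thesis using flow1_outside[OF 2(1), of t] flow1_inside[OF 2(2), of t] assms by linarith
  next
    case 3
    then show ?thesis using flow1_outside[OF 3(2), of t] flow1_inside[OF 3(1), of t] assms by linarith
  next
    case 4
    then show ?thesis using flow1_outside assms by simp
  qed
qed

lemma flow1_less_iff: "flow1 (-t) s < s' \<longleftrightarrow> s < flow1 t s'"
  using flow1_strict_mono[of "flow1 (-t) s" s' t] flow1_strict_mono[of s' "flow1 (-t) s" t]
  by (cases "flow1 (-t) s" s' rule: linorder_cases) (auto simp: flow1_add flow1_0)

lemma flow1_deriv: "((\<lambda>t. flow1 t s) has_real_derivative speed (flow1 t s)) (at t)"
proof (cases "\<bar>s\<bar> < 1 + pi/2")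
  case True
  have "((\<lambda>t. orbit (orbit_time s + t)) has_real_derivative speed (orbit (orbit_time s + t)) * 1) (at t)"
    by (rule DERIV_chain2[OF orbit_deriv]) (auto intro!: derivative_eq_intros)
  then show ?thesis using True by (simp add: flow1_def[abs_def])
next
  case False
  then show ?thesis using speed_eq_0[of s] by (simp add: flow1_def[abs_def])
qed

lemma borel_measurable_flow1:
  assumes [measurable]: "f \<in> borel_measurable M" "g \<in> borel_measurable M"
  shows "(\<lambda>x. flow1 (f x) (g x)) \<in> borel_measurable M"
proof -
  have [measurable]: "arctan \<in> borel_measurable borel" "sin \<in> borel_measurable (borel :: real measure)"
    "cos \<in> borel_measurable (borel :: real measure)"
    by (intro borel_measurable_continuous_onI continuous_intros)+
  show ?thesis
    unfolding flow1_def orbit_def orbit_time_def tan_def by measurable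
qed

section \<open>Flow along parallel lines\<close>

text \<open>The quantity subtracted from \<open>r\<^sup>2\<close> is the squared distance of \<open>x\<close> from the line through \<open>p\<close> with
  direction \<open>e\<close>, so the bump is constant along that direction. The square makes it \<open>C\<^sup>1\<close>.\<close>

definition bump :: "'a::euclidean_space \<Rightarrow> 'a \<Rightarrow> real \<Rightarrow> 'a \<Rightarrow> real" where
  "bump p e r x = (max 0 (r\<^sup>2 - ((x - p) \<bullet> (x - p) - ((x - p) \<bullet> e)\<^sup>2)))\<^sup>2"

text \<open>On the line \<open>{p + y + s e}\<close> the equation of motion is \<open>s' = a \<psi>(y) speed (s/\<delta>)\<close> with the constant factor
  \<open>a \<psi>(y)\<close>, so the flow on each line is a rescaling of \<open>flow1\<close>.\<close>

definition line_field :: "'a::euclidean_space \<Rightarrow> 'a \<Rightarrow> real \<Rightarrow> real \<Rightarrow> real \<Rightarrow> 'a \<Rightarrow> 'a" where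
  "line_field p e r \<delta> a x = (a * bump p e r x * speed (((x - p) \<bullet> e) / \<delta>)) *\<^sub>R e"

definition line_flow :: "'a::euclidean_space \<Rightarrow> 'a \<Rightarrow> real \<Rightarrow> real \<Rightarrow> real \<Rightarrow> real \<Rightarrow> 'a \<Rightarrow> 'a" where
  "line_flow p e r \<delta> a t x =
     x + (\<delta> * flow1 (a * bump p e r x * t / \<delta>) (((x - p) \<bullet> e) / \<delta>) - (x - p) \<bullet> e) *\<^sub>R e"

lemma norm_1_inner_self: "norm e = 1 \<Longrightarrow> e \<bullet> e = (1::real)" for e :: "'a::real_inner"
  by (simp add: dot_square_norm)

lemma bump_translate:
  assumes "norm e = 1" shows "bump p e r (x + s *\<^sub>R e) = bump p e r x"
proof -
  have "(x + s *\<^sub>R e - p) \<bullet> (x + s *\<^sub>R e - p) - ((x + s *\<^sub>R e - p) \<bullet> e)\<^sup>2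
      = (x - p) \<bullet> (x - p) - ((x - p) \<bullet> e)\<^sup>2"
  proof -
    have "x + s *\<^sub>R e - p = (x - p) + s *\<^sub>R e" by simp
    then show ?thesis
      using norm_1_inner_self[OF assms]
      by (simp only: inner_add_left inner_add_right inner_scaleR_left inner_scaleR_right)
         (simp add: inner_commute power2_eq_square algebra_simps)
  qed
  then show ?thesis by (simp add: bump_def)
qed

lemma bump_perp:
  assumes "norm e = 1" "y \<bullet> e = 0"
  shows "bump p e r (p + y + s *\<^sub>R e) = (max 0 (r\<^sup>2 - (norm y)\<^sup>2))\<^sup>2"
  unfolding bump_translate[OF assms(1)] using assms(2)
  by (simp add: bump_def dot_square_norm)

lemma line_decomposition:
  assumes "norm e = (1::real)"
  obtains y s where "x = p + y + s *\<^sub>R e" "y \<bullet> e = 0" "s = (x - p) \<bullet> e"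
proof (rule that)
  show "x = p + (x - p - ((x - p) \<bullet> e) *\<^sub>R e) + ((x - p) \<bullet> e) *\<^sub>R e" by simp
  show "(x - p - ((x - p) \<bullet> e) *\<^sub>R e) \<bullet> e = 0"
    using norm_1_inner_self[OF assms] by (simp add: inner_diff_left)
qed simp

lemma C1_on_bump: "C1_on (bump p e r) W"
proof -
  have m: "C1_on (\<lambda>u::real. (max 0 u)\<^sup>2) UNIV"
  proof (rule C1_on_real)
    fix u :: real
    have "((\<lambda>u. if u \<le> 0 then 0 else u\<^sup>2) has_real_derivative (if u \<le> 0 then 0 else 2 * u)) (at u)"
      by (rule has_real_derivative_glue) (auto intro!: derivative_eq_intros)
    moreover have "(\<lambda>u::real. if u \<le> 0 then 0 else u\<^sup>2) = (\<lambda>u. (max 0 u)\<^sup>2)"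
      by (auto simp: fun_eq_iff max_def)
    moreover have "(if u \<le> 0 then 0 else 2 * u) = 2 * max 0 u" by simp
    ultimately show "((\<lambda>u. (max 0 u)\<^sup>2) has_real_derivative 2 * max 0 u) (at u)"
      by simp
  qed (intro continuous_intros)
  show ?thesis
    unfolding bump_def[abs_def] power2_eq_square[of "_ \<bullet> _"]
    by (rule C1_on_compose[OF _ m])
       (intro C1_on_diff C1_on_const C1_on_mult C1_on_inner C1_on_bounded_linear[OF bounded_linear_ident], simp)
qed

lemma C1_on_line_field: "C1_on (line_field p e r \<delta> a) W"
  unfolding line_field_def[abs_def] divide_inverse
  by (intro C1_on_scaleR C1_on_mult C1_on_const C1_on_bump C1_on_compose[OF _ C1_on_speed[of UNIV]]
       C1_on_inner C1_on_diff C1_on_bounded_linear[OF bounded_linear_ident]) simp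

text \<open>The motion takes place in the cylinder of radius \<open>r \<le> \<delta>\<close> and half-length \<open>(1 + \<pi>/2) \<delta> < 3 \<delta>\<close>, which
  lies in the ball of radius \<open>4 \<delta>\<close>.\<close>

lemma trivial_outside:
  assumes e: "norm e = 1" and r: "0 < r" "r \<le> \<delta>" and x: "x \<notin> ball p (4 * \<delta>)"
  shows "bump p e r x = 0 \<or> 3 < \<bar>((x - p) \<bullet> e) / \<delta>\<bar>"
proof (rule ccontr)
  assume "\<not> ?thesis"
  then have b: "bump p e r x \<noteq> 0" and s: "\<bar>((x - p) \<bullet> e) / \<delta>\<bar> \<le> 3" by auto
  obtain y s where y: "x = p + y + s *\<^sub>R e" "y \<bullet> e = 0" "s = (x - p) \<bullet> e"
    by (rule line_decomposition[OF e])
  have "(max 0 (r\<^sup>2 - (norm y)\<^sup>2))\<^sup>2 \<noteq> 0"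
    using b bump_perp[OF e y(2), of p r s] y(1) by simp
  then have "(norm y)\<^sup>2 < r\<^sup>2" by (auto simp: max_def split: if_splits)
  then have "norm y < r" using r by (simp add: power2_less_imp_less)
  moreover have "\<bar>s\<bar> \<le> 3 * \<delta>" using s r y(3) by (simp add: field_simps)
  moreover have "norm (x - p) \<le> norm y + \<bar>s\<bar>"
    using norm_triangle_ineq[of y "s *\<^sub>R e"] e by (simp add: y(1))
  ultimately show False using x r by (simp add: dist_norm norm_minus_commute)
qed

lemma pi_half_lt: "1 + pi/2 < 3" using pi_less_4 by simp

lemma line_flow_trivial_outside:
  assumes "norm e = 1" "0 < r" "r \<le> \<delta>" "x \<notin> ball p (4 * \<delta>)"
  shows "line_flow p e r \<delta> a t x = x" "line_field p e r \<delta> a x = 0"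
  using trivial_outside[OF assms] flow1_outside[of "((x - p) \<bullet> e) / \<delta>"]
     speed_eq_0[of "((x - p) \<bullet> e) / \<delta>"] pi_half_lt assms(2,3)
  by (auto simp: line_flow_def line_field_def flow1_0)

lemma line_flow_coordinate:
  assumes "norm e = 1"
  shows "(line_flow p e r \<delta> a t x - p) \<bullet> e = \<delta> * flow1 (a * bump p e r x * t / \<delta>) (((x - p) \<bullet> e) / \<delta>)"
proof -
  have "line_flow p e r \<delta> a t x - p = (x - p) + (\<delta> * flow1 (a * bump p e r x * t / \<delta>) (((x - p) \<bullet> e) / \<delta>) - (x - p) \<bullet> e) *\<^sub>R e"
    by (simp add: line_flow_def)
  then show ?thesis using norm_1_inner_self[OF assms] by (simp only: inner_add_left inner_scaleR_left) simp
qed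

lemma bump_line_flow: "norm e = 1 \<Longrightarrow> bump p e r (line_flow p e r \<delta> a t x) = bump p e r x"
  unfolding line_flow_def by (rule bump_translate)

lemma line_flow_0: "0 < \<delta> \<Longrightarrow> line_flow p e r \<delta> a 0 x = x"
  by (simp add: line_flow_def flow1_0)

lemma line_flow_inverse:
  assumes "norm e = 1" "0 < \<delta>"
  shows "line_flow p e r \<delta> a (- t) (line_flow p e r \<delta> a t x) = x"
  unfolding line_flow_def[of p e r \<delta> a "- t"] bump_line_flow[OF assms(1)] line_flow_coordinate[OF assms(1)]
  using assms(2) by (simp add: flow1_add flow1_0) (simp add: line_flow_def scaleR_diff_left)

lemma line_flow_image:
  assumes "norm e = 1" "0 < \<delta>"
  shows "line_flow p e r \<delta> a t ` A = {x. line_flow p e r \<delta> a (- t) x \<in> A}"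
proof (intro set_eqI iffI)
  fix x
  show "x \<in> line_flow p e r \<delta> a t ` A \<Longrightarrow> x \<in> {x. line_flow p e r \<delta> a (- t) x \<in> A}"
    using line_flow_inverse[OF assms, of p r a t] by auto
  assume "x \<in> {x. line_flow p e r \<delta> a (- t) x \<in> A}"
  then show "x \<in> line_flow p e r \<delta> a t ` A"
    using line_flow_inverse[OF assms, of p r a "- t" x]
    by (intro image_eqI[of _ _ "line_flow p e r \<delta> a (- t) x"]) auto
qed

lemma line_flow_has_vector_derivative:
  assumes "norm e = 1" "0 < \<delta>"
  shows "((\<lambda>t. line_flow p e r \<delta> a t x) has_vector_derivative
     line_field p e r \<delta> a (line_flow p e r \<delta> a t x)) (at t)"
proof -
  let ?b = "a * bump p e r x" and ?s = "((x - p) \<bullet> e) / \<delta>"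
  have "((\<lambda>t. flow1 (?b * t / \<delta>) ?s) has_real_derivative speed (flow1 (?b * t / \<delta>) ?s) * (?b / \<delta>)) (at t)"
    by (rule DERIV_chain2[OF flow1_deriv]) (use assms in \<open>auto intro!: derivative_eq_intros\<close>)
  from DERIV_cmult[OF this, of \<delta>]
  have "((\<lambda>t. \<delta> * flow1 (?b * t / \<delta>) ?s) has_real_derivative ?b * speed (flow1 (?b * t / \<delta>) ?s)) (at t)"
    using assms by (simp add: mult.commute)
  from DERIV_diff[OF this DERIV_const[of "(x - p) \<bullet> e"]]
  have "((\<lambda>t. \<delta> * flow1 (?b * t / \<delta>) ?s - (x - p) \<bullet> e) has_real_derivative ?b * speed (flow1 (?b * t / \<delta>) ?s)) (at t)"
    by simp
  from has_vector_derivative_add[OF has_vector_derivative_const[of x]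
      has_vector_derivative_scaleR[OF this has_vector_derivative_const[of e]]]
  have "((\<lambda>t. x + (\<delta> * flow1 (?b * t / \<delta>) ?s - (x - p) \<bullet> e) *\<^sub>R e) has_vector_derivative
      (?b * speed (flow1 (?b * t / \<delta>) ?s)) *\<^sub>R e) (at t)"
    by simp
  moreover have "line_field p e r \<delta> a (line_flow p e r \<delta> a t x) = (?b * speed (flow1 (?b * t / \<delta>) ?s)) *\<^sub>R e"
    unfolding line_field_def bump_line_flow[OF assms(1)] line_flow_coordinate[OF assms(1)]
    using assms(2) by simp
  ultimately show ?thesis by (simp add: line_flow_def[abs_def])
qed

lemma borel_measurable_line_flow: "line_flow p e r \<delta> a t \<in> borel_measurable borel"
proof -
  have [measurable]: "bump p e r \<in> borel_measurable borel"
    by (rule borel_measurable_continuous_onI[OF C1_on_imp_continuous_on[OF C1_on_bump]])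
  have [measurable]: "(\<lambda>x. flow1 (a * bump p e r x * t / \<delta>) (((x - p) \<bullet> e) / \<delta>)) \<in> borel_measurable borel"
    by (rule borel_measurable_flow1) measurable
  show ?thesis unfolding line_flow_def[abs_def] by measurable
qed

section \<open>Volume swept by the flow\<close>

text \<open>In the cylinder of radius \<open>r\<close> around the line through \<open>p\<close> with direction \<open>e\<close> the set lies below the
  graph of a function \<open>g\<close>. The bound \<open>\<delta>/2\<close> keeps the graph, also after moving it by at most \<open>\<delta>/2\<close>,
  in the region \<open>\<bar>s\<bar> \<le> \<delta>\<close> where the flow is a translation.\<close>

definition subgraph_near :: "'a::euclidean_space \<Rightarrow> 'a \<Rightarrow> real \<Rightarrow> real \<Rightarrow> 'a set \<Rightarrow> bool" where
  "subgraph_near p e r \<delta> A \<longleftrightarrow>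
     (\<forall>y. y \<bullet> e = 0 \<and> norm y < r \<longrightarrow>
        (\<exists>g. \<bar>g\<bar> < \<delta> / 2 \<and> (\<forall>s. \<bar>s\<bar> \<le> 3 * \<delta> \<longrightarrow> (p + y + s *\<^sub>R e \<in> A \<longleftrightarrow> s < g))))"

text \<open>The integral of the bump over the orthogonal complement of \<open>e\<close>, written as an integral over the
  slab \<open>0 \<le> x \<bullet> e \<le> 1\<close>.\<close>

definition bump_mass :: "'a::euclidean_space \<Rightarrow> 'a \<Rightarrow> real \<Rightarrow> ennreal" where
  "bump_mass p e r = (\<integral>\<^sup>+x. indicator {0..1} (x \<bullet> e) * ennreal (bump p e r x) \<partial>lborel)"

lemma bump_bounds: 
  assumes "norm e = 1" shows "0 \<le> bump p e r x" "bump p e r x \<le> r^4"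
proof -
  show "0 \<le> bump p e r x" by (simp add: bump_def)
  have "((x - p) \<bullet> e)\<^sup>2 \<le> (x - p) \<bullet> (x - p)"
    using Cauchy_Schwarz_ineq[of "x - p" e] norm_1_inner_self[OF assms] by simp
  then have "max 0 (r\<^sup>2 - ((x - p) \<bullet> (x - p) - ((x - p) \<bullet> e)\<^sup>2)) \<le> r\<^sup>2" by simp
  then have "bump p e r x \<le> (r\<^sup>2)\<^sup>2" unfolding bump_def by (intro power_mono) auto
  then show "bump p e r x \<le> r^4" by simp
qed

lemma borel_measurable_bump: "bump p e r \<in> borel_measurable borel"
  by (rule borel_measurable_continuous_onI[OF C1_on_imp_continuous_on[OF C1_on_bump]])

lemma bump_mass_finite:
  assumes e: "norm e = 1" and r: "0 < r" shows "bump_mass p e r < \<infinity>"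
proof -
  \<comment> \<open>On the support \<open>\<bar>(x - p) \<bullet> e\<bar> \<le> 1 + \<bar>p \<bullet> e\<bar>\<close>, and the distance of \<open>x\<close> from the line is below \<open>r\<close>.\<close>
  define R where "R = r + 1 + \<bar>p \<bullet> e\<bar>"
  have "bump_mass p e r \<le> (\<integral>\<^sup>+x. ennreal (r^4) * indicator (ball p R) x \<partial>lborel)"
    unfolding bump_mass_def
  proof (rule nn_integral_mono)
    fix x
    show "indicator {0..1} (x \<bullet> e) * ennreal (bump p e r x) \<le> ennreal (r^4) * indicator (ball p R) x"
    proof (cases "bump p e r x \<noteq> 0 \<and> x \<bullet> e \<in> {0..1}")
      case True
      obtain y s where y: "x = p + y + s *\<^sub>R e" "y \<bullet> e = 0" "s = (x - p) \<bullet> e"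
        by (rule line_decomposition[OF e])
      have "(max 0 (r\<^sup>2 - (norm y)\<^sup>2))\<^sup>2 \<noteq> 0"
        using True bump_perp[OF e y(2), of p r s] y(1) by simp
      then have "(norm y)\<^sup>2 < r\<^sup>2" by (auto simp: max_def split: if_splits)
      then have "norm y < r" using r by (simp add: power2_less_imp_less)
      moreover have "\<bar>s\<bar> \<le> 1 + \<bar>p \<bullet> e\<bar>" using True y(3) by (auto simp: inner_diff_left)
      moreover have "norm (x - p) \<le> norm y + \<bar>s\<bar>"
        using norm_triangle_ineq[of y "s *\<^sub>R e"] e by (simp add: y(1))
      ultimately have "x \<in> ball p R" by (simp add: R_def dist_norm norm_minus_commute)
      then show ?thesis using True bump_bounds(2)[OF e, of p r x] by (auto intro: ennreal_leI)
    next
      case False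
      then show ?thesis by (auto simp: indicator_def)
    qed
  qed
  also have "\<dots> = ennreal (r^4) * emeasure lborel (ball p R)"
    by (rule nn_integral_cmult_indicator) simp
  also have "\<dots> < \<infinity>" using emeasure_lborel_ball_finite[of p R] by (simp add: ennreal_mult_less_top)
  finally show ?thesis .
qed

lemma bump_mass_pos:
  assumes e: "norm e = 1" and r: "0 < r" shows "0 < bump_mass p e r"
proof (rule ccontr)
  assume "\<not> 0 < bump_mass p e r"
  then have z: "bump_mass p e r = 0" by simp
  have [measurable]: "bump p e r \<in> borel_measurable borel" by (rule borel_measurable_bump)
  have ae: "AE x in lborel. indicator {0..1} (x \<bullet> e) * ennreal (bump p e r x) = 0"
    using z unfolding bump_mass_def by (subst (asm) nn_integral_0_iff_AE) auto
  define S where "S = {x. 0 < x \<bullet> e} \<inter> {x. x \<bullet> e < 1} \<inter> {x. 0 < bump p e r x}"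
  have "open S" unfolding S_def
    by (intro open_Int open_Collect_less continuous_intros C1_on_imp_continuous_on C1_on_bump)
  moreover have "p + 0 + (1/2 - p \<bullet> e) *\<^sub>R e \<in> S"
    using norm_1_inner_self[OF e] bump_perp[OF e, of 0 p r "1/2 - p \<bullet> e"] r
    by (simp add: S_def inner_add_left)
  ultimately have "\<not> negligible S" using open_not_negligible by blast
  moreover have "S \<in> sets borel" using \<open>open S\<close> by simp
  moreover have "AE x in lborel. x \<notin> S"
    using ae by eventually_elim (auto simp: S_def indicator_def)
  ultimately show False
    by (simp add: negligible_iff_null_sets null_sets_completionI AE_iff_null_sets[symmetric] null_sets_def)
qed

text \<open>A set that meets every line of direction \<open>e\<close> in an interval of length proportional to the bump has a
  volume that depends only on the factor of proportionality.\<close>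

lemma band_volume:
  fixes S :: "'a::euclidean_space set"
  assumes e: "norm e = 1" and S: "S \<in> sets borel" and c: "0 \<le> c"
    and band: "\<And>y. y \<bullet> e = 0 \<Longrightarrow>
      \<exists>\<alpha> \<beta>. \<beta> - \<alpha> = c * bump p e r (p + y) \<and> {s. p + y + s *\<^sub>R e \<in> S} = {\<alpha>..<\<beta>}"
  shows "emeasure lborel S = ennreal c * bump_mass p e r"
proof -
  have [measurable]: "bump p e r \<in> borel_measurable borel" by (rule borel_measurable_bump)
  have "(\<integral>\<^sup>+s. indicator S (x + s *\<^sub>R e) \<partial>lborel) = ennreal c * ennreal (bump p e r x)" for x
  proof -
    obtain y u where y: "x = p + y + u *\<^sub>R e" "y \<bullet> e = 0" "u = (x - p) \<bullet> e"
      by (rule line_decomposition[OF e])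
    obtain \<alpha> \<beta> where ab: "\<beta> - \<alpha> = c * bump p e r (p + y)" "{s. p + y + s *\<^sub>R e \<in> S} = {\<alpha>..<\<beta>}"
      using band[OF y(2)] by blast
    have b: "bump p e r x = bump p e r (p + y)" unfolding y(1) by (rule bump_translate[OF e])
    have le: "\<alpha> \<le> \<beta>"
      using ab(1) c bump_bounds(1)[OF e, of p r "p + y"] by (metis diff_ge_0_iff_ge mult_nonneg_nonneg)
    have "x + s *\<^sub>R e \<in> S \<longleftrightarrow> s \<in> {\<alpha> - u..<\<beta> - u}" for s
    proof -
      have "x + s *\<^sub>R e \<in> S \<longleftrightarrow> u + s \<in> {s. p + y + s *\<^sub>R e \<in> S}"
        by (simp add: y(1) scaleR_add_left add.assoc)
      then show ?thesis unfolding ab(2) by auto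
    qed
    then have "(\<integral>\<^sup>+s. indicator S (x + s *\<^sub>R e) \<partial>lborel) = (\<integral>\<^sup>+s. indicator {\<alpha> - u..<\<beta> - u} s \<partial>lborel)"
      by (intro nn_integral_cong) (simp add: indicator_def)
    also have "\<dots> = ennreal (\<beta> - \<alpha>)" using le by simp
    finally show ?thesis using ab(1) c bump_bounds(1)[OF e, of p r "p + y"] by (simp add: b ennreal_mult)
  qed
  moreover have "emeasure lborel S = (\<integral>\<^sup>+x. indicator {0..1} (x \<bullet> e) * (\<integral>\<^sup>+s. indicator S (x + s *\<^sub>R e) \<partial>lborel) \<partial>lborel)"
    using nn_integral_lines[OF _ e, of "indicator S"] S by simp
  ultimately have "emeasure lborel S = (\<integral>\<^sup>+x. ennreal c * (indicator {0..1} (x \<bullet> e) * ennreal (bump p e r x)) \<partial>lborel)"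
    by (simp add: mult.left_commute)
  also have "\<dots> = ennreal c * bump_mass p e r"
    unfolding bump_mass_def by (rule nn_integral_cmult) measurable
  finally show ?thesis .
qed

text \<open>The flow raises the graph by exactly \<open>a \<psi> t\<close>: it is increasing on each line, and a translation on
  the range of heights that the graph passes through.\<close>

lemma subgraph_line_flow:
  assumes e: "norm e = 1" and r: "0 < r" "r \<le> \<delta>" and small: "\<bar>a * t\<bar> * r^4 \<le> \<delta> / 2"
    and y: "y \<bullet> e = 0" and g: "\<bar>g\<bar> < \<delta> / 2" "\<And>s. \<bar>s\<bar> \<le> 3 * \<delta> \<Longrightarrow> p + y + s *\<^sub>R e \<in> A \<longleftrightarrow> s < g"
    and s: "\<bar>s\<bar> \<le> 3 * \<delta>"
  shows "p + y + s *\<^sub>R e \<in> line_flow p e r \<delta> a t ` A \<longleftrightarrow> s < g + a * bump p e r (p + y) * t"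
proof -
  have \<delta>: "0 < \<delta>" using r by simp
  define \<tau> where "\<tau> = a * bump p e r (p + y) * t / \<delta>"
  have b: "bump p e r (p + y + s *\<^sub>R e) = bump p e r (p + y)" by (rule bump_translate[OF e])
  have co: "(p + y + s *\<^sub>R e - p) \<bullet> e = s"
    using y norm_1_inner_self[OF e] by (simp add: inner_add_left)
  have "line_flow p e r \<delta> a (- t) (p + y + s *\<^sub>R e) = p + y + s *\<^sub>R e + (\<delta> * flow1 (- \<tau>) (s / \<delta>) - s) *\<^sub>R e"
    unfolding line_flow_def b co by (simp add: \<tau>_def)
  then have lf: "line_flow p e r \<delta> a (- t) (p + y + s *\<^sub>R e) = p + y + (\<delta> * flow1 (- \<tau>) (s / \<delta>)) *\<^sub>R e"
    by (simp add: algebra_simps)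
  have "\<bar>flow1 (- \<tau>) (s / \<delta>)\<bar> \<le> 3"
  proof (cases "\<bar>s / \<delta>\<bar> < 1 + pi/2")
    case True
    then show ?thesis using flow1_inside[OF True, of "- \<tau>"] pi_half_lt by linarith
  next
    case False
    then have "flow1 (- \<tau>) (s / \<delta>) = s / \<delta>" by (intro flow1_outside) simp
    moreover have "\<bar>s / \<delta>\<bar> \<le> 3" using s \<delta> by (simp add: field_simps)
    ultimately show ?thesis by simp
  qed
  then have in3: "\<bar>\<delta> * flow1 (- \<tau>) (s / \<delta>)\<bar> \<le> 3 * \<delta>" using \<delta> by (simp add: abs_mult)
  have "\<bar>a * bump p e r (p + y) * t\<bar> = \<bar>a * t\<bar> * bump p e r (p + y)"
    using bump_bounds(1)[OF e, of p r "p + y"] by (simp add: abs_mult)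
  also have "\<dots> \<le> \<bar>a * t\<bar> * r^4" by (intro mult_left_mono bump_bounds[OF e]) simp
  finally have "\<bar>a * bump p e r (p + y) * t\<bar> \<le> \<delta> / 2" using small by linarith
  then have \<tau>: "\<bar>\<tau>\<bar> \<le> 1/2" using \<delta> by (simp add: \<tau>_def field_simps)
  have g\<delta>: "\<bar>g / \<delta>\<bar> \<le> 1/2" using g(1) \<delta> by (simp add: field_simps)
  have "p + y + s *\<^sub>R e \<in> line_flow p e r \<delta> a t ` A \<longleftrightarrow> p + y + (\<delta> * flow1 (- \<tau>) (s / \<delta>)) *\<^sub>R e \<in> A"
    unfolding line_flow_image[OF e \<delta>] by (simp add: lf)
  also have "\<dots> \<longleftrightarrow> \<delta> * flow1 (- \<tau>) (s / \<delta>) < g" by (rule g(2)[OF in3])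
  also have "\<dots> \<longleftrightarrow> flow1 (- \<tau>) (s / \<delta>) < g / \<delta>" using \<delta> by (simp add: field_simps)
  also have "\<dots> \<longleftrightarrow> s / \<delta> < g / \<delta> + \<tau>" by (simp add: flow1_less_iff flow1_linear[OF g\<delta> \<tau>])
  also have "\<dots> \<longleftrightarrow> s < g + a * bump p e r (p + y) * t" using \<delta> by (simp add: \<tau>_def field_simps)
  finally show ?thesis .
qed

lemma line_flow_mem_outside:
  assumes e: "norm e = 1" and r: "0 < r" "r \<le> \<delta>" and y: "y \<bullet> e = 0"
    and out: "r \<le> norm y \<or> 3 * \<delta> < \<bar>s\<bar>"
  shows "p + y + s *\<^sub>R e \<in> line_flow p e r \<delta> a t ` A \<longleftrightarrow> p + y + s *\<^sub>R e \<in> A"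
proof -
  have \<delta>: "0 < \<delta>" using r by simp
  have co: "(p + y + s *\<^sub>R e - p) \<bullet> e = s"
    using y norm_1_inner_self[OF e] by (simp add: inner_add_left)
  have "line_flow p e r \<delta> a (- t) (p + y + s *\<^sub>R e) = p + y + s *\<^sub>R e"
  proof (cases "r \<le> norm y")
    case True
    then have "r\<^sup>2 \<le> (norm y)\<^sup>2" using r by (intro power_mono) auto
    then have "bump p e r (p + y + s *\<^sub>R e) = 0" unfolding bump_perp[OF e y] by simp
    then show ?thesis using \<delta> by (simp add: line_flow_def flow1_0)
  next
    case False
    then have "3 < \<bar>s / \<delta>\<bar>" using out \<delta> by (simp add: field_simps)
    then show ?thesis using flow1_outside[of "s / \<delta>"] pi_half_lt \<delta> unfolding line_flow_def co by simp
  qed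
  then show ?thesis unfolding line_flow_image[OF e \<delta>] by simp
qed

text \<open>The set gained or lost is the band between the old and the new graph, hence its volume is exactly
  linear in \<open>t\<close>. The exactness permits two such flows to be combined to a volume preserving one.\<close>

lemma line_flow_volume_step:
  fixes A :: "'a::euclidean_space set"
  assumes e: "norm e = 1" and r: "0 < r" "r \<le> \<delta>" and small: "\<bar>a * t\<bar> * r^4 \<le> \<delta> / 2"
    and a: "0 \<le> a" and sub: "subgraph_near p e r \<delta> A" and A: "A \<in> sets borel"
  defines "B \<equiv> line_flow p e r \<delta> a t ` A"
  shows "B \<in> sets borel"
    and "0 \<le> t \<Longrightarrow> A \<subseteq> B \<and> emeasure lborel (B - A) = ennreal (a * t) * bump_mass p e r"
    and "t \<le> 0 \<Longrightarrow> B \<subseteq> A \<and> emeasure lborel (A - B) = ennreal (a * - t) * bump_mass p e r"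
proof -
  have \<delta>: "0 < \<delta>" using r by simp
  have "B = line_flow p e r \<delta> a (- t) -` A \<inter> space borel"
    unfolding B_def line_flow_image[OF e \<delta>] by auto
  then show B: "B \<in> sets borel"
    using measurable_sets[OF borel_measurable_line_flow A] by simp
  have line: "\<exists>g h. h - g = a * t * bump p e r (p + y) \<and>
      {s. p + y + s *\<^sub>R e \<in> B - A} = {g..<h} \<and> {s. p + y + s *\<^sub>R e \<in> A - B} = {h..<g}"
    if y: "y \<bullet> e = 0" for y
  proof (cases "norm y < r")
    case True
    then obtain g where g: "\<bar>g\<bar> < \<delta> / 2" "\<And>s. \<bar>s\<bar> \<le> 3 * \<delta> \<Longrightarrow> p + y + s *\<^sub>R e \<in> A \<longleftrightarrow> s < g"
      using sub y unfolding subgraph_near_def by blast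
    define h where "h = g + a * t * bump p e r (p + y)"
    have "\<bar>a * t * bump p e r (p + y)\<bar> \<le> \<bar>a * t\<bar> * r^4"
      using bump_bounds[OF e, of p r "p + y"] by (simp add: abs_mult mult_left_mono)
    then have h: "\<bar>h\<bar> \<le> \<delta>" using g(1) small by (simp add: h_def)
    have inB: "p + y + s *\<^sub>R e \<in> B \<longleftrightarrow> s < h" if "\<bar>s\<bar> \<le> 3 * \<delta>" for s
      unfolding B_def h_def using subgraph_line_flow[OF e r small y g that] by (simp add: mult.assoc mult.commute[of t])
    have far: "p + y + s *\<^sub>R e \<in> B \<longleftrightarrow> p + y + s *\<^sub>R e \<in> A" if "\<not> \<bar>s\<bar> \<le> 3 * \<delta>" for s
      unfolding B_def using that by (intro line_flow_mem_outside e r y) auto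
    have m: "p + y + s *\<^sub>R e \<in> B - A \<longleftrightarrow> g \<le> s \<and> s < h" "p + y + s *\<^sub>R e \<in> A - B \<longleftrightarrow> h \<le> s \<and> s < g" for s
    proof -
      consider "\<bar>s\<bar> \<le> 3 * \<delta>" | "\<not> \<bar>s\<bar> \<le> 3 * \<delta>" "\<not> (g \<le> s \<and> s < h)" "\<not> (h \<le> s \<and> s < g)"
        using g(1) h by linarith
      then show "p + y + s *\<^sub>R e \<in> B - A \<longleftrightarrow> g \<le> s \<and> s < h" "p + y + s *\<^sub>R e \<in> A - B \<longleftrightarrow> h \<le> s \<and> s < g"
        by (cases; auto simp: inB far g(2))+
    qed
    have "{s. p + y + s *\<^sub>R e \<in> B - A} = {g..<h}" "{s. p + y + s *\<^sub>R e \<in> A - B} = {h..<g}"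
      unfolding m by auto
    moreover have "h - g = a * t * bump p e r (p + y)" by (simp add: h_def)
    ultimately show ?thesis by blast
  next
    case False
    then have "r\<^sup>2 \<le> (norm y)\<^sup>2" using r by (intro power_mono) auto
    then have "bump p e r (p + y) = 0" using bump_perp[OF e y, of p r 0] by simp
    moreover have "p + y + s *\<^sub>R e \<in> B \<longleftrightarrow> p + y + s *\<^sub>R e \<in> A" for s
      unfolding B_def using False by (intro line_flow_mem_outside e r y) auto
    ultimately show ?thesis by (intro exI[of _ 0]) auto
  qed
  have subset: "X \<subseteq> Y"
    if XY: "\<And>y. y \<bullet> e = 0 \<Longrightarrow> {s. p + y + s *\<^sub>R e \<in> X - Y} = {}" for X Y
  proof
    fix x assume x: "x \<in> X"
    obtain y s where y: "x = p + y + s *\<^sub>R e" "y \<bullet> e = 0" "s = (x - p) \<bullet> e"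
      by (rule line_decomposition[OF e])
    then show "x \<in> Y" using XY[OF y(2)] x by blast
  qed
  have nonneg: "0 \<le> a * bump p e r x" for x using a bump_bounds(1)[OF e] by simp
  show "A \<subseteq> B \<and> emeasure lborel (B - A) = ennreal (a * t) * bump_mass p e r" if t: "0 \<le> t"
  proof (intro conjI subset band_volume[OF e])
    fix y assume y: "y \<bullet> e = 0"
    obtain g h where gh: "h - g = a * t * bump p e r (p + y)" "{s. p + y + s *\<^sub>R e \<in> B - A} = {g..<h}"
      "{s. p + y + s *\<^sub>R e \<in> A - B} = {h..<g}" using line[OF y] by blast
    then have "g \<le> h" using mult_nonneg_nonneg[OF nonneg t, of "p + y"] by (simp add: mult.commute mult.left_commute)
    then show "{s. p + y + s *\<^sub>R e \<in> A - B} = {}" unfolding gh(3) by simp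
    show "\<exists>\<alpha> \<beta>. \<beta> - \<alpha> = a * t * bump p e r (p + y) \<and> {s. p + y + s *\<^sub>R e \<in> B - A} = {\<alpha>..<\<beta>}"
      using gh by blast
  qed (use a t A B in auto)
  show "B \<subseteq> A \<and> emeasure lborel (A - B) = ennreal (a * - t) * bump_mass p e r" if t: "t \<le> 0"
  proof (intro conjI subset band_volume[OF e])
    fix y assume y: "y \<bullet> e = 0"
    obtain g h where gh: "h - g = a * t * bump p e r (p + y)" "{s. p + y + s *\<^sub>R e \<in> B - A} = {g..<h}"
      "{s. p + y + s *\<^sub>R e \<in> A - B} = {h..<g}" using line[OF y] by blast
    then have "h \<le> g" using mult_nonneg_nonpos[OF nonneg t, of "p + y"] by (simp add: mult.commute mult.left_commute)
    then show "{s. p + y + s *\<^sub>R e \<in> B - A} = {}" unfolding gh(2) by simp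
    have "g - h = a * - t * bump p e r (p + y)" using gh(1) by simp
    then show "\<exists>\<alpha> \<beta>. \<beta> - \<alpha> = a * - t * bump p e r (p + y) \<and> {s. p + y + s *\<^sub>R e \<in> A - B} = {\<alpha>..<\<beta>}"
      using gh(3) by blast
  qed (use a t A B in \<open>auto simp: mult_nonneg_nonpos\<close>)
qed

definition volume_change :: "'n::finite heis set \<Rightarrow> 'n heis set \<Rightarrow> real \<Rightarrow> bool" where
  "volume_change A B t \<longleftrightarrow> B \<in> sets borel \<and>
     (0 \<le> t \<longrightarrow> A \<subseteq> B \<and> vol (B - A) = ennreal t) \<and>
     (t \<le> 0 \<longrightarrow> B \<subseteq> A \<and> vol (A - B) = ennreal (- t))"

text \<open>The factor \<open>a\<close> of the line flow is the reciprocal of the mass of the bump, so that volume changes at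
  rate one.\<close>

lemma unit_rate_flow_exists:
  fixes p e :: "'n::finite heis"
  assumes e: "norm e = 1" and r: "0 < r" "r \<le> \<delta>"
  shows "\<exists>U \<phi> t\<^sub>0. 0 < t\<^sub>0 \<and> C1_on U UNIV \<and> flow_of U \<phi> \<and>
    (\<forall>x. x \<notin> ball p (4 * \<delta>) \<longrightarrow> U x = 0 \<and> (\<forall>t. \<phi> t x = x)) \<and>
    (\<forall>t x. \<phi> (- t) (\<phi> t x) = x) \<and>
    (\<forall>A t. A \<in> sets borel \<longrightarrow> subgraph_near p e r \<delta> A \<longrightarrow> \<bar>t\<bar> < t\<^sub>0 \<longrightarrow>
       volume_change A (\<phi> t ` A) t)"
proof -
  have \<delta>: "0 < \<delta>" using r by simp
  define M where "M = enn2real (bump_mass p e r)"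
  have M: "bump_mass p e r = ennreal M" "0 < M"
    using bump_mass_finite[OF e r(1)] bump_mass_pos[OF e r(1)] unfolding M_def
    by (auto simp: enn2real_positive_iff)
  define a where "a = 1 / M"
  have a: "0 < a" "a * M = 1" using M by (auto simp: a_def)
  define t\<^sub>0 where "t\<^sub>0 = \<delta> / 2 / (a * r^4)"
  have t0: "0 < t\<^sub>0" using \<delta> a r by (simp add: t\<^sub>0_def)
  have rate: "ennreal (a * t) * bump_mass p e r = ennreal t" if "0 \<le> t" for t
    using that a M by (simp add: ennreal_mult[symmetric] mult.commute mult.left_commute)
  have small: "\<bar>a * t\<bar> * r^4 \<le> \<delta> / 2" if "\<bar>t\<bar> < t\<^sub>0" for t
    using that a r unfolding t\<^sub>0_def by (simp add: abs_mult field_simps)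
  show ?thesis
  proof (intro exI[of _ "line_field p e r \<delta> a"] exI[of _ "line_flow p e r \<delta> a"] exI[of _ t\<^sub>0] conjI allI impI)
    show "flow_of (line_field p e r \<delta> a) (line_flow p e r \<delta> a)"
      unfolding flow_of_def using line_flow_0[OF \<delta>] line_flow_has_vector_derivative[OF e \<delta>] by blast
    fix A t assume A: "A \<in> sets borel" "subgraph_near p e r \<delta> A" and t: "\<bar>t\<bar> < t\<^sub>0"
    note step = line_flow_volume_step[OF e r small[OF t] less_imp_le[OF a(1)] A(2,1)]
    show "volume_change A (line_flow p e r \<delta> a t ` A) t"
      unfolding volume_change_def vol_def
    proof (intro conjI impI)
      show "line_flow p e r \<delta> a t ` A \<in> sets borel" by (rule step)
    qed (use step rate[of t] rate[of "- t"] in simp_all)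
  qed (use t0 C1_on_line_field line_flow_trivial_outside[OF e r] line_flow_inverse[OF e \<delta>] in auto)
qed

section \<open>Level sets near a regular point\<close>

text \<open>The map \<open>F x = x + ((f x - D x) / D e) e\<close> with \<open>D e \<noteq> 0\<close> has derivative the identity at \<open>p\<close> and
  satisfies \<open>D \<circ> F = f\<close>. By the inverse function theorem it is a chart in which \<open>f\<close> becomes the linear
  form \<open>D\<close>.\<close>

lemma straightening:
  fixes f :: "'a::euclidean_space \<Rightarrow> real"
  assumes f: "C1_on f W" and W: "open W" "p \<in> W" and ne: "frechet_derivative f (at p) \<noteq> (\<lambda>_. 0)"
  defines "D \<equiv> frechet_derivative f (at p)"
  shows "\<exists>F G U V. open U \<and> p \<in> U \<and> U \<subseteq> W \<and> open V \<and> homeomorphism U V F G \<and>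
     (\<forall>x. D (F x) = f x) \<and> (G has_derivative (\<lambda>v. v)) (at (F p))"
proof -
  obtain f' :: "'a \<Rightarrow> 'a \<Rightarrow>\<^sub>L real" where
    d: "\<And>x. x \<in> W \<Longrightarrow> (f has_derivative blinfun_apply (f' x)) (at x)" and c: "continuous_on W f'"
    using f unfolding C1_on_def by blast
  have D: "D = blinfun_apply (f' p)"
    unfolding D_def by (rule frechet_derivative_at[OF d[OF W(2)], symmetric])
  then have lin: "linear D" by (simp add: blinfun.bounded_linear_right bounded_linear.linear)
  obtain e where e: "D e \<noteq> 0" using ne unfolding D_def by auto
  define F where "F x = x + ((f x - D x) / D e) *\<^sub>R e" for x
  have DF: "D (F x) = f x" for x
    using e by (simp add: F_def linear_add[OF lin] linear_scale[OF lin])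
  define E where "E = blinfun_scaleR_left e"
  define F' where "F' x = id_blinfun + (inverse (D e)) *\<^sub>R (E o\<^sub>L (f' x - f' p))" for x
  have dF: "(F has_derivative blinfun_apply (F' x)) (at x)" if "x \<in> W" for x
  proof -
    have "(D has_derivative D) (at x)"
      unfolding D by (rule bounded_linear_imp_has_derivative[OF blinfun.bounded_linear_right])
    then have "((\<lambda>x. x + (inverse (D e) * (f x - D x)) *\<^sub>R e) has_derivative
        (\<lambda>v. v + (inverse (D e) * (blinfun_apply (f' x) v - D v)) *\<^sub>R e)) (at x)"
      by (auto intro!: derivative_eq_intros d[OF that])
    moreover have "blinfun_apply (F' x) = (\<lambda>v. v + (inverse (D e) * (blinfun_apply (f' x) v - D v)) *\<^sub>R e)"
      by (simp add: fun_eq_iff F'_def E_def D blinfun.bilinear_simps)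
    ultimately show ?thesis by (simp add: F_def[abs_def] divide_inverse mult.commute)
  qed
  have cF: "continuous_on W F'"
    unfolding F'_def by (intro continuous_intros c)
  have F'p: "F' p = id_blinfun" by (simp add: F'_def)
  have inv: "id_blinfun o\<^sub>L F' p = id_blinfun"
    unfolding F'p by (rule blinfun_eqI) simp
  obtain U V G G' where U: "open U" "U \<subseteq> W" "p \<in> U" and V: "open V" "F p \<in> V"
    and hom: "homeomorphism U V F G"
    and dG: "\<And>y. y \<in> V \<Longrightarrow> (G has_derivative (G' y)) (at y)"
    and G': "\<And>y. y \<in> V \<Longrightarrow> G' y = inv (blinfun_apply (F' (G y)))"
    by (rule inverse_function_theorem[OF W(1) dF cF W(2) inv]) blast+
  have "G (F p) = p" using hom U(3) by (simp add: homeomorphism_def)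
  then have "G' (F p) = inv (\<lambda>v. v)" using G'[OF V(2)] F'p by (simp add: id_blinfun.rep_eq)
  then have "(G has_derivative (\<lambda>v. v)) (at (F p))" using dG[OF V(2)] by (simp add: inv_id[unfolded id_def])
  then show ?thesis using U V(1) hom DF by blast
qed

lemma curve_in_level_set:
  fixes f :: "'a::euclidean_space \<Rightarrow> real"
  assumes f: "C1_on f W" and W: "open W" "p \<in> W" and ne: "frechet_derivative f (at p) \<noteq> (\<lambda>_. 0)"
    and v: "frechet_derivative f (at p) v = 0"
  shows "\<exists>\<gamma>. \<gamma> 0 = p \<and> (\<forall>\<^sub>F s in nhds (0::real). \<gamma> s \<in> W \<and> f (\<gamma> s) = f p) \<and>
     (\<gamma> has_vector_derivative v) (at 0)"
proof -
  let ?D = "frechet_derivative f (at p)"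
  have lin: "linear ?D" by (rule has_derivative_linear[OF C1_on_has_derivative[OF f W(2)]])
  obtain F G U V where U: "open U" "p \<in> U" "U \<subseteq> W" and V: "open V" and hom: "homeomorphism U V F G"
    and DF: "\<And>x. ?D (F x) = f x" and dG: "(G has_derivative (\<lambda>v. v)) (at (F p))"
    using straightening[OF f W ne] by blast
  define \<gamma> where "\<gamma> s = G (F p + s *\<^sub>R v)" for s :: real
  have "\<gamma> 0 = p" using hom U(2) by (simp add: \<gamma>_def homeomorphism_def)
  moreover have "\<forall>\<^sub>F s in nhds (0::real). \<gamma> s \<in> W \<and> f (\<gamma> s) = f p"
  proof -
    have "F p \<in> V" using hom U(2) by (auto simp: homeomorphism_def)
    moreover have "isCont (\<lambda>s. F p + s *\<^sub>R v) 0" by (intro continuous_intros)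
    ultimately have "\<forall>\<^sub>F s in nhds (0::real). F p + s *\<^sub>R v \<in> V"
      using V unfolding continuous_at_open eventually_nhds by fastforce
    then show ?thesis
    proof eventually_elim
      fix s assume s: "F p + s *\<^sub>R v \<in> V"
      then have "F (\<gamma> s) = F p + s *\<^sub>R v" "\<gamma> s \<in> U"
        using hom by (auto simp: \<gamma>_def homeomorphism_def)
      moreover from this have "f (\<gamma> s) = ?D (F p) + s *\<^sub>R ?D v"
        by (metis DF linear_add[OF lin] linear_scale[OF lin])
      ultimately show "\<gamma> s \<in> W \<and> f (\<gamma> s) = f p" using U(3) v DF by auto
    qed
  qed
  moreover have "(\<gamma> has_vector_derivative v) (at 0)"
  proof -
    have "((\<lambda>s. F p + s *\<^sub>R v) has_derivative (\<lambda>s. s *\<^sub>R v)) (at 0)"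
      by (auto intro!: derivative_eq_intros)
    from has_derivative_compose[OF this, of G "\<lambda>v. v"] dG
    show ?thesis by (simp add: \<gamma>_def[abs_def] has_vector_derivative_def)
  qed
  ultimately show ?thesis by blast
qed

text \<open>In the straightening chart the two sides are the halves of a ball.\<close>

lemma connected_sides:
  fixes f :: "'a::euclidean_space \<Rightarrow> real"
  assumes f: "C1_on f W" and W: "open W" "p \<in> W" and ne: "frechet_derivative f (at p) \<noteq> (\<lambda>_. 0)"
  shows "\<exists>U. open U \<and> p \<in> U \<and> U \<subseteq> W \<and> connected {x\<in>U. 0 < f x} \<and> connected {x\<in>U. f x < 0}"
proof -
  let ?D = "frechet_derivative f (at p)"
  have lin: "linear ?D" by (rule has_derivative_linear[OF C1_on_has_derivative[OF f W(2)]])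
  obtain F G U V where U: "open U" "p \<in> U" "U \<subseteq> W" and V: "open V" and hom: "homeomorphism U V F G"
    and DF: "\<And>x. ?D (F x) = f x" 
    using straightening[OF f W ne] by blast
  have FpV: "F p \<in> V" using hom U(2) by (auto simp: homeomorphism_def)
  then obtain \<rho> where \<rho>: "0 < \<rho>" "ball (F p) \<rho> \<subseteq> V" using V open_contains_ball by blast
  have GF: "G (F x) = x" if "x \<in> U" for x using hom that by (simp add: homeomorphism_def)
  have FG: "F (G y) = y" "G y \<in> U" if "y \<in> V" for y using hom that by (auto simp: homeomorphism_def)
  have cG: "continuous_on V G" and cF: "continuous_on U F" using hom by (auto simp: homeomorphism_def)
  define U' where "U' = {x\<in>U. F x \<in> ball (F p) \<rho>}"
  have oU': "open U'"
  proof -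
    have "U' = F -` ball (F p) \<rho> \<inter> U" by (auto simp: U'_def)
    then show ?thesis using continuous_on_open_vimage[OF U(1)] cF by auto
  qed
  have conn: "connected {x\<in>U'. P (f x)}" if "convex {y. P (?D y)}" for P
  proof -
    have "{x\<in>U'. P (f x)} = G ` (ball (F p) \<rho> \<inter> {y. P (?D y)})"
    proof (intro set_eqI iffI)
      fix x assume x: "x \<in> {x\<in>U'. P (f x)}"
      then have "F x \<in> ball (F p) \<rho> \<inter> {y. P (?D y)}" "G (F x) = x" by (auto simp: U'_def DF GF)
      then show "x \<in> G ` (ball (F p) \<rho> \<inter> {y. P (?D y)})" by (metis imageI)
    next
      fix x assume "x \<in> G ` (ball (F p) \<rho> \<inter> {y. P (?D y)})"
      then obtain y where y: "x = G y" "y \<in> ball (F p) \<rho>" "P (?D y)" by blast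
      then have yV: "y \<in> V" using \<rho> by blast
      then show "x \<in> {x\<in>U'. P (f x)}" using y FG[OF yV] DF[of x] by (auto simp: U'_def)
    qed
    moreover have "continuous_on (ball (F p) \<rho> \<inter> {y. P (?D y)}) G"
      by (rule continuous_on_subset[OF cG]) (use \<rho>(2) in auto)
    moreover have "connected (ball (F p) \<rho> \<inter> {y. P (?D y)})"
      by (intro convex_connected convex_Int convex_ball that)
    ultimately show ?thesis by (simp add: connected_continuous_image)
  qed
  have "convex {y. 0 < ?D y}" "convex {y. ?D y < 0}"
  proof -
    have "{y. 0 < ?D y} = ?D -` {0<..}" "{y. ?D y < 0} = ?D -` {..<0}" by auto
    then show "convex {y. 0 < ?D y}" "convex {y. ?D y < 0}"
      using convex_linear_vimage[OF lin, of "{0<..}"] convex_linear_vimage[OF lin, of "{..<0}"] by auto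
  qed
  then have "connected {x\<in>U'. 0 < f x}" "connected {x\<in>U'. f x < 0}"
    using conn[of "\<lambda>u. 0 < u"] conn[of "\<lambda>u. u < 0"] by auto
  moreover have "p \<in> U'" "U' \<subseteq> W" using U \<rho> by (auto simp: U'_def)
  ultimately show ?thesis using oU' by blast
qed

text \<open>Near \<open>p\<close> the function \<open>f\<close> decreases strictly along \<open>e\<close>, and it changes sign on every line close to
  the one through \<open>p\<close>.\<close>

lemma positive_set_subgraph:
  fixes f :: "'a::euclidean_space \<Rightarrow> real"
  assumes f: "C1_on f (ball p R)" and R: "0 < R" and fp: "f p = 0"
    and e: "norm e = 1" and neg: "frechet_derivative f (at p) e < 0"
  shows "\<exists>\<delta> r. 0 < r \<and> r \<le> \<delta> \<and> 4 * \<delta> < R \<and>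
    (\<forall>A. (\<forall>x\<in>ball p R. x \<in> A \<longleftrightarrow> 0 < f x) \<longrightarrow> subgraph_near p e r \<delta> A)"
proof -
  have "open ((\<lambda>x. frechet_derivative f (at x) e) -` {..<0} \<inter> ball p R)"
    using continuous_on_open_vimage[of "ball p R" "\<lambda>x. frechet_derivative f (at x) e"]
      C1_on_continuous_derivative[OF f] by auto
  moreover have "p \<in> (\<lambda>x. frechet_derivative f (at x) e) -` {..<0} \<inter> ball p R" using neg R by simp
  ultimately obtain R1 where R1: "0 < R1" "ball p R1 \<subseteq> (\<lambda>x. frechet_derivative f (at x) e) -` {..<0} \<inter> ball p R"
    using open_contains_ball by blast
  define \<delta> where "\<delta> = min R1 R / 8"
  have \<delta>: "0 < \<delta>" "4 * \<delta> < R1" "4 * \<delta> < R" using R1(1) R by (auto simp: \<delta>_def min_def)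
  have cf: "continuous_on (ball p R) f" by (rule C1_on_imp_continuous_on[OF f])
  have decr: "f (z + t *\<^sub>R e) < f (z + s *\<^sub>R e)"
    if "s < t" "\<And>u. s \<le> u \<Longrightarrow> u \<le> t \<Longrightarrow> z + u *\<^sub>R e \<in> ball p R1" for z s t
  proof -
    let ?h = "\<lambda>u. - f (z + u *\<^sub>R e)"
    have "?h s < ?h t"
    proof (rule DERIV_pos_imp_increasing[OF that(1), of ?h])
      fix u assume "s \<le> u" "u \<le> t"
      then have u: "z + u *\<^sub>R e \<in> ball p R1" by (rule that(2))
      then have uR: "z + u *\<^sub>R e \<in> ball p R" using R1 by blast
      let ?D = "frechet_derivative f (at (z + u *\<^sub>R e))"
      have dD: "(f has_derivative ?D) (at (z + u *\<^sub>R e))" by (rule C1_on_has_derivative[OF f uR])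
      have "((\<lambda>u. z + u *\<^sub>R e) has_derivative (\<lambda>u. u *\<^sub>R e)) (at u)" by (auto intro!: derivative_eq_intros)
      from has_derivative_minus[OF has_derivative_compose[OF this dD]]
      have "(?h has_derivative (\<lambda>r. (- ?D e) * r)) (at u)"
        by (simp add: linear_scale[OF has_derivative_linear[OF dD]] mult.commute)
      then have "(?h has_real_derivative - ?D e) (at u)" unfolding has_field_derivative_def .
      moreover have "0 < - ?D e" using u R1 by auto
      ultimately show "\<exists>y. (?h has_real_derivative y) (at u) \<and> 0 < y" by blast
    qed
    then show ?thesis by simp
  qed
  have inb: "p + y + s *\<^sub>R e \<in> ball p R1" if "norm y \<le> \<delta>" "\<bar>s\<bar> \<le> 3 * \<delta>" for y s
  proof -
    have "norm (y + s *\<^sub>R e) \<le> norm y + \<bar>s\<bar>" using norm_triangle_ineq[of y "s *\<^sub>R e"] e by simp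
    moreover have "dist p (p + y + s *\<^sub>R e) = norm (y + s *\<^sub>R e)"
      by (metis add.assoc dist_add_cancel dist_0_norm add_0_right)
    ultimately show ?thesis using that \<delta> by simp
  qed
  have inR: "p + y + s *\<^sub>R e \<in> ball p R" if "norm y \<le> \<delta>" "\<bar>s\<bar> \<le> 3 * \<delta>" for y s
    using inb[OF that] R1 by blast
  have ends: "0 < f (p + (- \<delta>/4) *\<^sub>R e)" "f (p + (\<delta>/4) *\<^sub>R e) < 0"
    using decr[of "- \<delta>/4" 0 p] decr[of 0 "\<delta>/4" p] inb[of 0] \<delta> fp by auto
  have near: "\<exists>d>0. \<forall>x. dist x q < d \<longrightarrow> x \<in> S" if "open S" "q \<in> S" for q :: 'a and S
    using that open_dist by blast
  have o: "open (f -` {0<..} \<inter> ball p R)" "open (f -` {..<0} \<inter> ball p R)"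
    using continuous_on_open_vimage[of "ball p R" f] cf by auto
  obtain d1 where d1: "0 < d1" "\<And>x. dist x (p + (- \<delta>/4) *\<^sub>R e) < d1 \<Longrightarrow> 0 < f x"
    using near[OF o(1), of "p + (- \<delta>/4) *\<^sub>R e"] ends inR[of 0 "- \<delta>/4"] \<delta> by auto
  obtain d2 where d2: "0 < d2" "\<And>x. dist x (p + (\<delta>/4) *\<^sub>R e) < d2 \<Longrightarrow> f x < 0"
    using near[OF o(2), of "p + (\<delta>/4) *\<^sub>R e"] ends inR[of 0 "\<delta>/4"] \<delta> by auto
  define r where "r = min \<delta> (min d1 d2)"
  have r: "0 < r" "r \<le> \<delta>" using \<delta> d1 d2 by (auto simp: r_def)
  have g: "\<exists>g. \<bar>g\<bar> < \<delta> / 2 \<and> (\<forall>s. \<bar>s\<bar> \<le> 3 * \<delta> \<longrightarrow> (0 < f (p + y + s *\<^sub>R e) \<longleftrightarrow> s < g))" if y: "norm y < r" for y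
  proof -
    have ny: "norm y \<le> \<delta>" using y r by simp
    have di: "dist (p + y + s *\<^sub>R e) (p + s *\<^sub>R e) < d1" "dist (p + y + s *\<^sub>R e) (p + s *\<^sub>R e) < d2" for s
      using y by (auto simp: dist_norm r_def)
    have "\<exists>g\<ge>- \<delta>/4. g \<le> \<delta>/4 \<and> f (p + y + g *\<^sub>R e) = 0"
    proof (rule IVT2')
      show "f (p + y + (\<delta> / 4) *\<^sub>R e) \<le> 0" "0 \<le> f (p + y + (- \<delta> / 4) *\<^sub>R e)"
        using d1(2)[OF di(1)] d2(2)[OF di(2)] by (auto intro: less_imp_le)
      show "continuous_on {- \<delta> / 4..\<delta> / 4} (\<lambda>g. f (p + y + g *\<^sub>R e))"
        by (rule continuous_on_compose2[OF cf]) (use inR[OF ny] \<delta> in \<open>auto intro!: continuous_intros\<close>)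
    qed (use \<delta> in simp)
    then obtain g where "- \<delta>/4 \<le> g" "g \<le> \<delta>/4" and g0: "f (p + y + g *\<^sub>R e) = 0" by blast
    then have g: "\<bar>g\<bar> \<le> \<delta>/4" "f (p + y + g *\<^sub>R e) = 0" by linarith+
    have "0 < f (p + y + s *\<^sub>R e) \<longleftrightarrow> s < g" if s: "\<bar>s\<bar> \<le> 3 * \<delta>" for s
    proof (cases s g rule: linorder_cases)
      case less
      have "f (p + y + g *\<^sub>R e) < f (p + y + s *\<^sub>R e)"
        by (rule decr[OF less]) (use inb[OF ny] s g \<delta> in auto)
      then show ?thesis using g less by simp
    next
      case greater
      have "f (p + y + s *\<^sub>R e) < f (p + y + g *\<^sub>R e)"
        by (rule decr[OF greater]) (use inb[OF ny] s g \<delta> in auto)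
      then show ?thesis using g greater by simp
    qed (use g in simp)
    then show ?thesis using g(1) \<delta> by (intro exI[of _ g]) auto
  qed
  have "subgraph_near p e r \<delta> A" if A: "\<forall>x\<in>ball p R. x \<in> A \<longleftrightarrow> 0 < f x" for A
    unfolding subgraph_near_def
  proof (intro allI impI)
    fix y assume y: "y \<bullet> e = 0 \<and> norm y < r"
    then have ny: "norm y \<le> \<delta>" using r by simp
    show "\<exists>g. \<bar>g\<bar> < \<delta> / 2 \<and> (\<forall>s. \<bar>s\<bar> \<le> 3 * \<delta> \<longrightarrow> (p + y + s *\<^sub>R e \<in> A \<longleftrightarrow> s < g))"
      using g[of y] y A inR[OF ny] by auto
  qed
  then show ?thesis using r \<delta> by blast
qed

section \<open>The inner normal\<close>

text \<open>The gradient of \<open>f\<close> with respect to the Riemannian metric.\<close>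

definition rgrad :: "('n::finite heis \<Rightarrow> real) \<Rightarrow> 'n heis \<Rightarrow> 'n heis" where
  "rgrad f p = hgrad f p + frechet_derivative f (at p) (Tf p) *\<^sub>R Tf p"

lemma hmetric_rgrad:
  assumes "f differentiable (at p)"
  shows "hmetric p (rgrad f p) u = frechet_derivative f (at p) u"
proof -
  let ?D = "frechet_derivative f (at p)"
  have lin: "linear ?D" using assms frechet_derivative_works has_derivative_linear by blast
  have T: "Tcoeff p (hproj p u) = 0"
    by (simp add: hproj_eq linear_diff[OF Tcoeff_linear] linear_scale[OF Tcoeff_linear])
  have u: "u = hproj p u + Tcoeff p u *\<^sub>R Tf p" by (simp add: hproj_eq)
  have "?D u = ?D (hproj p u) + Tcoeff p u * ?D (Tf p)"
    by (subst u) (simp add: linear_add[OF lin] linear_scale[OF lin])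
  also have "?D (hproj p u) = hmetric p (hgrad f p) (hproj p u)"
    by (rule derivative_horizontal[OF assms T])
  also have "\<dots> = hmetric p (hgrad f p) u"
    by (simp add: hproj_eq linear_diff[OF hmetric_linear(1)] linear_scale[OF hmetric_linear(1)] hmetric_frame)
  finally show ?thesis
    by (simp add: rgrad_def linear_add[OF hmetric_linear(2)] linear_scale[OF hmetric_linear(2)]
        hmetric_commute[of p "Tf p"] hmetric_frame mult.commute)
qed

definition unit_rgrad :: "('n::finite heis \<Rightarrow> real) \<Rightarrow> 'n heis \<Rightarrow> 'n heis" where
  "unit_rgrad f p = inverse (hnorm p (rgrad f p)) *\<^sub>R rgrad f p"

lemma rgrad_nonzero:
  assumes "f differentiable (at p)" "frechet_derivative f (at p) \<noteq> (\<lambda>_. 0)"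
  shows "rgrad f p \<noteq> 0"
  using hmetric_rgrad[OF assms(1)] assms(2) linear_0[OF hmetric_linear(2), of p] by (auto simp: fun_eq_iff)

lemma derivative_unit_rgrad_pos:
  assumes "f differentiable (at p)" "frechet_derivative f (at p) \<noteq> (\<lambda>_. 0)"
  shows "0 < frechet_derivative f (at p) (unit_rgrad f p)"
  using hmetric_pos[OF rgrad_nonzero[OF assms], of p] hnorm_pos[OF rgrad_nonzero[OF assms], of p]
  by (simp add: hmetric_rgrad[OF assms(1), symmetric] unit_rgrad_def linear_scale[OF hmetric_linear(1)])

lemma hmetric_unit_rgrad:
  assumes "f differentiable (at p)"
  shows "hmetric p (unit_rgrad f p) u = inverse (hnorm p (rgrad f p)) * frechet_derivative f (at p) u"
  by (simp add: unit_rgrad_def linear_scale[OF hmetric_linear(2)] hmetric_rgrad[OF assms])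

lemma unit_rgrad_unit:
  assumes "f differentiable (at p)" "frechet_derivative f (at p) \<noteq> (\<lambda>_. 0)"
  shows "hmetric p (unit_rgrad f p) (unit_rgrad f p) = 1"
  using hnorm_pos[OF rgrad_nonzero[OF assms], of p]
  by (simp add: hnorm_square unit_rgrad_def hnorm_scaleR)

lemma tangent_space_subset_kernel:
  assumes d: "f differentiable (at p)" and W: "open W" "p \<in> W" and z: "\<And>x. x \<in> W \<Longrightarrow> x \<in> \<Sigma> \<Longrightarrow> f x = 0"
    and v: "v \<in> tangent_space \<Sigma> p"
  shows "frechet_derivative f (at p) v = 0"
proof -
  obtain \<gamma> where \<gamma>: "\<gamma> 0 = p" "\<forall>\<^sub>F s in nhds (0::real). \<gamma> s \<in> \<Sigma>" "(\<gamma> has_vector_derivative v) (at 0)"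
    using v by (auto simp: tangent_space_def)
  have df: "(f has_derivative frechet_derivative f (at p)) (at (\<gamma> 0))"
    using d \<gamma>(1) frechet_derivative_works by auto
  have "isCont \<gamma> 0" using \<gamma>(3) has_vector_derivative_continuous by blast
  then have "\<forall>\<^sub>F s in nhds 0. \<gamma> s \<in> W"
    using W \<gamma>(1) unfolding continuous_at_open eventually_nhds by fastforce
  with \<gamma>(2) have ev: "\<forall>\<^sub>F s in nhds 0. f (\<gamma> s) = 0" by eventually_elim (rule z)
  have "((\<lambda>s. f (\<gamma> s)) has_derivative (\<lambda>s. frechet_derivative f (at p) (s *\<^sub>R v))) (at 0)"
    by (rule has_derivative_compose[OF \<gamma>(3)[unfolded has_vector_derivative_def] df])
  moreover have "((\<lambda>s. f (\<gamma> s)) has_derivative (\<lambda>_. 0)) (at 0)"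
  proof -
    obtain S where "open S" "0 \<in> S" "\<And>s. s \<in> S \<Longrightarrow> f (\<gamma> s) = 0"
      using ev unfolding eventually_nhds by blast
    then show ?thesis
      by (intro has_derivative_transform_within_open[OF has_derivative_const]) auto
  qed
  ultimately have "(\<lambda>s. frechet_derivative f (at p) (s *\<^sub>R v)) = (\<lambda>_. 0)"
    by (rule has_derivative_unique)
  then show ?thesis by (metis scaleR_one)
qed

text \<open>Tangent vectors are defined through curves, so that the inclusion of the kernel needs the curves
  supplied by the straightening chart.\<close>

lemma tangent_space_eq_kernel:
  fixes f :: "'n::finite heis \<Rightarrow> real"
  assumes f: "C1_on f W" and W: "open W" "p \<in> W" and z: "\<And>x. x \<in> W \<Longrightarrow> x \<in> \<Sigma> \<longleftrightarrow> f x = 0" and p: "p \<in> \<Sigma>"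
    and ne: "frechet_derivative f (at p) \<noteq> (\<lambda>_. 0)"
  shows "tangent_space \<Sigma> p = {v. frechet_derivative f (at p) v = 0}"
proof (intro set_eqI iffI)
  fix v assume "v \<in> tangent_space \<Sigma> p"
  then show "v \<in> {v. frechet_derivative f (at p) v = 0}"
    using tangent_space_subset_kernel[OF C1_on_differentiable[OF f W(2)] W, of \<Sigma> v] z by auto
next
  fix v assume "v \<in> {v. frechet_derivative f (at p) v = 0}"
  then obtain \<gamma> where \<gamma>: "\<gamma> 0 = p" "\<forall>\<^sub>F s in nhds (0::real). \<gamma> s \<in> W \<and> f (\<gamma> s) = f p" "(\<gamma> has_vector_derivative v) (at 0)"
    using curve_in_level_set[OF f W ne] by blast
  have "\<forall>\<^sub>F s in nhds (0::real). \<gamma> s \<in> \<Sigma>"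
    using \<gamma>(2) by eventually_elim (use z W(2) p in auto)
  then show "v \<in> tangent_space \<Sigma> p" using \<gamma> by (auto simp: tangent_space_def)
qed

lemma is_inner_normal_unit_rgrad:
  assumes d: "f differentiable (at p)" and ne: "frechet_derivative f (at p) \<noteq> (\<lambda>_. 0)" and fp: "f p = 0"
    and W: "open W" "p \<in> W" and z: "\<And>x. x \<in> W \<Longrightarrow> x \<in> frontier \<Omega> \<Longrightarrow> f x = 0"
    and pos: "\<And>x. x \<in> W \<Longrightarrow> 0 < f x \<Longrightarrow> x \<in> \<Omega>"
  shows "is_inner_normal \<Omega> p (unit_rgrad f p)"
  unfolding is_inner_normal_def
proof (intro conjI ballI)
  let ?N = "unit_rgrad f p" and ?D = "frechet_derivative f (at p)"
  show "hmetric p ?N ?N = 1" by (rule unit_rgrad_unit[OF d ne])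
  show "hmetric p ?N v = 0" if "v \<in> tangent_space (frontier \<Omega>) p" for v
    using tangent_space_subset_kernel[OF d W z that] by (simp add: hmetric_unit_rgrad[OF d])
  have lin: "linear ?D" using d frechet_derivative_works has_derivative_linear by blast
  have "((\<lambda>s::real. p + s *\<^sub>R ?N) has_derivative (\<lambda>s. s *\<^sub>R ?N)) (at 0)"
    by (auto intro!: derivative_eq_intros)
  moreover have "(f has_derivative ?D) (at (p + 0 *\<^sub>R ?N))" using d frechet_derivative_works by auto
  ultimately have "((\<lambda>s. f (p + s *\<^sub>R ?N)) has_derivative (\<lambda>s. ?D (s *\<^sub>R ?N))) (at 0)"
    by (rule has_derivative_compose)
  then have "((\<lambda>s. f (p + s *\<^sub>R ?N)) has_real_derivative ?D ?N) (at 0)"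
    by (simp add: has_field_derivative_def linear_scale[OF lin] mult.commute[of _ "?D _"])
  from DERIV_pos_inc_right[OF this derivative_unit_rgrad_pos[OF d ne]]
  obtain d where d: "0 < d" "\<And>h. 0 < h \<Longrightarrow> h < d \<Longrightarrow> 0 < f (p + h *\<^sub>R ?N)"
    using fp by auto
  then have "\<forall>\<^sub>F s in at_right 0. 0 < f (p + s *\<^sub>R ?N)"
    unfolding eventually_at_right_field by (intro exI[of _ d]) auto
  moreover have "\<forall>\<^sub>F s in at_right 0. p + s *\<^sub>R ?N \<in> W"
  proof -
    have "isCont (\<lambda>s::real. p + s *\<^sub>R ?N) 0" by (intro continuous_intros)
    then have "\<forall>\<^sub>F s in nhds (0::real). p + s *\<^sub>R ?N \<in> W"
      using W unfolding continuous_at_open eventually_nhds by fastforce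
    then show ?thesis by (simp add: eventually_at_filter eventually_mono)
  qed
  ultimately show "\<forall>\<^sub>F s in at_right 0. p + s *\<^sub>R ?N \<in> \<Omega>"
    by eventually_elim (rule pos)
qed

lemma C2_on_minus:
  fixes f :: "'a::euclidean_space \<Rightarrow> 'b::real_normed_vector"
  assumes "C2_on f W" shows "C2_on (\<lambda>x. - f x) W"
proof -
  obtain f' :: "'a \<Rightarrow> 'a \<Rightarrow>\<^sub>L 'b" where
    d: "\<And>x. x \<in> W \<Longrightarrow> (f has_derivative blinfun_apply (f' x)) (at x)" and c: "C1_on f' W"
    using assms(1) unfolding C2_on_def by blast
  have "((\<lambda>x. - f x) has_derivative blinfun_apply (- f' x)) (at x)" if "x \<in> W" for x
  proof -
    have "blinfun_apply (- f' x) = (\<lambda>v. - blinfun_apply (f' x) v)"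
      by (simp add: fun_eq_iff blinfun.minus_left)
    then show ?thesis using has_derivative_minus[OF d[OF that]] by simp
  qed
  then show ?thesis unfolding C2_on_def
    by (intro exI[of _ "\<lambda>x. - f' x"] conjI ballI C1_on_minus[OF c])
qed

lemma C2_on_subset: "C2_on f W \<Longrightarrow> V \<subseteq> W \<Longrightarrow> C2_on f V"
  unfolding C2_on_def by (meson C1_on_subset subsetD)

lemma frechet_derivative_uminus:
  assumes "f differentiable (at p)"
  shows "frechet_derivative (\<lambda>x. - f x) (at p) = (\<lambda>v. - frechet_derivative f (at p) v)"
  by (rule frechet_derivative_at[symmetric], rule has_derivative_minus)
     (use assms frechet_derivative_works in blast)

text \<open>The two sides \<open>{f > 0}\<close> and \<open>{f < 0}\<close> are connected and do not meet the boundary, so each is inside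
  \<open>\<Omega>\<close> or disjoint from it. Not both are disjoint from \<open>\<Omega>\<close>, as the boundary point \<open>p\<close> is a limit of
  points of the open set \<open>\<Omega>\<close>. If both were inside, the normalized gradients of \<open>f\<close> and \<open>- f\<close> would be
  two inner normals at \<open>p\<close>, contrary to uniqueness. Changing the sign of \<open>f\<close> if necessary makes
  \<open>{f > 0}\<close> the inner side.\<close>

lemma local_defining_function:
  fixes \<Omega> :: "'n::finite heis set"
  assumes \<Omega>: "bounded_by_C2_hypersurface \<Omega>" and p: "p \<in> frontier \<Omega>"
  shows "\<exists>(f :: 'n heis \<Rightarrow> real) R. 0 < R \<and> C2_on f (ball p R) \<and>
    (\<forall>x\<in>ball p R. frechet_derivative f (at x) \<noteq> (\<lambda>_. 0) \<and> (x \<in> \<Omega> \<longleftrightarrow> 0 < f x) \<and> (x \<in> frontier \<Omega> \<longleftrightarrow> f x = 0))"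
proof -
  have op: "open \<Omega>" and uniq: "\<exists>!N. is_inner_normal \<Omega> p N"
    using \<Omega> p by (auto simp: bounded_by_C2_hypersurface_def)
  have disj: "\<Omega> \<inter> frontier \<Omega> = {}" using op by (auto simp: frontier_def interior_open)
  have "C2_hypersurface (frontier \<Omega>)" using \<Omega> by (simp add: bounded_by_C2_hypersurface_def)
  from bspec[OF this[unfolded C2_hypersurface_def] p]
  obtain W and f :: "'n heis \<Rightarrow> real" where W: "open W" "p \<in> W" and f: "C2_on f W"
    and ne': "\<forall>q\<in>W. frechet_derivative f (at q) \<noteq> (\<lambda>_. 0)"
    and eq: "frontier \<Omega> \<inter> W = {q \<in> W. f q = 0}"
    by (elim exE conjE)
  have ne: "frechet_derivative f (at q) \<noteq> (\<lambda>_. 0)" if "q \<in> W" for q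
    using ne' that by (rule bspec)
  have fr: "x \<in> frontier \<Omega> \<longleftrightarrow> f x = 0" if "x \<in> W" for x using eq that by blast
  have C1: "C1_on f W" by (rule C2_on_imp_C1_on[OF f])
  have dif: "f differentiable (at p)" by (rule C1_on_differentiable[OF C1 W(2)])
  have fp: "f p = 0" using fr[OF W(2)] p by simp
  obtain U where U: "open U" "p \<in> U" "U \<subseteq> W" and conn: "connected {x\<in>U. 0 < f x}" "connected {x\<in>U. f x < 0}"
    using connected_sides[OF C1 W ne[OF W(2)]] by blast
  have side: "S \<subseteq> \<Omega> \<or> S \<inter> \<Omega> = {}" if "connected S" "S \<inter> frontier \<Omega> = {}" for S
    using connected_Int_frontier[OF that(1), of \<Omega>] that(2) by blast
  have P: "{x\<in>U. 0 < f x} \<subseteq> \<Omega> \<or> {x\<in>U. 0 < f x} \<inter> \<Omega> = {}"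
    by (rule side[OF conn(1)]) (use fr U in force)
  have N: "{x\<in>U. f x < 0} \<subseteq> \<Omega> \<or> {x\<in>U. f x < 0} \<inter> \<Omega> = {}"
    by (rule side[OF conn(2)]) (use fr U in force)
  have meets: "U \<inter> \<Omega> \<noteq> {}"
    using p U(2) open_Int_closure_eq_empty[OF U(1), of \<Omega>] by (auto simp: frontier_def)
  obtain R where R: "0 < R" "ball p R \<subseteq> U" using U open_contains_ball by blast
  have zero: "x \<notin> \<Omega>" if "x \<in> U" "f x = 0" for x
    using fr[of x] that U disj by blast
  have both: False if PP: "{x\<in>U. 0 < f x} \<subseteq> \<Omega>" and NN: "{x\<in>U. f x < 0} \<subseteq> \<Omega>"
  proof -
    have 1: "is_inner_normal \<Omega> p (unit_rgrad f p)"
      by (rule is_inner_normal_unit_rgrad[OF dif ne[OF W(2)] fp U(1,2)]) (use fr U PP in auto)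
    have dif': "(\<lambda>x. - f x) differentiable (at p)" using dif by simp
    have D': "frechet_derivative (\<lambda>x. - f x) (at p) = (\<lambda>v. - frechet_derivative f (at p) v)"
      by (rule frechet_derivative_uminus[OF dif])
    have ne': "frechet_derivative (\<lambda>x. - f x) (at p) \<noteq> (\<lambda>_. 0)"
      using ne[OF W(2)] by (auto simp: D' fun_eq_iff)
    have 2: "is_inner_normal \<Omega> p (unit_rgrad (\<lambda>x. - f x) p)"
      by (rule is_inner_normal_unit_rgrad[OF dif' ne' _ U(1,2)]) (use fp fr U NN in auto)
    have "unit_rgrad f p = unit_rgrad (\<lambda>x. - f x) p" using uniq 1 2 by blast
    then show False
      using derivative_unit_rgrad_pos[OF dif ne[OF W(2)]] derivative_unit_rgrad_pos[OF dif' ne'] by (simp add: D')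
  qed
  consider (pos) "{x\<in>U. 0 < f x} \<subseteq> \<Omega>" "{x\<in>U. f x < 0} \<inter> \<Omega> = {}" |
    (neg) "{x\<in>U. f x < 0} \<subseteq> \<Omega>" "{x\<in>U. 0 < f x} \<inter> \<Omega> = {}"
  proof (cases "{x\<in>U. 0 < f x} \<subseteq> \<Omega>")
    case True
    then show ?thesis using both N pos by blast
  next
    case False
    have "{x\<in>U. f x < 0} \<subseteq> \<Omega>"
    proof (rule ccontr)
      assume "\<not> ?thesis"
      then have "U \<inter> \<Omega> = {}" using False P N zero by (auto simp: disjoint_iff) (metis linorder_neqE_linordered_idom)
      then show False using meets by blast
    qed
    then show ?thesis using False P neg by blast
  qed
  then show ?thesis
  proof cases
    case pos
    have mem: "x \<in> \<Omega> \<longleftrightarrow> 0 < f x" if "x \<in> U" for x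
      using pos zero[OF that] that by (cases "f x" "0::real" rule: linorder_cases) auto
    show ?thesis
    proof (intro exI[of _ f] exI[of _ R] conjI ballI)
      fix x assume "x \<in> ball p R"
      then have x: "x \<in> U" "x \<in> W" using R U by auto
      show "frechet_derivative f (at x) \<noteq> (\<lambda>_. 0)" by (rule ne[OF x(2)])
      show "x \<in> \<Omega> \<longleftrightarrow> 0 < f x" by (rule mem[OF x(1)])
      show "x \<in> frontier \<Omega> \<longleftrightarrow> f x = 0" by (rule fr[OF x(2)])
    qed (use R U C2_on_subset[OF f, of "ball p R"] in auto)
  next
    case neg
    have mem: "x \<in> \<Omega> \<longleftrightarrow> 0 < - f x" if "x \<in> U" for x
      using neg zero[OF that] that by (cases "f x" "0::real" rule: linorder_cases) auto
    have ne': "frechet_derivative (\<lambda>x. - f x) (at x) \<noteq> (\<lambda>_. 0)" if "x \<in> W" for x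
      using ne[OF that] frechet_derivative_uminus[OF C1_on_differentiable[OF C1 that]] by (auto simp: fun_eq_iff)
    show ?thesis
    proof (intro exI[of _ "\<lambda>x. - f x"] exI[of _ R] conjI ballI)
      fix x assume "x \<in> ball p R"
      then have x: "x \<in> U" "x \<in> W" using R U by auto
      show "frechet_derivative (\<lambda>x. - f x) (at x) \<noteq> (\<lambda>_. 0)" by (rule ne'[OF x(2)])
      show "x \<in> \<Omega> \<longleftrightarrow> 0 < - f x" by (rule mem[OF x(1)])
      show "x \<in> frontier \<Omega> \<longleftrightarrow> - f x = 0" using fr[OF x(2)] by simp
    qed (use R U C2_on_subset[OF C2_on_minus[OF f], of "ball p R"] in auto)
  qed
qed

section \<open>The mean curvature as a divergence\<close>

lemma Tcoeff_field_has_derivative: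
  assumes V: "(V has_derivative DV) (at p)"
  shows "((\<lambda>q. Tcoeff q (V q)) has_derivative
     (\<lambda>v. Tcoeff p (DV v) + (Tcoeff v (V p) - snd (V p)))) (at p)"
proof -
  have 1: "((\<lambda>q. fst q $ k) has_derivative (\<lambda>a. fst a $ k)) (at p)" for k
    by (intro bounded_linear_imp_has_derivative
        bounded_linear_compose[OF bounded_linear_vec_nth bounded_linear_fst])
  have 2: "((\<lambda>q. fst (V q) $ k) has_derivative (\<lambda>a. fst (DV a) $ k)) (at p)" for k
    by (rule bounded_linear.has_derivative[OF bounded_linear_compose[OF bounded_linear_vec_nth bounded_linear_fst] V])
  show ?thesis
    unfolding Tcoeff_def
    by (auto intro!: derivative_eq_intros 1 2 V simp: algebra_simps sum.distrib sum_subtractf)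
qed

text \<open>The reason why the divergence of the extension \<open>V\<close> equals the divergence along the surface:
  \<open>\<langle>D\<^sub>N V, V\<rangle> = 0\<close> because \<open>V\<close> has unit length, and \<open>\<langle>D\<^sub>N V, T\<rangle> = - \<langle>V, D\<^sub>N T\<rangle> = 0\<close> because \<open>V\<close> is horizontal
  and \<open>D\<^sub>N T\<close>, for \<open>N = a V + b T\<close>, is a multiple of \<open>V\<close> rotated by a right angle.\<close>

lemma levi_civita_normal_horizontal:
  fixes V :: "'n::finite heis \<Rightarrow> 'n heis"
  assumes V: "V differentiable (at p)" and W: "open W" "p \<in> W"
    and hor: "\<And>q. q \<in> W \<Longrightarrow> Tcoeff q (V q) = 0" and unit: "\<And>q. q \<in> W \<Longrightarrow> hmetric q (V q) (V q) = 1"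
    and N: "N = a *\<^sub>R V p + b *\<^sub>R Tf p"
  shows "hmetric p (levi_civita UNIV V p N) N = 0"
proof -
  define DV where "DV = frechet_derivative V (at p)"
  have dV: "(V has_derivative DV) (at p)" using V unfolding DV_def by (simp add: frechet_derivative_works[symmetric])
  have "((\<lambda>q. Tcoeff q (V q)) has_derivative (\<lambda>_. 0)) (at p)"
    using has_derivative_transform_within_open[OF has_derivative_const W, of 0 "\<lambda>q. Tcoeff q (V q)"] hor by simp
  note Teq = has_derivative_unique[OF Tcoeff_field_has_derivative[OF dV] this]
  have T: "Tcoeff p (DV v) = - (Tcoeff v (V p) - snd (V p))" for v
    using fun_cong[OF Teq, of v] by linarith
  have dfst: "((\<lambda>q. fst (V q)) has_derivative (\<lambda>v. fst (DV v))) (at p)"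
    by (rule bounded_linear.has_derivative[OF bounded_linear_fst dV])
  have "((\<lambda>q. fst (V q) \<bullet> fst (V q)) has_derivative (\<lambda>_. 0)) (at p)"
    using has_derivative_transform_within_open[OF has_derivative_const W, of 1 "\<lambda>q. fst (V q) \<bullet> fst (V q)"]
      unit hor by (simp add: hmetric_horizontal)
  note Ieq = has_derivative_unique[OF has_derivative_inner[OF dfst dfst] this]
  have I: "fst (DV v) \<bullet> fst (V p) = 0" for v
    using fun_cong[OF Ieq, of v] by (simp add: inner_commute)
  have V0: "Tcoeff p (V p) = 0" by (rule hor[OF W(2)])
  have "hmetric p (levi_civita UNIV V p N) (V p) = hmetric p (DV N) (V p) + koszul p N (V p) (V p)"
    by (simp add: levi_civita_def DV_def linear_add[OF hmetric_linear(2)] hmetric_christoffel)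
  also have "\<dots> = 0" by (simp add: hmetric_fst I V0 koszul_eq Tcoeff_self)
  finally have 1: "hmetric p (levi_civita UNIV V p N) (V p) = 0" .
  have "hmetric p (levi_civita UNIV V p N) (Tf p) = Tcoeff p (DV N) + koszul p N (V p) (Tf p)"
    unfolding levi_civita_def linear_add[OF hmetric_linear(2)] hmetric_christoffel
    by (simp add: DV_def hmetric_frame)
  also have "\<dots> = - (Tcoeff N (V p) - snd (V p))"
    by (simp add: T koszul_eq V0) (simp add: Tf_def Tcoeff_T)
  also have "\<dots> = - (a * (Tcoeff (V p) (V p) - snd (V p)) + b * (Tcoeff (Tf p) (V p) - snd (V p)))"
    unfolding N linear_add[OF Tcoeff_base_linear] linear_scale[OF Tcoeff_base_linear] by simp
  also have "\<dots> = 0" by (simp add: Tcoeff_self) (simp add: Tf_def Tcoeff_T)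
  finally have 2: "hmetric p (levi_civita UNIV V p N) (Tf p) = 0" .
  show ?thesis
    by (subst (2) N) (simp add: linear_add[OF hmetric_linear(1)] linear_scale[OF hmetric_linear(1)] 1 2)
qed

text \<open>Derivatives within a hypersurface are not unique, but on tangent vectors they are determined by
  differentiating along curves.\<close>

lemma frechet_derivative_within_tangent:
  assumes V: "(V has_derivative D) (at p)" and W: "open W" "p \<in> W" and p: "p \<in> \<Sigma>"
    and eq: "\<And>q. q \<in> W \<Longrightarrow> q \<in> \<Sigma> \<Longrightarrow> U q = V q" and v: "v \<in> tangent_space \<Sigma> p"
  shows "frechet_derivative U (at p within \<Sigma>) v = D v"
proof -
  obtain d where d: "0 < d" "ball p d \<subseteq> W" using W open_contains_ball by blast
  have U: "(U has_derivative D) (at p within \<Sigma>)"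
    by (rule has_derivative_transform_within[OF has_derivative_at_withinI[OF V] d(1) p])
       (use d(2) eq in \<open>auto simp: dist_commute subset_iff\<close>)
  then have U': "(U has_derivative frechet_derivative U (at p within \<Sigma>)) (at p within \<Sigma>)"
    using frechet_derivative_works differentiableI by blast
  obtain \<gamma> where \<gamma>: "\<gamma> 0 = p" "\<forall>\<^sub>F s in nhds (0::real). \<gamma> s \<in> \<Sigma>" "(\<gamma> has_vector_derivative v) (at 0)"
    using v by (auto simp: tangent_space_def)
  obtain S where S: "open S" "0 \<in> S" "\<gamma> ` S \<subseteq> \<Sigma>" using \<gamma>(2) unfolding eventually_nhds by blast
  have "((\<lambda>s. U (\<gamma> s)) has_derivative (\<lambda>s. E (s *\<^sub>R v))) (at 0)" if "(U has_derivative E) (at p within \<Sigma>)" for E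
  proof -
    have "(\<gamma> has_derivative (\<lambda>s. s *\<^sub>R v)) (at 0 within S)"
      using \<gamma>(3) unfolding has_vector_derivative_def by (rule has_derivative_at_withinI)
    moreover have "(U has_derivative E) (at (\<gamma> 0) within \<gamma> ` S)"
      unfolding \<gamma>(1) by (rule has_derivative_subset[OF that S(3)])
    ultimately have "((\<lambda>s. U (\<gamma> s)) has_derivative (\<lambda>s. E (s *\<^sub>R v))) (at 0 within S)"
      by (rule has_derivative_in_compose)
    then show ?thesis unfolding at_within_open[OF S(2,1)] .
  qed
  from has_derivative_unique[OF this[OF U'] this[OF U]] show ?thesis by (metis scaleR_one)
qed

text \<open>Existence matters because \<open>surface_div\<close> is a definite description over all orthonormal bases.\<close>

lemma orthonormal_basis_exists:
  fixes V :: "'n::finite heis set"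
  assumes "subspace V"
  shows "\<exists>B. orthonormal_basis p V B"
proof -
  let ?L = "frame_coords p"
  have lin: "linear ?L" by (rule frame_coords_linear)
  have inj: "inj ?L" using frame_coords_bij bij_betw_def by blast
  obtain B where B: "B \<subseteq> ?L ` V" "pairwise orthogonal B" "\<And>x. x \<in> B \<Longrightarrow> norm x = 1"
    "independent B" "span B = ?L ` V"
    using orthonormal_basis_subspace[OF linear_subspace_image[OF lin assms]] by metis
  define C where "C = {u \<in> V. ?L u \<in> B}"
  have LC: "?L ` C = B" using B(1) by (auto simp: C_def)
  have "finite C"
    using finite_imageD[of ?L C] LC independent_imp_finite[OF B(4)] inj_on_subset[OF inj] by simp
  moreover have "span C = V"
  proof -
    have "?L ` span C = ?L ` V" by (simp add: linear_span_image[OF lin, symmetric] LC B(5))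
    then show ?thesis by (simp add: inj_image_eq_iff[OF inj])
  qed
  moreover have "hmetric p e e' = (if e = e' then 1 else 0)" if e: "e \<in> C" "e' \<in> C" for e e'
  proof (cases "e = e'")
    case True
    then show ?thesis using B(3)[of "?L e"] e by (simp add: C_def hmetric_eq_inner norm_1_inner_self)
  next
    case False
    then have "?L e \<noteq> ?L e'" using inj by (auto dest: injD)
    then show ?thesis using B(2) e False by (auto simp: C_def hmetric_eq_inner pairwise_def orthogonal_def)
  qed
  ultimately show ?thesis unfolding orthonormal_basis_def by blast
qed

lemma hproj_unit_rgrad:
  "hproj p (unit_rgrad f p) = inverse (hnorm p (rgrad f p)) *\<^sub>R hgrad f p"
  by (simp add: hproj_eq unit_rgrad_def rgrad_def linear_add[OF Tcoeff_linear] linear_scale[OF Tcoeff_linear] algebra_simps)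

text \<open>An orthonormal basis of the tangent space together with \<open>N\<close> is an orthonormal basis of the whole
  space. The trace defining the divergence of \<open>V = - \<nu>\<close>, which extends the horizontal normal, is thus
  the divergence along the surface plus the term \<open>\<langle>D\<^sub>N V, N\<rangle> = 0\<close>. The first part identifies the
  singular points as the zeros of the horizontal gradient.\<close>

lemma mean_curvature_eq_hdiv:
  fixes f :: "'n::finite heis \<Rightarrow> real"
  assumes \<Omega>: "bounded_by_C2_hypersurface \<Omega>" and p: "p \<in> frontier \<Omega>"
    and W: "open W" "p \<in> W" and f: "C2_on f W"
    and ne: "\<And>x. x \<in> W \<Longrightarrow> frechet_derivative f (at x) \<noteq> (\<lambda>_. 0)"
    and inside: "\<And>x. x \<in> W \<Longrightarrow> x \<in> \<Omega> \<longleftrightarrow> 0 < f x"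
    and bd: "\<And>x. x \<in> W \<Longrightarrow> x \<in> frontier \<Omega> \<longleftrightarrow> f x = 0"
  shows "hproj p (inner_normal \<Omega> p) = inverse (hnorm p (rgrad f p)) *\<^sub>R hgrad f p"
    and "(\<And>x. x \<in> W \<Longrightarrow> hgrad f x \<noteq> 0) \<Longrightarrow>
      hdiv (outward_horizontal_normal f) p = 2 * real CARD('n) * mean_curvature \<Omega> p"
proof -
  let ?\<nu> = "outward_horizontal_normal f" and ?D = "frechet_derivative f (at p)"
  have C1: "C1_on f W" by (rule C2_on_imp_C1_on[OF f])
  have dif: "f differentiable (at q)" if "q \<in> W" for q by (rule C1_on_differentiable[OF C1 that])
  have normal: "inner_normal \<Omega> q = unit_rgrad f q" if q: "q \<in> W" "q \<in> frontier \<Omega>" for q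
  proof -
    have "is_inner_normal \<Omega> q (unit_rgrad f q)"
      by (rule is_inner_normal_unit_rgrad[OF dif[OF q(1)] ne[OF q(1)] _ W(1) q(1)])
         (use inside bd q in auto)
    moreover have "\<exists>!N. is_inner_normal \<Omega> q N" using \<Omega> q by (simp add: bounded_by_C2_hypersurface_def)
    ultimately show ?thesis unfolding inner_normal_def by (metis the1_equality)
  qed
  show "hproj p (inner_normal \<Omega> p) = inverse (hnorm p (rgrad f p)) *\<^sub>R hgrad f p"
    unfolding normal[OF W(2) p] by (rule hproj_unit_rgrad)
  assume h: "\<And>x. x \<in> W \<Longrightarrow> hgrad f x \<noteq> 0"
  define V where "V q = - ?\<nu> q" for q
  have Veq: "horizontal_normal \<Omega> q = V q" if q: "q \<in> W" "q \<in> frontier \<Omega>" for q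
  proof -
    have "0 < hnorm q (rgrad f q)" by (rule hnorm_pos[OF rgrad_nonzero[OF dif[OF q(1)] ne[OF q(1)]]])
    then show ?thesis
      unfolding horizontal_normal_def normal[OF q] hproj_unit_rgrad hnorm_scaleR V_def outward_horizontal_normal_def
      by (simp add: field_simps)
  qed
  have C1\<nu>: "C1_on ?\<nu> W" by (rule C1_on_outward[OF f W(1) h])
  have C1V: "C1_on V W" unfolding V_def by (rule C1_on_minus[OF C1\<nu>])
  have difV: "V differentiable (at p)" by (rule C1_on_differentiable[OF C1V W(2)])
  have dV: "(V has_derivative frechet_derivative V (at p)) (at p)" using difV frechet_derivative_works by blast
  have TV: "Tcoeff q (V q) = 0" for q by (simp add: V_def linear_neg[OF Tcoeff_linear])
  have VV: "hmetric q (V q) (V q) = 1" if "q \<in> W" for q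
    using hnorm_outward[OF h[OF that]] by (simp add: hnorm_square V_def hnorm_minus)
  let ?N = "unit_rgrad f p"
  have kernel: "tangent_space (frontier \<Omega>) p = {v. ?D v = 0}"
    by (rule tangent_space_eq_kernel[OF C1 W bd p ne[OF W(2)]])
  have lin: "linear ?D" by (rule has_derivative_linear[OF C1_on_has_derivative[OF C1 W(2)]])
  have sub: "subspace {v. ?D v = 0}" by (rule linear_subspace_kernel[OF lin])
  have Nform: "?N = (inverse (hnorm p (rgrad f p)) * hnorm p (hgrad f p)) *\<^sub>R V p
      + (inverse (hnorm p (rgrad f p)) * ?D (Tf p)) *\<^sub>R Tf p"
    using hnorm_pos[OF h[OF W(2)], of p]
    by (simp add: V_def outward_horizontal_normal_def unit_rgrad_def rgrad_def scaleR_add_right)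
  have NN0: "hmetric p (levi_civita UNIV V p ?N) ?N = 0"
    by (rule levi_civita_normal_horizontal[OF difV W TV VV Nform])
  have N1: "hmetric p ?N ?N = 1" by (rule unit_rgrad_unit[OF dif[OF W(2)] ne[OF W(2)]])
  have sum: "hdiv V p = (\<Sum>e\<in>B. hmetric p (levi_civita (frontier \<Omega>) (horizontal_normal \<Omega>) p e) e)"
    if B: "orthonormal_basis p (tangent_space (frontier \<Omega>) p) B" for B
  proof -
    have fB: "finite B" and spB: "span B = {v. ?D v = 0}"
      and onB: "\<And>e e'. e \<in> B \<Longrightarrow> e' \<in> B \<Longrightarrow> hmetric p e e' = (if e = e' then 1 else 0)"
      using B by (auto simp: orthonormal_basis_def kernel)
    have BD: "?D e = 0" if "e \<in> B" for e using spB span_base[OF that] by auto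
    have Ne: "hmetric p ?N e = 0" "hmetric p e ?N = 0" if "e \<in> B" for e
      using hmetric_unit_rgrad[OF dif[OF W(2)]] BD[OF that] hmetric_commute[of p] by auto
    have NB: "?N \<notin> B" using Ne(1)[of ?N] N1 by auto
    have ob: "orthonormal_basis p UNIV (insert ?N B)"
      unfolding orthonormal_basis_def
    proof (intro conjI ballI)
      show "finite (insert ?N B)" using fB by simp
      show "hmetric p e e' = (if e = e' then 1 else 0)" if "e \<in> insert ?N B" "e' \<in> insert ?N B" for e e'
        using that onB Ne N1 NB by (metis insert_iff)
      show "span (insert ?N B) = UNIV"
      proof (intro set_eqI iffI UNIV_I)
        fix v
        let ?w = "v - hmetric p ?N v *\<^sub>R ?N"
        have "hmetric p ?N ?w = 0"
          by (simp add: linear_diff[OF hmetric_linear(1)] linear_scale[OF hmetric_linear(1)] N1)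
        then have "?D ?w = 0"
          using hmetric_unit_rgrad[OF dif[OF W(2)], of ?w] hnorm_pos[OF rgrad_nonzero[OF dif[OF W(2)] ne[OF W(2)]], of p] by simp
        then have "?w \<in> span B" using spB by auto
        then have "?w \<in> span (insert ?N B)" using span_mono[of B "insert ?N B"] by auto
        moreover have "hmetric p ?N v *\<^sub>R ?N \<in> span (insert ?N B)" by (intro span_scale span_base) simp
        ultimately have "?w + hmetric p ?N v *\<^sub>R ?N \<in> span (insert ?N B)" by (rule span_add)
        then show "v \<in> span (insert ?N B)" by simp
      qed
    qed
    have "hdiv V p = (\<Sum>e\<in>insert ?N B. hmetric p (levi_civita UNIV V p e) e)"
      unfolding hdiv_eq_trace[OF difV] by (rule trace_orthonormal_basis[OF ob levi_civita_linear[OF difV], symmetric])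
    also have "\<dots> = (\<Sum>e\<in>B. hmetric p (levi_civita UNIV V p e) e)"
      using fB NB NN0 by simp
    also have "\<dots> = (\<Sum>e\<in>B. hmetric p (levi_civita (frontier \<Omega>) (horizontal_normal \<Omega>) p e) e)"
    proof (rule sum.cong[OF refl])
      fix e assume "e \<in> B"
      then have et: "e \<in> tangent_space (frontier \<Omega>) p" using BD kernel by auto
      have "frechet_derivative (horizontal_normal \<Omega>) (at p within frontier \<Omega>) e = frechet_derivative V (at p) e"
        by (rule frechet_derivative_within_tangent[OF dV W p Veq et])
      then show "hmetric p (levi_civita UNIV V p e) e
          = hmetric p (levi_civita (frontier \<Omega>) (horizontal_normal \<Omega>) p e) e"
        by (simp add: levi_civita_def Veq[OF W(2) p])
    qed
    finally show ?thesis .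
  qed
  obtain B where B: "orthonormal_basis p (tangent_space (frontier \<Omega>) p) B"
    using orthonormal_basis_exists[OF sub, of p] unfolding kernel by (elim exE)
  have "surface_div (frontier \<Omega>) (horizontal_normal \<Omega>) p = hdiv V p"
    unfolding surface_div_def
  proof (rule the_equality)
    show "\<forall>B. orthonormal_basis p (tangent_space (frontier \<Omega>) p) B \<longrightarrow>
        hdiv V p = (\<Sum>e\<in>B. hmetric p (levi_civita (frontier \<Omega>) (horizontal_normal \<Omega>) p e) e)"
      using sum by blast
  qed (use B sum in auto)
  moreover have "hdiv V p = - hdiv ?\<nu> p"
  proof -
    have "(?\<nu> has_derivative frechet_derivative ?\<nu> (at p)) (at p)" by (rule C1_on_has_derivative[OF C1\<nu> W(2)])
    from has_derivative_minus[OF this]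
    have "frechet_derivative V (at p) = (\<lambda>v. - frechet_derivative ?\<nu> (at p) v)"
      unfolding V_def[abs_def] by (rule frechet_derivative_at[symmetric])
    then show ?thesis
      using difV C1_on_differentiable[OF C1\<nu> W(2)] by (simp add: hdiv_eq_euclidean sum_negf)
  qed
  ultimately show "hdiv ?\<nu> p = 2 * real CARD('n) * mean_curvature \<Omega> p"
    by (simp add: mean_curvature_def)
qed

section \<open>Localized deformations\<close>

lemma integral_nearly_constant:
  fixes h :: "'a::euclidean_space \<Rightarrow> real"
  assumes D: "D \<in> sets borel" "D \<subseteq> W" "emeasure lborel D = ennreal t" "0 \<le> t" and W: "open W"
    and h: "continuous_on W h" "\<And>x. x \<in> W \<Longrightarrow> \<bar>h x - \<kappa>\<bar> \<le> \<epsilon>"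
  shows "\<bar>(\<integral>x. indicator D x * h x \<partial>lborel) - \<kappa> * t\<bar> \<le> \<epsilon> * t"
proof -
  have I1: "integrable lborel (indicator D :: 'a \<Rightarrow> real)"
    using D by (intro integrable_real_indicator) auto
  have m: "measure lborel D = t" using D by (simp add: measure_def)
  have "(\<lambda>x. indicator W x *\<^sub>R h x) \<in> borel_measurable borel"
    using W h(1) by (intro borel_measurable_continuous_on_indicator) auto
  then have "(\<lambda>x. indicator D x * (indicator W x *\<^sub>R h x)) \<in> borel_measurable borel"
    using D(1) by (intro borel_measurable_times borel_measurable_indicator) auto
  moreover have "(\<lambda>x. indicator D x * (indicator W x *\<^sub>R h x)) = (\<lambda>x. indicator D x * h x)"
    using D(2) by (auto simp: indicator_def fun_eq_iff)
  ultimately have mh: "(\<lambda>x. indicator D x * h x) \<in> borel_measurable lborel" by simp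
  have b: "\<bar>indicator D x * h x - \<kappa> * indicator D x\<bar> \<le> \<epsilon> * indicator D x" for x
    using h(2)[of x] D(2) by (auto simp: indicator_def)
  have bd: "\<bar>indicator D x * h x\<bar> \<le> (\<bar>\<kappa>\<bar> + \<epsilon>) * indicator D x" for x
    using b[of x] by (auto simp: indicator_def split: if_splits)
  have Ih: "integrable lborel (\<lambda>x. indicator D x * h x)"
    by (rule Bochner_Integration.integrable_bound[OF integrable_mult_right[OF I1, of "\<bar>\<kappa>\<bar> + \<epsilon>"] mh])
       (use bd abs_ge_self order_trans in \<open>fastforce intro!: AE_I2\<close>)
  have Ik: "integrable lborel (\<lambda>x. \<kappa> * indicator D x :: real)" by (rule integrable_mult_right[OF I1])
  have "(\<integral>x. indicator D x * h x \<partial>lborel) - \<kappa> * t = (\<integral>x. indicator D x * h x - \<kappa> * indicator D x \<partial>lborel)"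
    using Ih Ik D(1) by (simp add: m)
  also have "\<bar>\<dots>\<bar> \<le> (\<integral>x. \<epsilon> * indicator D x \<partial>lborel)"
  proof -
    have "norm (\<integral>x. indicator D x * h x - \<kappa> * indicator D x \<partial>lborel) \<le> (\<integral>x. \<epsilon> * indicator D x \<partial>lborel)"
      by (rule Bochner_Integration.integral_norm_bound_integral) (use Ih Ik I1 b in auto)
    then show ?thesis by simp
  qed
  also have "\<dots> = \<epsilon> * t" using D(1) by (simp add: m)
  finally show ?thesis .
qed

text \<open>A flow supported near \<open>p\<close> that changes volume at rate one and for which the perimeter grows at a rate
  of at least \<open>\<kappa>\<close>, up to an error \<open>\<epsilon>\<close>. Arbitrary sets \<open>A\<close> that agree with \<open>\<Omega>\<close> near \<open>p\<close> are included
  so that the flow may be applied after \<open>\<Omega>\<close> has been changed elsewhere, and negative times so that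
  volume can also be removed.\<close>

definition unit_rate_variation ::
  "'n::finite heis set \<Rightarrow> 'n heis \<Rightarrow> real \<Rightarrow> real \<Rightarrow> real \<Rightarrow> ('n heis \<Rightarrow> 'n heis) \<Rightarrow>
     (real \<Rightarrow> 'n heis \<Rightarrow> 'n heis) \<Rightarrow> real \<Rightarrow> bool" where
  "unit_rate_variation \<Omega> p \<rho> \<kappa> \<epsilon> U \<phi> t\<^sub>0 \<longleftrightarrow>
    0 < t\<^sub>0 \<and> C1_on U UNIV \<and> flow_of U \<phi> \<and>
    (\<forall>x. x \<notin> ball p \<rho> \<longrightarrow> U x = 0 \<and> (\<forall>t. \<phi> t x = x)) \<and>
    (\<forall>t x. \<phi> (- t) (\<phi> t x) = x) \<and>
    (\<forall>A t. A \<in> sets borel \<longrightarrow> (\<forall>x\<in>ball p \<rho>. x \<in> A \<longleftrightarrow> x \<in> \<Omega>) \<longrightarrow> \<bar>t\<bar> < t\<^sub>0 \<longrightarrow>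
       volume_change A (\<phi> t ` A) t \<and>
       perimeter A \<le> perimeter (\<phi> t ` A) - ereal (\<kappa> * t - \<epsilon> * \<bar>t\<bar>))"

lemma unit_rate_variationD:
  assumes "unit_rate_variation \<Omega> p \<rho> \<kappa> \<epsilon> U \<phi> t\<^sub>0"
  shows "0 < t\<^sub>0" "C1_on U UNIV" "flow_of U \<phi>"
    and "x \<notin> ball p \<rho> \<Longrightarrow> U x = 0 \<and> (\<forall>t. \<phi> t x = x)"
    and "\<phi> (- t) (\<phi> t x) = x"
    and "A \<in> sets borel \<Longrightarrow> (\<forall>x\<in>ball p \<rho>. x \<in> A \<longleftrightarrow> x \<in> \<Omega>) \<Longrightarrow> \<bar>t\<bar> < t\<^sub>0 \<Longrightarrow>
       volume_change A (\<phi> t ` A) t \<and>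
       perimeter A \<le> perimeter (\<phi> t ` A) - ereal (\<kappa> * t - \<epsilon> * \<bar>t\<bar>)"
  using assms unfolding unit_rate_variation_def by blast+

text \<open>Here \<open>\<kappa> = 2nH(p)\<close> is the divergence of \<open>\<nu>\<close> at \<open>p\<close>, and the ball is so small that this divergence differs
  from \<open>\<kappa>\<close> by at most \<open>\<epsilon>\<close> on it. The set gained or lost at time \<open>t\<close> has volume \<open>\<bar>t\<bar>\<close>, so that the
  calibration inequality yields the rate \<open>\<kappa>\<close>.\<close>

lemma unit_rate_variation_exists:
  fixes \<Omega> :: "'n::finite heis set"
  assumes \<Omega>: "bounded_by_C2_hypersurface \<Omega>" and p: "p \<in> frontier \<Omega> - singular_set \<Omega>"
    and \<epsilon>: "0 < \<epsilon>" and \<rho>\<^sub>0: "0 < \<rho>\<^sub>0"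
  defines "\<kappa> \<equiv> 2 * real CARD('n) * mean_curvature \<Omega> p"
  shows "\<exists>U \<phi> t\<^sub>0. unit_rate_variation \<Omega> p \<rho>\<^sub>0 \<kappa> \<epsilon> U \<phi> t\<^sub>0"
proof -
  have pf: "p \<in> frontier \<Omega>" using p by blast
  obtain f :: "'n heis \<Rightarrow> real" and R where R: "0 < R" and f: "C2_on f (ball p R)"
    and loc: "\<forall>x\<in>ball p R. frechet_derivative f (at x) \<noteq> (\<lambda>_. 0) \<and> (x \<in> \<Omega> \<longleftrightarrow> 0 < f x) \<and> (x \<in> frontier \<Omega> \<longleftrightarrow> f x = 0)"
    using local_defining_function[OF \<Omega> pf] by (elim exE conjE)
  have ne: "frechet_derivative f (at x) \<noteq> (\<lambda>_. 0)" and inside: "x \<in> \<Omega> \<longleftrightarrow> 0 < f x"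
    and bd: "x \<in> frontier \<Omega> \<longleftrightarrow> f x = 0" if "x \<in> ball p R" for x
    using loc that by (fast, fast, fast)
  have pR: "p \<in> ball p R" using R by simp
  have "hproj p (inner_normal \<Omega> p) = inverse (hnorm p (rgrad f p)) *\<^sub>R hgrad f p"
    by (rule mean_curvature_eq_hdiv(1)[OF \<Omega> pf open_ball pR f ne inside bd])
  then have hp: "hgrad f p \<noteq> 0" using p by (auto simp: singular_set_def)
  have "continuous_on (ball p R) (hgrad f)"
    by (rule C1_on_imp_continuous_on[OF C1_on_hgrad[OF f open_ball]])
  then have o1: "open (hgrad f -` (- {0}) \<inter> ball p R)"
    using continuous_on_open_vimage[OF open_ball] by blast
  define W1 where "W1 = hgrad f -` (- {0}) \<inter> ball p R"
  have W1: "open W1" "p \<in> W1" "W1 \<subseteq> ball p R" "\<And>x. x \<in> W1 \<Longrightarrow> hgrad f x \<noteq> 0"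
    using o1 hp R by (auto simp: W1_def)
  let ?\<nu> = "outward_horizontal_normal f"
  have f1: "C2_on f W1" by (rule C2_on_subset[OF f W1(3)])
  have \<kappa>: "hdiv ?\<nu> p = \<kappa>"
    unfolding \<kappa>_def
    by (rule mean_curvature_eq_hdiv(2)[OF \<Omega> pf W1(1,2) f1]) (use ne inside bd W1(3,4) in blast)+
  have c\<nu>: "continuous_on W1 (hdiv ?\<nu>)"
    by (rule continuous_on_hdiv[OF C1_on_outward[OF f1 W1(1) W1(4)]])
  define W where "W = hdiv ?\<nu> -` {\<kappa> - \<epsilon><..<\<kappa> + \<epsilon>} \<inter> W1"
  have "open W" 
    using continuous_on_open_vimage[OF W1(1), of "hdiv ?\<nu>"] c\<nu> open_greaterThanLessThan
    unfolding W_def by metis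
  moreover have "p \<in> W" using W1(2) \<kappa> \<epsilon> by (simp add: W_def)
  ultimately obtain \<rho>' where \<rho>': "0 < \<rho>'" "ball p \<rho>' \<subseteq> W" using open_contains_ball by blast
  define \<rho> where "\<rho> = min \<rho>' \<rho>\<^sub>0"
  have \<rho>: "0 < \<rho>" "\<rho> \<le> \<rho>\<^sub>0" "ball p \<rho> \<subseteq> W" using \<rho>' \<rho>\<^sub>0 by (auto simp: \<rho>_def)
  have \<rho>1: "ball p \<rho> \<subseteq> W1" "ball p \<rho> \<subseteq> ball p R" using \<rho>(3) W1(3) by (auto simp: W_def)
  have near\<kappa>: "\<bar>hdiv ?\<nu> x - \<kappa>\<bar> \<le> \<epsilon>" if "x \<in> ball p \<rho>" for x
  proof -
    have "x \<in> W" using that \<rho>(3) by blast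
    then show ?thesis by (simp add: W_def abs_le_iff)
  qed
  have f\<rho>: "C2_on f (ball p \<rho>)" by (rule C2_on_subset[OF f \<rho>1(2)])
  let ?D = "frechet_derivative f (at p)"
  have lin: "linear ?D" by (rule has_derivative_linear[OF C1_on_has_derivative[OF C2_on_imp_C1_on[OF f] pR]])
  obtain e where e: "norm e = 1" "?D e < 0"
  proof -
    obtain u where u: "?D u \<noteq> 0" using ne[OF pR] by (metis ext)
    then have nu: "0 < norm u" using linear_0[OF lin] by (metis zero_less_norm_iff)
    show ?thesis
    proof (rule that)
      show "norm ((- sgn (?D u) / norm u) *\<^sub>R u) = 1" using u nu by (simp add: abs_sgn_eq)
      have "?D ((- sgn (?D u) / norm u) *\<^sub>R u) = - (\<bar>?D u\<bar> / norm u)"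
        unfolding linear_scale[OF lin] using abs_sgn[of "?D u"] by (simp add: mult.commute)
      then show "?D ((- sgn (?D u) / norm u) *\<^sub>R u) < 0" using u nu by simp
    qed
  qed
  have fp: "f p = 0" using bd[OF pR] pf by simp
  have "C1_on f (ball p (\<rho> / 2))"
    by (rule C1_on_subset[OF C2_on_imp_C1_on[OF f\<rho>]]) (use \<rho> in auto)
  from positive_set_subgraph[OF this _ fp e] \<rho>(1)
  obtain \<delta> r where r: "0 < r" "r \<le> \<delta>" and \<delta>: "4 * \<delta> < \<rho> / 2"
    and sub: "\<And>A. \<forall>x\<in>ball p (\<rho> / 2). x \<in> A \<longleftrightarrow> 0 < f x \<Longrightarrow> subgraph_near p e r \<delta> A"
    by auto
  obtain U :: "'n heis \<Rightarrow> 'n heis" and \<phi> t\<^sub>0 where U: "0 < t\<^sub>0" "C1_on U UNIV" "flow_of U \<phi>"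
    and supp: "\<And>x. x \<notin> ball p (4 * \<delta>) \<Longrightarrow> U x = 0 \<and> (\<forall>t. \<phi> t x = x)"
    and inv: "\<And>t x. \<phi> (- t) (\<phi> t x) = x"
    and step: "\<And>A t. A \<in> sets borel \<Longrightarrow> subgraph_near p e r \<delta> A \<Longrightarrow> \<bar>t\<bar> < t\<^sub>0 \<Longrightarrow>
       volume_change A (\<phi> t ` A) t"
    using unit_rate_flow_exists[OF e(1) r] by metis
  have ball4: "ball p (4 * \<delta>) \<subseteq> ball p \<rho>" "ball p (4 * \<delta>) \<subseteq> ball p \<rho>\<^sub>0" using \<delta> \<rho> by (auto intro!: subset_ball)
  have off: "x \<in> \<phi> t ` A \<longleftrightarrow> x \<in> A" if x: "x \<notin> ball p (4 * \<delta>)" for x t A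
  proof
    assume "x \<in> A"
    then show "x \<in> \<phi> t ` A" using supp[OF x] by (metis imageI)
  next
    assume "x \<in> \<phi> t ` A"
    then obtain z where z: "z \<in> A" "x = \<phi> t z" by blast
    then have "z = \<phi> (- t) x" using inv by simp
    then show "x \<in> A" using z supp[OF x] by simp
  qed
  have per: "perimeter A \<le> perimeter (\<phi> t ` A) - ereal (\<kappa> * t - \<epsilon> * \<bar>t\<bar>)"
    if A: "A \<in> sets borel" "\<forall>x\<in>ball p \<rho>\<^sub>0. x \<in> A \<longleftrightarrow> x \<in> \<Omega>" and t: "\<bar>t\<bar> < t\<^sub>0"
      and st: "volume_change A (\<phi> t ` A) t" for A t
  proof -
    note st = st[unfolded volume_change_def]
    let ?c = "\<integral>x. (indicator (\<phi> t ` A) x - indicator A x) * hdiv ?\<nu> x \<partial>lborel"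
    have "perimeter A \<le> perimeter (\<phi> t ` A) - ereal ?c"
    proof (rule perimeter_calibration_le[OF f\<rho> open_ball])
      show "hgrad f x \<noteq> 0" if "x \<in> ball p \<rho>" for x using that \<rho>1 W1(4) by blast
      show "x \<in> A \<longleftrightarrow> 0 < f x" if "x \<in> ball p \<rho>" for x 
      proof -
        have "x \<in> ball p \<rho>\<^sub>0" "x \<in> ball p R" using that \<rho>(2) \<rho>1(2) by auto
        then show ?thesis using A(2) inside by blast
      qed
      show "cball p (\<rho> / 2) \<subseteq> ball p \<rho>" using \<rho> by auto
      show "x \<in> \<phi> t ` A \<longleftrightarrow> x \<in> A" if "x \<notin> ball p (4 * \<delta>)" for x by (rule off[OF that])
    qed (use A st \<delta> r in auto)
    also have "\<dots> \<le> perimeter (\<phi> t ` A) - ereal (\<kappa> * t - \<epsilon> * \<bar>t\<bar>)"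
    proof (rule ereal_minus_mono[OF order_refl])
      have c: "continuous_on (ball p \<rho>) (hdiv ?\<nu>)" by (rule continuous_on_subset[OF c\<nu> \<rho>1(1)])
      have "\<kappa> * t - \<epsilon> * \<bar>t\<bar> \<le> ?c"
      proof (cases "0 \<le> t")
        case True
        let ?E = "\<phi> t ` A - A"
        have sub: "?E \<subseteq> ball p \<rho>" using off[of _ t A] ball4(1) by blast
        have E: "?E \<in> sets borel" "emeasure lborel ?E = ennreal t"
          using A(1) st True unfolding vol_def by blast+
        have "indicator (\<phi> t ` A) x - indicator A x = (indicator ?E x :: real)" for x
          using st True by (auto simp: indicator_def)
        then show ?thesis
          using integral_nearly_constant[OF E(1) sub E(2) True open_ball c near\<kappa>] True by (simp add: abs_le_iff)
      next
        case False
        let ?E = "A - \<phi> t ` A"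
        have sub: "?E \<subseteq> ball p \<rho>" using off[of _ t A] ball4(1) by blast
        have t0: "t \<le> 0" "0 \<le> - t" using False by auto
        have E: "?E \<in> sets borel" "emeasure lborel ?E = ennreal (- t)"
          using A(1) st t0(1) unfolding vol_def by blast+
        have "indicator (\<phi> t ` A) x - indicator A x = - (indicator ?E x :: real)" for x
          using st False by (auto simp: indicator_def)
        then show ?thesis
          using integral_nearly_constant[OF E(1) sub E(2) t0(2) open_ball c near\<kappa>] False by (simp add: abs_le_iff)
      qed
      then show "ereal (\<kappa> * t - \<epsilon> * \<bar>t\<bar>) \<le> ereal ?c" by simp
    qed
    finally show ?thesis .
  qed
  have sg: "subgraph_near p e r \<delta> A" if "\<forall>x\<in>ball p \<rho>\<^sub>0. x \<in> A \<longleftrightarrow> x \<in> \<Omega>" for A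
  proof (rule sub, rule ballI)
    fix x assume "x \<in> ball p (\<rho> / 2)"
    then have "x \<in> ball p \<rho>" using \<rho>(1) by simp
    then have "x \<in> ball p \<rho>\<^sub>0" "x \<in> ball p R" using \<rho> \<rho>1 by auto
    then show "x \<in> A \<longleftrightarrow> 0 < f x" using that inside by blast
  qed
  show ?thesis
    unfolding unit_rate_variation_def
  proof (intro exI[of _ U] exI[of _ \<phi>] exI[of _ t\<^sub>0] conjI allI impI)
    fix A t assume A: "A \<in> sets borel" "\<forall>x\<in>ball p \<rho>\<^sub>0. x \<in> A \<longleftrightarrow> x \<in> \<Omega>" and t: "\<bar>t\<bar> < t\<^sub>0"
    note st = step[OF A(1) sg[OF A(2)] t]
    show "volume_change A (\<phi> t ` A) t" by (rule st)
    show "perimeter A \<le> perimeter (\<phi> t ` A) - ereal (\<kappa> * t - \<epsilon> * \<bar>t\<bar>)" by (rule per[OF A t st])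
  next
    show "U x = 0" "\<phi> t x = x" if "x \<notin> ball p \<rho>\<^sub>0" for x t using supp[of x] that ball4 by blast+
  qed (use U inv in auto)
qed

section \<open>Two-point variations\<close>

lemma perimeter_nonneg: "0 \<le> perimeter \<Omega>"
proof -
  have "C1c_field (\<lambda>_. 0 :: 'a heis)"
    by (rule C1c_field_compact_support[OF C1_on_const compact_empty]) simp
  then have "ereal (LINT p:\<Omega>|lborel. hdiv (\<lambda>_. 0 :: 'a heis) p) \<le> perimeter \<Omega>"
    unfolding perimeter_def
    by (intro SUP_upper) (simp add: horizontal_def hproj_eq_self_iff linear_0[OF Tcoeff_linear] hnorm_eq_norm linear_0[OF frame_coords_linear])
  moreover have "(LINT p:\<Omega>|lborel. hdiv (\<lambda>_. 0 :: 'a heis) p) = 0"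
    by (simp add: hdiv_eq_euclidean set_lebesgue_integral_def)
  ultimately show ?thesis by (simp add: zero_ereal_def)
qed

text \<open>If the curvature were larger at \<open>p\<close>, the flow that adds volume near \<open>p\<close> while removing the same amount
  near \<open>q\<close> would preserve volume, and the perimeter would satisfy
  \<open>P(t) \<ge> P(0) + (\<kappa>\<^sub>p - \<kappa>\<^sub>q - 2 \<epsilon>) t\<close> for small \<open>t > 0\<close>, contrary to \<open>P'(0) = 0\<close>.\<close>

lemma mean_curvature_le:
  fixes \<Omega> :: "'n::finite heis set"
  assumes fin: "finite_perimeter \<Omega>" and \<Omega>: "bounded_by_C2_hypersurface \<Omega>" and stat: "stationary \<Omega>"
    and p: "p \<in> frontier \<Omega> - singular_set \<Omega>" and q: "q \<in> frontier \<Omega> - singular_set \<Omega>"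
  shows "mean_curvature \<Omega> p \<le> mean_curvature \<Omega> q"
proof (rule ccontr)
  assume "\<not> ?thesis"
  then have lt: "mean_curvature \<Omega> q < mean_curvature \<Omega> p" by simp
  define \<kappa>p where "\<kappa>p = 2 * real CARD('n) * mean_curvature \<Omega> p"
  define \<kappa>q where "\<kappa>q = 2 * real CARD('n) * mean_curvature \<Omega> q"
  \<comment> \<open>Two errors \<open>\<epsilon>\<close> arise, one from each flow, and half of the difference of the rates remains.\<close>
  define \<epsilon> where "\<epsilon> = (\<kappa>p - \<kappa>q) / 4"
  have \<epsilon>: "0 < \<epsilon>" using lt by (simp add: \<epsilon>_def \<kappa>p_def \<kappa>q_def)
  define \<rho> where "\<rho> = dist p q / 2"
  have "p \<noteq> q" using lt by auto
  then have \<rho>: "0 < \<rho>" by (simp add: \<rho>_def)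
  have disj: "x \<notin> ball q \<rho>" if "x \<in> ball p \<rho>" for x
    using that dist_triangle_half_l[of p x "dist p q" q] by (auto simp: \<rho>_def dist_commute) 
  have bor: "\<Omega> \<in> sets borel" and perfin: "perimeter \<Omega> < \<infinity>" using fin by (auto simp: finite_perimeter_def)
  obtain U \<phi> t1 where var: "unit_rate_variation \<Omega> p \<rho> \<kappa>p \<epsilon> U \<phi> t1"
    using unit_rate_variation_exists[OF \<Omega> p \<epsilon> \<rho>, folded \<kappa>p_def] by (elim exE)
  note U = unit_rate_variationD(1-3)[OF var] and supp = unit_rate_variationD(4)[OF var]
    and inv = unit_rate_variationD(5)[OF var] and step = unit_rate_variationD(6)[OF var]
  obtain U' \<phi>' t2 where var': "unit_rate_variation \<Omega> q \<rho> \<kappa>q \<epsilon> U' \<phi>' t2"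
    using unit_rate_variation_exists[OF \<Omega> q \<epsilon> \<rho>, folded \<kappa>q_def] by (elim exE)
  note U' = unit_rate_variationD(1-3)[OF var'] and supp' = unit_rate_variationD(4)[OF var']
    and inv' = unit_rate_variationD(5)[OF var'] and step' = unit_rate_variationD(6)[OF var']
  have zero: "\<phi> 0 x = x" "\<phi>' 0 x = x" for x
    using U(3) U'(3) unfolding flow_of_def by blast+
  have deriv: "((\<lambda>s. \<phi> s x) has_vector_derivative U (\<phi> t x)) (at t)"
     "((\<lambda>s. \<phi>' s x) has_vector_derivative U' (\<phi>' t x)) (at t)" for x t
    using U(3) U'(3) unfolding flow_of_def by blast+
  define V where "V x = U x - U' x" for x
  \<comment> \<open>The supports are disjoint, so the composition is the flow of the difference of the two fields.\<close>
  define \<psi> where "\<psi> t x = \<phi> t (\<phi>' (- t) x)" for t x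
  have stay: "\<phi> t x \<in> ball p \<rho>" if "x \<in> ball p \<rho>" for t x
    using supp[of "\<phi> t x"] inv[of t x] that by metis
  have stay': "\<phi>' t x \<notin> ball p \<rho>" if "x \<notin> ball p \<rho>" for t x
  proof (cases "x \<in> ball q \<rho>")
    case True
    have "\<phi>' t x \<in> ball q \<rho>" using supp'[of "\<phi>' t x"] inv'[of t x] True by metis
    then show ?thesis using disj by blast
  qed (use supp' that in auto)
  have C1V: "C1_on V UNIV" unfolding V_def by (rule C1_on_diff[OF U(2) U'(2)])
  have cV: "C1c_field V"
    by (rule C1c_field_compact_support[OF C1V compact_Un[OF compact_cball[of p \<rho>] compact_cball[of q \<rho>]]])
       (use supp supp' in \<open>auto simp: V_def\<close>)
  have fl: "flow_of V \<psi>"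
    unfolding flow_of_def
  proof (intro conjI allI)
    fix x t
    show "\<psi> 0 x = x" by (simp add: \<psi>_def zero)
    show "((\<lambda>s. \<psi> s x) has_vector_derivative V (\<psi> t x)) (at t)"
    proof (cases "x \<in> ball p \<rho>")
      case True
      have "\<psi> s x = \<phi> s x" for s using supp'[OF disj[OF True]] by (simp add: \<psi>_def)
      moreover have "V (\<phi> t x) = U (\<phi> t x)" using supp'[OF disj[OF stay[OF True]]] by (simp add: V_def)
      ultimately show ?thesis using deriv(1)[of x t] by simp
    next
      case False
      have 1: "\<psi> s x = \<phi>' (- s) x" for s using supp[OF stay'[OF False]] by (simp add: \<psi>_def)
      have 2: "V (\<phi>' (- t) x) = - U' (\<phi>' (- t) x)" using supp[OF stay'[OF False]] by (simp add: V_def)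
      have "((\<lambda>s. \<phi>' s x) has_vector_derivative U' (\<phi>' (- t) x)) (at (- t))" by (rule deriv(2))
      moreover have "((\<lambda>s. - s) has_vector_derivative -1) (at t)"
        by (auto simp: has_real_derivative_iff_has_vector_derivative[symmetric] intro!: derivative_eq_intros)
      ultimately have "((\<lambda>s. \<phi>' (- s) x) has_vector_derivative - U' (\<phi>' (- t) x)) (at t)"
        using vector_diff_chain_at[of "\<lambda>s. - s" "-1" t "\<lambda>s. \<phi>' s x"] by (simp add: o_def)
      then show ?thesis by (simp add: 1 2)
    qed
  qed
  define t0 where "t0 = min t1 t2"
  have t0: "0 < t0" using U U' by (simp add: t0_def)
  define B where "B t = \<phi>' (- t) ` \<Omega>" for t
  have B: "B t \<in> sets borel" "0 \<le> t \<Longrightarrow> B t \<subseteq> \<Omega> \<and> vol (\<Omega> - B t) = ennreal t"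
     "t \<le> 0 \<Longrightarrow> \<Omega> \<subseteq> B t \<and> vol (B t - \<Omega>) = ennreal (- t)"
     "perimeter \<Omega> \<le> perimeter (B t) - ereal (- \<kappa>q * t - \<epsilon> * \<bar>t\<bar>)" if "\<bar>t\<bar> < t0" for t
    using step'[OF bor, of "- t"] that by (auto simp: B_def t0_def volume_change_def)
  have Bp: "\<forall>x\<in>ball p \<rho>. x \<in> B t \<longleftrightarrow> x \<in> \<Omega>" for t
  proof (intro ballI iffI)
    fix x assume x: "x \<in> ball p \<rho>"
    note triv = supp'[OF disj[OF x]]
    show "x \<in> \<Omega> \<Longrightarrow> x \<in> B t" unfolding B_def using triv by (metis imageI)
    assume "x \<in> B t"
    then obtain z where z: "z \<in> \<Omega>" "x = \<phi>' (- t) z" by (auto simp: B_def)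
    then have "z = \<phi>' t x" using inv'[of "- t" z] by simp
    then show "x \<in> \<Omega>" using z triv by simp
  qed
  have \<psi>im: "\<psi> t ` \<Omega> = \<phi> t ` B t" for t by (auto simp: \<psi>_def B_def)
  have S: "\<psi> t ` \<Omega> \<in> sets borel" "0 \<le> t \<Longrightarrow> B t \<subseteq> \<psi> t ` \<Omega> \<and> vol (\<psi> t ` \<Omega> - B t) = ennreal t"
     "t \<le> 0 \<Longrightarrow> \<psi> t ` \<Omega> \<subseteq> B t \<and> vol (B t - \<psi> t ` \<Omega>) = ennreal (- t)"
     "perimeter (B t) \<le> perimeter (\<psi> t ` \<Omega>) - ereal (\<kappa>p * t - \<epsilon> * \<bar>t\<bar>)" if "\<bar>t\<bar> < t0" for t
    using step[OF B(1)[OF that] Bp, of t] that by (auto simp: \<psi>im t0_def volume_change_def)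
  have split: "vol Y = vol X + vol (Y - X)" if "X \<in> sets borel" "Y \<in> sets borel" "X \<subseteq> Y" for X Y :: "'n heis set"
    using plus_emeasure[of X lborel "Y - X"] that by (simp add: vol_def Un_absorb1)
  have \<psi>0: "\<psi> 0 ` \<Omega> = \<Omega>" by (simp add: \<psi>_def zero)
  have vp: "volume_preserving \<psi> \<Omega>"
    unfolding volume_preserving_def
  proof (intro exI[of _ t0] conjI allI impI)
    fix t assume t: "\<bar>t\<bar> < t0"
    show "vol (\<psi> t ` \<Omega>) = vol (\<psi> 0 ` \<Omega>)"
    proof (cases "0 \<le> t")
      case True
      show ?thesis
        using split[OF B(1)[OF t] S(1)[OF t]] split[OF B(1)[OF t] bor] B(2)[OF t True] S(2)[OF t True] \<psi>0 by simp
    next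
      case False
      then have f: "t \<le> 0" by simp
      have "vol (\<psi> t ` \<Omega>) + ennreal (- t) = vol \<Omega> + ennreal (- t)"
        using split[OF S(1)[OF t] B(1)[OF t]] split[OF bor B(1)[OF t]] B(3)[OF t f] S(3)[OF t f] by simp
      then show ?thesis using \<psi>0 by simp
    qed
  qed (rule t0)
  from stat cV fl vp have ev: "\<forall>\<^sub>F t in nhds 0. perimeter (\<psi> t ` \<Omega>) < \<infinity>"
    and der: "((\<lambda>t. real_of_ereal (perimeter (\<psi> t ` \<Omega>))) has_real_derivative 0) (at 0)"
    unfolding stationary_def by blast+
  define P where "P t = real_of_ereal (perimeter (\<psi> t ` \<Omega>))" for t
  have grow: "P 0 + 2 * \<epsilon> * t \<le> P t" if t: "0 < t" "t < t0" and pf: "perimeter (\<psi> t ` \<Omega>) < \<infinity>" for t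
  proof -
    have t': "\<bar>t\<bar> < t0" using t by simp
    obtain a where a: "perimeter \<Omega> = ereal a"
      using perfin perimeter_nonneg[of \<Omega>] by (cases "perimeter \<Omega>") auto
    obtain c where c: "perimeter (\<psi> t ` \<Omega>) = ereal c"
      using pf perimeter_nonneg[of "\<psi> t ` \<Omega>"] by (cases "perimeter (\<psi> t ` \<Omega>)") auto
    obtain b where b: "perimeter (B t) = ereal b"
      using S(4)[OF t'] c perimeter_nonneg[of "B t"] by (cases "perimeter (B t)") auto
    have "a \<le> b - (- \<kappa>q * t - \<epsilon> * t)" "b \<le> c - (\<kappa>p * t - \<epsilon> * t)"
      using B(4)[OF t'] S(4)[OF t'] a b c t by auto
    then have "a + (\<kappa>p - \<kappa>q - 2 * \<epsilon>) * t \<le> c" by (simp add: algebra_simps)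
    moreover have "\<kappa>p - \<kappa>q = 4 * \<epsilon>" by (simp add: \<epsilon>_def)
    ultimately show ?thesis using a c by (simp add: P_def \<psi>0)
  qed
  have "((\<lambda>t. (P t - P 0) / t) \<longlongrightarrow> 0) (at_right 0)"
  proof (rule filterlim_mono[OF _ order_refl at_le[OF subset_UNIV]])
    show "((\<lambda>t. (P t - P 0) / t) \<longlongrightarrow> 0) (at 0)"
      using der by (simp add: has_field_derivative_iff P_def[abs_def])
  qed
  moreover have "\<forall>\<^sub>F t in at_right 0. 2 * \<epsilon> \<le> (P t - P 0) / t"
  proof -
    have "\<forall>\<^sub>F t in at_right 0. perimeter (\<psi> t ` \<Omega>) < \<infinity>"
      using ev by (simp add: eventually_at_filter eventually_mono)
    moreover have "\<forall>\<^sub>F t in at_right (0::real). 0 < t \<and> t < t0"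
      unfolding eventually_at_right_field using t0 by auto
    ultimately show ?thesis
    proof eventually_elim
      case (elim t)
      then show ?case using grow[of t] by (simp add: field_simps)
    qed
  qed
  ultimately have "2 * \<epsilon> \<le> 0"
    by (intro tendsto_lowerbound) auto
  then show False using \<epsilon> by simp
qed

theorem corollary3p4:
  fixes \<Omega> :: "'n::finite heis set"
  assumes "finite_perimeter \<Omega>"
    and "bounded_by_C2_hypersurface \<Omega>"
    and "stationary \<Omega>"
  shows "constant_mean_curvature \<Omega>"
  unfolding constant_mean_curvature_def
  using mean_curvature_le[OF assms] by (metis order_antisym)

end
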